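(* Let $q\in\mathbb{C}$ be a primitive cube root of unity ($r=3$) and let $\mathrm{Max}=\delta\mathrm{d}:\Omega^1\to\Omega^1$ be the Maxwell operator on the reduced quantum group $\mathcal{A}=\mathbb{C}_q[SL_2]$. Let $E=\mathrm{d}\Omega^0$ be the space of exact 1-forms, so that $\ker\mathrm{Max}/E$ is 28-dimensional. Then the subspace of $\ker\mathrm{Max}/E$ of classes of $A$ with self-dual curvature ($\star\mathrm{d}A=\mathrm{d}A$) is 16-dimensional, and the subspace of classes of $A$ with antiself-dual curvature ($\star\mathrm{d}A=-\mathrm{d}A$) is 16-dimensional. Every element of $\ker\mathrm{Max}$ is, modulo $E$, the sum of an element with self-dual curvature and an element with antiself-dual curvature, and the intersection of the two 16-dimensional subspaces is the 4-dimensional space of classes with zero curvature.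
   Context: Here $q^3=1$, $q\ne1$, $\mu=1-q^{-2}$. $\mathcal{A}$ is the unital $\mathbb{C}$-algebra generated by $a,b,c,d$ with relations $ba=qab$, $ca=qac$, $db=qbd$, $dc=qcd$, $cb=bc$, $da-ad=q\mu bc$, $ad-q^{-1}bc=1$, $a^3=d^3=1$, $b^3=c^3=0$. It has dimension 27 with basis $\{a^mb^nc^k\}_{0\le m,n,k\le2}$. $\Lambda$ is the graded algebra generated by degree-1 elements $e_a,e_b,e_c,e_d$ with relations: $e_b,e_c,e_d$ pairwise anticommute and square to zero; $e_a\wedge e_a=\mu e_b\wedge e_c$; $e_a\wedge e_d+e_d\wedge e_a+\mu e_b\wedge e_c=0$; $e_a\wedge e_b+q^2e_b\wedge e_a-\mu e_b\wedge e_d=0$; $e_c\wedge e_a+q^2e_a\wedge e_c+\mu e_c\wedge e_d=0$. Write $e_{ij\cdots}=e_i\wedge e_j\wedge\cdots$; bases in degrees $2,3,4$ are $\{e_{ab},e_{ac},e_{ad},e_{bc},e_{bd},e_{cd}\}$, $\{e_{abc},e_{abd},e_{acd},e_{bcd}\}$, $\{e_{abcd}\}$. $\Omega=\Lambda\otimes\mathcal{A}$ is the free right $\mathcal{A}$-module on $\Lambda$, with algebra structure given by those of $\Lambda$, $\mathcal{A}$ and the following cross relations, where $(u,v)$ is either $(a,c)$ or $(b,d)$: $ve_b=e_bv$, $ue_c=e_cu$, $ue_d=q^{-1}e_du$, $ve_d=qe_dv$, $ue_b=e_bu+q\mu e_dv$, $ve_c=e_cv+q\mu e_du$, $ve_a=q^{-1}e_av+\mu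 e_bu$, $ue_a=qe_au+\mu e_cv+q\mu^2e_du$. The exterior derivative is $\mathrm{d}\omega=-(\theta\wedge\omega-(-1)^{|\omega|}\omega\wedge\theta)$, $\theta=e_a+e_d$. The Hodge operator $\star:\Omega^i\to\Omega^{4-i}$ is the right $\mathcal{A}$-linear map with $\star1=e_{abcd}$, $\star e_{abcd}=1$, $\star e_a=-e_{abc}-\mu e_{bcd}$, $\star e_b=-e_{abd}$, $\star e_c=q^2e_{acd}$, $\star e_d=e_{bcd}$, $\star e_{ab}=-e_{ab}+2\mu e_{bd}$, $\star e_{ac}=e_{ac}$, $\star e_{ad}=\frac{1}{1+q^2}(2e_{bc}-q^2\mu e_{ad})$, $\star e_{bc}=\frac{q^2}{1+q^2}(2e_{ad}+\mu e_{bc})$, $\star e_{bd}=e_{bd}$, $\star e_{cd}=-e_{cd}$, $\star e_{abc}=-e_a-\mu e_d$, $\star e_{abd}=-e_b$, $\star e_{acd}=q^{-2}e_c$, $\star e_{bcd}=e_d$. Set $\delta=\star\circ\mathrm{d}\circ\star$. The curvature of a 1-form $A$ is $\mathrm{d}A$. *)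

theory Defs
  imports "HOL-Library.Poly_Mapping" "HOL-Algebra.QuotRing" "Jordan_Normal_Form.VS_Connect"
begin

section \<open>The free algebra on eight generators\<close>

text \<open>\<open>GA, \<dots>, GD\<close> stand for $a,b,c,d$ and \<open>EA, \<dots>, ED\<close> for $e_a,e_b,e_c,e_d$.\<close>

datatype gen = GA | GB | GC | GD | EA | EB | EC | ED

datatype word = Word "gen list"

instantiation word :: monoid_add
begin

definition zero_word :: word where "0 = Word []"

fun plus_word :: "word \<Rightarrow> word \<Rightarrow> word" where
  "Word us + Word vs = Word (us @ vs)"

instance
proof
  fix u v w :: word
  show "u + v + w = u + (v + w)" by (cases u; cases v; cases w) simp
  show "0 + u = u" by (cases u) (simp add: zero_word_def)
  show "u + 0 = u" by (cases u) (simp add: zero_word_def)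
qed

end

text \<open>Multiplication on \<^typ>\<open>word \<Rightarrow>\<^sub>0 complex\<close> is convolution, so this is the free unital
  associative complex algebra on \<^typ>\<open>gen\<close>.\<close>

type_synonym free_alg = "word \<Rightarrow>\<^sub>0 complex"

definition var :: "gen \<Rightarrow> free_alg" where
  "var g = Poly_Mapping.single (Word [g]) 1"

definition scal :: "complex \<Rightarrow> free_alg" where
  "scal z = Poly_Mapping.single 0 z"

abbreviation "xa \<equiv> var GA"
abbreviation "xb \<equiv> var GB"
abbreviation "xc \<equiv> var GC"
abbreviation "xd \<equiv> var GD"
abbreviation "ea \<equiv> var EA"
abbreviation "eb \<equiv> var EB"
abbreviation "ec \<equiv> var EC"
abbreviation "ed \<equiv> var ED"

section \<open>The algebra of differential forms\<close>

definition mu :: "complex \<Rightarrow> complex" where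
  "mu q = 1 - 1 / q ^ 2"

text \<open>A pair \<open>(l, r)\<close> below encodes the relation \<open>l = r\<close>.\<close>

definition function_relations :: "complex \<Rightarrow> (free_alg \<times> free_alg) set" where
  "function_relations q =
    {(xb * xa, scal q * xa * xb),
     (xc * xa, scal q * xa * xc),
     (xd * xb, scal q * xb * xd),
     (xd * xc, scal q * xc * xd),
     (xc * xb, xb * xc),
     (xd * xa - xa * xd, scal (q * mu q) * xb * xc),
     (xa * xd - scal (1 / q) * xb * xc, 1),
     (xa ^ 3, 1), (xd ^ 3, 1), (xb ^ 3, 0), (xc ^ 3, 0)}"

definition exterior_relations :: "complex \<Rightarrow> (free_alg \<times> free_alg) set" where
  "exterior_relations q =
    {(x * y + y * x, 0) | x y. x \<in> {eb, ec, ed} \<and> y \<in> {eb, ec, ed} \<and> x \<noteq> y} \<union>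
    {(x * x, 0) | x. x \<in> {eb, ec, ed}} \<union>
    {(ea * ea, scal (mu q) * eb * ec),
     (ea * ed + ed * ea + scal (mu q) * eb * ec, 0),
     (ea * eb + scal (q ^ 2) * eb * ea - scal (mu q) * eb * ed, 0),
     (ec * ea + scal (q ^ 2) * ea * ec + scal (mu q) * ec * ed, 0)}"

definition cross_relations :: "complex \<Rightarrow> (free_alg \<times> free_alg) set" where
  "cross_relations q = (\<Union>(u, v) \<in> {(xa, xc), (xb, xd)}.
    {(v * eb, eb * v),
     (u * ec, ec * u),
     (u * ed, scal (1 / q) * ed * u),
     (v * ed, scal q * ed * v),
     (u * eb, eb * u + scal (q * mu q) * ed * v),
     (v * ec, ec * v + scal (q * mu q) * ed * u),
     (v * ea, scal (1 / q) * ea * v + scal (mu q) * eb * u),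
     (u * ea, scal q * ea * u + scal (mu q) * ec * v + scal (q * (mu q) ^ 2) * ed * u)})"

definition rel_ideal :: "complex \<Rightarrow> free_alg set" where
  "rel_ideal q = Idl\<^bsub>class_ring\<^esub>
    ((\<lambda>(l, r). l - r) ` (function_relations q \<union> exterior_relations q \<union> cross_relations q))"

text \<open>The class of a noncommutative polynomial in the presented algebra.\<close>

definition cls :: "complex \<Rightarrow> free_alg \<Rightarrow> free_alg set" where
  "cls q x = rel_ideal q +>\<^bsub>class_ring\<^esub> x"

text \<open>The algebra $\Omega = \Lambda \otimes \mathcal{A}$, presented by the generators of $\Lambda$
  and $\mathcal{A}$, their relations, and the cross relations. The cross relations move functions
  to the right of the $e_i$, which is the identification with the right $\mathcal{A}$-module
  $\Lambda \otimes \mathcal{A}$.\<close>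

definition Omega :: "complex \<Rightarrow> (complex, free_alg set) module" where
  "Omega q = (let R = (class_ring :: free_alg ring) Quot rel_ideal q in
    \<lparr>carrier = carrier R, mult = mult R, one = one R, zero = zero R, add = add R,
     smult = (\<lambda>z X. cls q (scal z) \<otimes>\<^bsub>R\<^esub> X)\<rparr>)"

definition Fun_alg :: "complex \<Rightarrow> free_alg set set" where
  "Fun_alg q = cls q ` {x. Poly_Mapping.keys x \<subseteq> Word ` lists {GA, GB, GC, GD}}"

text \<open>$\Omega^i = \Lambda^i \mathcal{A}$: combinations of words consisting of $i$ letters among
  the $e_j$ followed by letters among $a,b,c,d$.\<close>

definition Forms :: "complex \<Rightarrow> nat \<Rightarrow> free_alg set set" where
  "Forms q i = cls q ` {x. Poly_Mapping.keys x \<subseteq>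
     {Word (us @ vs) | us vs. us \<in> lists {EA, EB, EC, ED} \<and> length us = i \<and>
                              vs \<in> lists {GA, GB, GC, GD}}}"

definition theta :: "complex \<Rightarrow> free_alg set" where
  "theta q = cls q (ea + ed)"

text \<open>The exterior derivative on forms of degree \<open>i\<close>.\<close>

definition dext :: "complex \<Rightarrow> nat \<Rightarrow> free_alg set \<Rightarrow> free_alg set" where
  "dext q i w = \<ominus>\<^bsub>Omega q\<^esub> (theta q \<otimes>\<^bsub>Omega q\<^esub> w \<ominus>\<^bsub>Omega q\<^esub>
                  ((- 1) ^ i \<odot>\<^bsub>Omega q\<^esub> (w \<otimes>\<^bsub>Omega q\<^esub> theta q)))"

section \<open>Hodge operator and Maxwell operator\<close>

definition hodge_values :: "complex \<Rightarrow> (free_alg \<times> free_alg) set" where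
  "hodge_values q =
    {(1, ea * eb * ec * ed),
     (ea * eb * ec * ed, 1),
     (ea, - (ea * eb * ec) - scal (mu q) * eb * ec * ed),
     (eb, - (ea * eb * ed)),
     (ec, scal (q ^ 2) * ea * ec * ed),
     (ed, eb * ec * ed),
     (ea * eb, - (ea * eb) + scal (2 * mu q) * eb * ed),
     (ea * ec, ea * ec),
     (ea * ed, scal (1 / (1 + q ^ 2)) * (scal 2 * eb * ec - scal (q ^ 2 * mu q) * ea * ed)),
     (eb * ec, scal (q ^ 2 / (1 + q ^ 2)) * (scal 2 * ea * ed + scal (mu q) * eb * ec)),
     (eb * ed, eb * ed),
     (ec * ed, - (ec * ed)),
     (ea * eb * ec, - ea - scal (mu q) * ed),
     (ea * eb * ed, - eb),
     (ea * ec * ed, scal (1 / q ^ 2) * ec),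
     (eb * ec * ed, ed)}"

text \<open>The operators \<open>\<Omega>\<^sup>i \<rightarrow> \<Omega>\<^sup>4\<^sup>-\<^sup>i\<close> are bundled into one map on \<open>\<Omega>\<close>, which is set to
  \<^const>\<open>undefined\<close> outside the carrier so that it is determined as a HOL function.\<close>

definition is_hodge :: "complex \<Rightarrow> (free_alg set \<Rightarrow> free_alg set) \<Rightarrow> bool" where
  "is_hodge q S \<longleftrightarrow>
     S \<in> extensional (carrier (Omega q)) \<and>
     (\<forall>i\<le>4. S \<in> Forms q i \<rightarrow> Forms q (4 - i)) \<and>
     (\<forall>v\<in>carrier (Omega q). \<forall>w\<in>carrier (Omega q).
        S (v \<oplus>\<^bsub>Omega q\<^esub> w) = S v \<oplus>\<^bsub>Omega q\<^esub> S w) \<and>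
     (\<forall>w\<in>carrier (Omega q). \<forall>f\<in>Fun_alg q.
        S (w \<otimes>\<^bsub>Omega q\<^esub> f) = S w \<otimes>\<^bsub>Omega q\<^esub> f) \<and>
     (\<forall>(x, y)\<in>hodge_values q. S (cls q x) = cls q y)"

definition hodge :: "complex \<Rightarrow> free_alg set \<Rightarrow> free_alg set" where
  "hodge q = (THE S. is_hodge q S)"

text \<open>\<open>\<delta> : \<Omega>\<^sup>i \<rightarrow> \<Omega>\<^sup>i\<^sup>-\<^sup>1\<close>\<close>

definition codiff :: "complex \<Rightarrow> nat \<Rightarrow> free_alg set \<Rightarrow> free_alg set" where
  "codiff q i w = hodge q (dext q (4 - i) (hodge q w))"

definition curvature :: "complex \<Rightarrow> free_alg set \<Rightarrow> free_alg set" where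
  "curvature q A = dext q 1 A"

definition Max_op :: "complex \<Rightarrow> free_alg set \<Rightarrow> free_alg set" where
  "Max_op q A = codiff q 2 (dext q 1 A)"

definition ker_Max :: "complex \<Rightarrow> free_alg set set" where
  "ker_Max q = {A \<in> Forms q 1. Max_op q A = \<zero>\<^bsub>Omega q\<^esub>}"

definition exact_forms :: "complex \<Rightarrow> free_alg set set" where
  "exact_forms q = dext q 0 ` Forms q 0"

definition self_dual :: "complex \<Rightarrow> free_alg set set" where
  "self_dual q = {A \<in> ker_Max q. hodge q (curvature q A) = curvature q A}"

definition antiself_dual :: "complex \<Rightarrow> free_alg set set" where
  "antiself_dual q = {A \<in> ker_Max q. hodge q (curvature q A) = \<ominus>\<^bsub>Omega q\<^esub> (curvature q A)}"

definition flat :: "complex \<Rightarrow> free_alg set set" where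
  "flat q = {A \<in> ker_Max q. curvature q A = \<zero>\<^bsub>Omega q\<^esub>}"

section \<open>Quotient spaces and dimension\<close>

text \<open>Quotient of a vector space by a subspace. The ring fields \<open>mult\<close> and \<open>one\<close> of the record
  play no role in a vector space.\<close>

definition quot_space :: "('k, 'v, 'm) module_scheme \<Rightarrow> 'v set \<Rightarrow> ('k, 'v set) module"
  where "quot_space V E =
    \<lparr>carrier = a_rcosets\<^bsub>V\<^esub> E, mult = undefined, one = undefined, zero = E, add = set_add V,
     smult = (\<lambda>z X. \<Union>x\<in>X. E +>\<^bsub>V\<^esub> (z \<odot>\<^bsub>V\<^esub> x))\<rparr>"

definition has_dim :: "(complex, 'v, 'm) module_scheme \<Rightarrow> nat \<Rightarrow> bool" where
  "has_dim V n \<longleftrightarrow> vectorspace class_ring V \<and> vectorspace.fin_dim class_ring V \<and>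
                   vectorspace.dim class_ring V = n"

definition Ker_Max_space :: "complex \<Rightarrow> (complex, free_alg set) module" where
  "Ker_Max_space q = (Omega q)\<lparr>carrier := ker_Max q\<rparr>"

definition Max_quot :: "complex \<Rightarrow> (complex, free_alg set set) module" where
  "Max_quot q = quot_space (Ker_Max_space q) (exact_forms q)"

definition quot_classes :: "complex \<Rightarrow> free_alg set set \<Rightarrow> free_alg set set set" where
  "quot_classes q W = (\<lambda>A. exact_forms q +>\<^bsub>Omega q\<^esub> A) ` W"

end

theory Submission
  imports Defs
begin

text \<open>The cross relations let every form be written in the normal words $e_I a^m b^n c^k$, so these
  span $\Omega$; they are linearly independent because left multiplication by the generators on the
  432-dimensional space with this basis respects all relations. All structure constants lie in
  $\mathbb{Z}[q]$, so the remaining statements are finite computations in $\mathbb{Z}[q]$.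
  Since $\theta\wedge\theta=0$, exact forms are closed. The solutions of the Maxwell equation are read off
  from an identity of linear maps on $\Omega^1$,
  \[ 12\,A = \sum_{j<28} \langle c_j, A + \mathrm{d}A\rangle\, w_j + \mathrm{d}(hA) + g(\mathrm{Max}\,A), \]
  with explicit closed forms $w_0,\ldots,w_3$, forms $w_4,\ldots,w_{15}$ of self-dual and
  $w_{16},\ldots,w_{27}$ of antiself-dual curvature, and functionals that are biorthogonal to the $w_j$
  and vanish on exact forms. On the self-dual (antiself-dual) part the functionals of the other kind vanish.\<close>

text \<open>The algebra is a quotient of a free algebra and might collapse, so spanning by normal
  words bounds dimensions only from above; their independence is what turns tables into statements
  about dimensions. The same integer tables are therefore evaluated twice: in the quotient, where
  rewriting is shown sound, and on the free vector space on normal words, where it is shown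
  consistent. About q they use only q^2 = -1 - q, which gives 1/q = -1 - q, mu = 1 - q and 1/(1 +
  q^2) = 1 + q, so one set of evaluations serves both primitive roots. The splitting cannot be had
  by projecting. For a Maxwell potential A the two halves of dA under the Hodge operator are closed,
  but the operator acts on curvatures and not on potentials, and closedness of a 2-form does not by
  itself provide a potential. Hence the forms w_j are written down explicitly. That they solve the
  Maxwell equation then follows at once: if star dw = dw or star dw = -dw, then delta d w is, up to
  sign, star d d w = 0.\<close>

section \<open>Linear combinations over the Eisenstein integers\<close>

text \<open>\<open>(x, y) :: eis\<close> stands for \<open>x + y q\<close>, and \<open>(I, m, n, k) :: bkey\<close> for the normal word
  $e_I a^m b^n c^k$.\<close>

type_synonym eis = "int \<times> int"
type_synonym bkey = "gen list \<times> nat \<times> nat \<times> nat"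
type_synonym svec = "(bkey \<times> eis) list"

fun emul :: "eis \<Rightarrow> eis \<Rightarrow> eis" where
  "emul (x, y) (u, v) = (let w = y * v in (x * u - w, x * v + y * u - w))"

fun eadd :: "eis \<Rightarrow> eis \<Rightarrow> eis" where
  "eadd (x, y) (u, v) = (x + u, y + v)"

fun qpow :: "nat \<Rightarrow> eis" where
  "qpow 0 = (1, 0)"
| "qpow (Suc 0) = (0, 1)"
| "qpow (Suc (Suc 0)) = (-1, -1)"
| "qpow (Suc (Suc (Suc n))) = qpow n"

definition vscale :: "eis \<Rightarrow> ('k \<times> eis) list \<Rightarrow> ('k \<times> eis) list" where
  "vscale c = map (\<lambda>(k, d). (k, emul c d))"

fun vbind :: "('k \<times> eis) list \<Rightarrow> ('k \<Rightarrow> ('l \<times> eis) list) \<Rightarrow> ('l \<times> eis) list" where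
  "vbind [] f = []"
| "vbind ((k, c) # xs) f = vscale c (f k) @ vbind xs f"

fun insert_term :: "'k \<Rightarrow> eis \<Rightarrow> ('k \<times> eis) list \<Rightarrow> ('k \<times> eis) list" where
  "insert_term k c [] = [(k, c)]"
| "insert_term k c ((l, d) # xs) = (if k = l then (let e = eadd c d in if e = (0, 0) then xs else (k, e) # xs) else (l, d) # insert_term k c xs)"

text \<open>Lists produced by \<open>vbind\<close> may repeat keys; merging them and dropping zeros
  makes cancellation visible. Most finite checks below have the form \<open>collect xs = []\<close>,
  and what is drawn from it is that \<open>xs\<close> evaluates to zero.\<close>

fun collect :: "('k \<times> eis) list \<Rightarrow> ('k \<times> eis) list" where
  "collect [] = []"
| "collect ((k, c) # xs) = (if c = (0, 0) then collect xs else insert_term k c (collect xs))"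

section \<open>Normal form of a generator times a normal word\<close>

fun rank_gen :: "gen \<Rightarrow> nat" where
 "rank_gen EA = 0" | "rank_gen EB = 1" | "rank_gen EC = 2" | "rank_gen ED = 3" | "rank_gen _ = 4"

text \<open>\<open>wedge3\<close> and \<open>wedge_a\<close> multiply from the left words without $e_a$, and words $e_a e_I$ given
  by their tail \<open>I\<close>.\<close>

fun wedge3 :: "gen \<Rightarrow> gen list \<Rightarrow> (gen list \<times> eis) list" where
  "wedge3 g [] = [([g], (1,0))]"
| "wedge3 g (h # I) = (if g = h then [] else if rank_gen g < rank_gen h then [(g # h # I, (1,0))]
     else map (\<lambda>(J, c). (h # J, emul (-1,0) c)) (wedge3 g I))"

fun wedge_a :: "gen \<Rightarrow> gen list \<Rightarrow> (gen list \<times> eis) list" where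
  "wedge_a EA I = vscale (1,-1) (vbind (wedge3 EC I) (wedge3 EB))"
| "wedge_a EB I = vscale (0,-1) (map (\<lambda>(J, c). (EA # J, c)) (wedge3 EB I)) @ vscale (1,2) (vbind (wedge3 ED I) (wedge3 EB))"
| "wedge_a EC I = vscale (1,1) (map (\<lambda>(J, c). (EA # J, c)) (wedge3 EC I)) @ vscale (-1,1) (vbind (wedge3 ED I) (wedge3 EC))"
| "wedge_a ED I = vscale (-1,0) (map (\<lambda>(J, c). (EA # J, c)) (wedge3 ED I)) @ vscale (-1,1) (vbind (wedge3 EC I) (wedge3 EB))"
| "wedge_a _ I = []"

fun wedge :: "gen \<Rightarrow> gen list \<Rightarrow> (gen list \<times> eis) list" where
  "wedge g (EA # I) = wedge_a g I"
| "wedge EA I = [(EA # I, (1,0))]"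
| "wedge g I = wedge3 g I"

text \<open>The cross relations treat $(u, v) = (a, c)$ and $(b, d)$ alike.\<close>

fun partner :: "gen \<Rightarrow> gen" where
  "partner GA = GC" | "partner GC = GA" | "partner GB = GD" | "partner GD = GB" | "partner g = g"

fun is_u :: "gen \<Rightarrow> bool" where
 "is_u GA = True" | "is_u GB = True" | "is_u _ = False"

text \<open>An entry \<open>((f, h), c)\<close> stands for c f h with f among the e_i and h a
  function generator. The coefficients are q, 1/q = -1 - q, mu = 1 - q, q mu = 1 + 2 q and q mu^2 =
  3 + 3 q as integer pairs.\<close>

fun cross :: "gen \<Rightarrow> gen \<Rightarrow> ((gen \<times> gen) \<times> eis) list" where
  "cross g EA = (if is_u g then [((EA, g), (0,1)), ((EC, partner g), (1,-1)), ((ED, g), (3,3))]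
                 else [((EA, g), (-1,-1)), ((EB, partner g), (1,-1))])"
| "cross g EB = (if is_u g then [((EB, g), (1,0)), ((ED, partner g), (1,2))] else [((EB, g), (1,0))])"
| "cross g EC = (if is_u g then [((EC, g), (1,0))] else [((EC, g), (1,0)), ((ED, partner g), (1,2))])"
| "cross g ED = (if is_u g then [((ED, g), (-1,-1))] else [((ED, g), (0,1))])"
| "cross g _ = []"

text \<open>Passing one letter can change both that letter and the function generator. The new
  generator is therefore moved through the tail before the new letter is multiplied back on from the
  left, which restores the order of the word.\<close>

fun push :: "gen \<Rightarrow> gen list \<Rightarrow> ((gen list \<times> gen) \<times> eis) list" where
  "push g [] = [(([], g), (1,0))]"
| "push g (e # I) = vbind (cross g e) (\<lambda>(f, h). vbind (push h I) (\<lambda>(J, x). map (\<lambda>(K, c). ((K, x), c)) (wedge f J)))"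

fun cyc :: "nat \<Rightarrow> nat" where
 "cyc 0 = Suc 0" | "cyc (Suc 0) = Suc (Suc 0)" | "cyc (Suc (Suc n)) = 0"

text \<open>The letter d does not occur in normal words: a^3 = 1 and a d = 1 + q^(-1) b c give d =
  a^2 (1 + q^(-1) b c). Moving b and c past a^m contributes q^m each, whence the square of
  \<open>qpow m\<close>.\<close>

fun act :: "gen \<Rightarrow> nat \<times> nat \<times> nat \<Rightarrow> ((nat \<times> nat \<times> nat) \<times> eis) list" where
  "act GA (m, n, k) = [((cyc m, n, k), (1,0))]"
| "act GB (m, n, k) = (if n < Suc (Suc 0) then [((m, Suc n, k), qpow m)] else [])"
| "act GC (m, n, k) = (if k < Suc (Suc 0) then [((m, n, Suc k), qpow m)] else [])"
| "act GD (m, n, k) = ((cyc (cyc m), n, k), (1,0)) # (if n < Suc (Suc 0) \<and> k < Suc (Suc 0) then [((cyc (cyc m), Suc n, Suc k), emul (-1,-1) (emul (qpow m) (qpow m)))] else [])"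
| "act _ _ = []"

text \<open>The test \<open>rank_gen g < 4\<close> separates the one-forms e_i from the function
  generators, all of which have rank 4.\<close>

fun lmul :: "gen \<Rightarrow> bkey \<Rightarrow> svec" where
  "lmul g (I, t) = (if rank_gen g < 4 then map (\<lambda>(J, c). ((J, t), c)) (wedge g I)
     else vbind (push g I) (\<lambda>(J, x). map (\<lambda>(s, c). ((J, s), c)) (act x t)))"

definition wmul :: "gen list \<Rightarrow> svec \<Rightarrow> svec" where
  "wmul ws v = foldr (\<lambda>g v. collect (vbind v (lmul g))) ws v"

definition tkeys :: "(nat \<times> nat \<times> nat) list" where
  "tkeys = List.product [0, 1, 2] (List.product [0, 1, 2] [0, 1, 2])"
definition ekeys :: "gen list list" where
  "ekeys = [[],[EA],[EB],[EC],[ED],[EA,EB],[EA,EC],[EA,ED],[EB,EC],[EB,ED],[EC,ED],[EA,EB,EC],[EA,EB,ED],[EA,EC,ED],[EB,EC,ED],[EA,EB,EC,ED]]"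

type_synonym relt = "(gen list \<times> eis) list"
definition rel_zero :: "bkey \<Rightarrow> relt \<Rightarrow> bool" where
  "rel_zero k r = (collect (vbind r (\<lambda>w. wmul w [(k, (1,0))])) = [])"

definition fun_rels :: "relt list" where
 "fun_rels = [[([GB,GA],(1,0)),([GA,GB],(0,-1))], [([GC,GA],(1,0)),([GA,GC],(0,-1))], [([GD,GB],(1,0)),([GB,GD],(0,-1))],
   [([GD,GC],(1,0)),([GC,GD],(0,-1))], [([GC,GB],(1,0)),([GB,GC],(-1,0))], [([GD,GA],(1,0)),([GA,GD],(-1,0)),([GB,GC],(-1,-2))],
   [([GA,GD],(1,0)),([GB,GC],(1,1)),([],(-1,0))], [([GA,GA,GA],(1,0)),([],(-1,0))], [([GD,GD,GD],(1,0)),([],(-1,0))], [([GB,GB,GB],(1,0))], [([GC,GC,GC],(1,0))]]"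

section \<open>Evaluation of integer pairs and symbolic lists at the root\<close>

definition val :: "complex \<Rightarrow> eis \<Rightarrow> complex" where
  "val q c = of_int (fst c) + of_int (snd c) * q"

text \<open>A symbolic list acquires meaning only after a vector space and images of the keys are
  chosen. The locale is interpreted in the quotient algebra (\<open>om\<close>) and in the space of
  finitely supported functions on keys (\<open>pm\<close>), so each computation with lists yields an
  identity in both.\<close>

locale primitive_root = vector_space scale
  for scale :: "complex \<Rightarrow> 'v::ab_group_add \<Rightarrow> 'v" +
  fixes q :: complex
  assumes q_square: "q * q = - 1 - q"
begin

definition lsum :: "('k \<Rightarrow> 'v) \<Rightarrow> ('k \<times> eis) list \<Rightarrow> 'v" where
  "lsum f xs = (\<Sum>(k, c)\<leftarrow>xs. scale (val q c) (f k))"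

lemma val_emul: "val q (emul c d) = val q c * val q d"
proof (cases c; cases d)
  fix x y u v assume cd: "c = (x, y)" "d = (u, v)"
  have "val q c * val q d = of_int x * of_int u + (of_int x * of_int v + of_int y * of_int u) * q
      + of_int y * of_int v * (q * q)"
    by (simp add: cd val_def algebra_simps)
  also have "\<dots> = val q (emul c d)"
    unfolding q_square by (simp add: cd val_def algebra_simps Let_def)
  finally show ?thesis by simp
qed

lemma val_eadd: "val q (eadd c d) = val q c + val q d"
  by (cases c; cases d) (simp add: val_def algebra_simps)

lemma val_qpow: "val q (qpow n) = q ^ n"
proof (induction n rule: qpow.induct)
  case (4 n)
  have "q ^ Suc (Suc (Suc n)) = q * (q * q) * q ^ n" by simp
  also have "\<dots> = q ^ n" unfolding q_square by (simp add: right_diff_distrib q_square)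
  finally show ?case using 4 by simp
qed (simp_all add: val_def q_square)

lemma lsum_Nil [simp]: "lsum f [] = 0"
  by (simp add: lsum_def)

lemma lsum_Cons [simp]: "lsum f ((k, c) # xs) = scale (val q c) (f k) + lsum f xs"
  by (simp add: lsum_def)

lemma lsum_append [simp]: "lsum f (xs @ ys) = lsum f xs + lsum f ys"
  by (simp add: lsum_def)

lemma lsum_vscale [simp]: "lsum f (vscale c xs) = scale (val q c) (lsum f xs)"
  by (induction xs) (auto simp: vscale_def val_emul scale_right_distrib)

lemma lsum_vbind [simp]: "lsum f (vbind xs g) = lsum (\<lambda>k. lsum f (g k)) xs"
  by (induction xs) auto

lemma lsum_insert_term [simp]: "lsum f (insert_term k c xs) = scale (val q c) (f k) + lsum f xs"
proof (induction xs)
  case (Cons x xs)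
  have z: "scale (val q c) (f k) + scale (val q d) (f k) = 0" if "eadd c d = (0, 0)" for d
    using that val_eadd[of c d] by (simp add: scale_left_distrib[symmetric]) (simp add: val_def)
  obtain l d where x: "x = (l, d)" by (cases x)
  show ?case
  proof (cases "k = l")
    case True
    show ?thesis
    proof (cases "eadd c d = (0, 0)")
      case True
      then show ?thesis
        using z[OF True] \<open>k = l\<close> by (simp add: x Let_def add.assoc[symmetric])
    next
      case False
      then show ?thesis
        using \<open>k = l\<close> by (simp add: x Let_def val_eadd scale_left_distrib add.assoc)
    qed
  next
    case False
    then show ?thesis using Cons by (simp add: x add.left_commute)
  qed
qed simp

lemma lsum_collect [simp]: "lsum f (collect xs) = lsum f xs"
  by (induction xs) (auto simp: val_def)

lemma lsum_map_key [simp]: "lsum f (map (\<lambda>(k, c). (h k, c)) xs) = lsum (\<lambda>k. f (h k)) xs"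
  by (induction xs) auto

lemma lsum_cong: "(\<And>k c. (k, c) \<in> set xs \<Longrightarrow> f k = g k) \<Longrightarrow> lsum f xs = lsum g xs"
  unfolding lsum_def by (rule arg_cong[where f = sum_list], rule map_cong) auto

lemma lsum_linear:
  assumes "module_hom scale scale T"
  shows "T (lsum f xs) = lsum (\<lambda>k. T (f k)) xs"
proof -
  interpret module_hom scale scale T by fact
  show ?thesis by (induction xs) (auto simp: add scale)
qed

lemma lsum_in_subspace:
  assumes "subspace U" and "\<And>k c. (k, c) \<in> set xs \<Longrightarrow> f k \<in> U"
  shows "lsum f xs \<in> U"
  using assms(2)
proof (induction xs)
  case Nil
  show ?case using subspace_0[OF assms(1)] by simp
next
  case (Cons x xs)
  obtain k c where x: "x = (k, c)" by (cases x)
  have "f k \<in> U" by (rule Cons.prems[of k c]) (simp add: x)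
  moreover have "lsum f xs \<in> U"
  proof (rule Cons.IH)
    fix l d assume "(l, d) \<in> set xs"
    then show "f l \<in> U" by (intro Cons.prems[of l d]) simp
  qed
  ultimately show ?case
    unfolding x lsum_Cons using subspace_add[OF assms(1)] subspace_scale[OF assms(1)] by blast
qed

end

section \<open>The free algebra and the ideal of relations\<close>

lemma free_alg_induct [case_names single add]:
  fixes x :: "'k \<Rightarrow>\<^sub>0 'b::comm_monoid_add"
  assumes "\<And>k c. P (Poly_Mapping.single k c)"
    and "\<And>x y. P x \<Longrightarrow> P y \<Longrightarrow> P (x + y)"
  shows "P x"
proof -
  have P0: "P 0"
    using assms(1)[of undefined 0] by simp
  have "P (\<Sum>k\<in>A. Poly_Mapping.single k (Poly_Mapping.lookup x k))" if "finite A" for A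
    using that by (induction A) (auto intro: assms P0)
  moreover have "x = (\<Sum>k\<in>Poly_Mapping.keys x. Poly_Mapping.single k (Poly_Mapping.lookup x k))"
    by (rule poly_mapping_eqI) (simp add: lookup_sum lookup_single when_def in_keys_iff sum.delta)
  ultimately show ?thesis
    by (metis finite_keys)
qed

lemma scal_commute: "scal z * x = x * scal z"
  by (induction x rule: free_alg_induct)
    (simp_all add: scal_def mult_single mult.commute distrib_left distrib_right)

lemma scal_mult: "scal (z * w) = scal z * scal w"
  by (simp add: scal_def mult_single)

lemma scal_add: "scal (z + w) = scal z + scal w"
  by (simp add: scal_def single_add)

lemma scal_one [simp]: "scal 1 = 1"
  by (simp add: scal_def)

lemma scal_zero [simp]: "scal 0 = 0"
  by (simp add: scal_def)

lemma single_word: "Poly_Mapping.single (Word us) c = scal c * prod_list (map var us)"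
proof (induction us)
  case Nil
  show ?case by (simp add: scal_def zero_word_def[symmetric])
next
  case (Cons u us)
  have "Poly_Mapping.single (Word (u # us)) c = var u * Poly_Mapping.single (Word us) c"
    by (simp add: var_def mult_single)
  then show ?case
    by (simp add: Cons mult.assoc[symmetric] scal_commute[of c "var u"])
qed

abbreviation relations :: "complex \<Rightarrow> (free_alg \<times> free_alg) set" where
  "relations q \<equiv> function_relations q \<union> exterior_relations q \<union> cross_relations q"

lemma rel_ideal_ideal: "ideal (rel_ideal q) (class_ring :: free_alg ring)"
  unfolding rel_ideal_def by (rule ring.genideal_ideal[OF class_ring.ring_axioms]) simp

lemma rel_0: "0 \<in> rel_ideal q"
  using additive_subgroup.zero_closed[OF ideal.axioms(1)[OF rel_ideal_ideal]] by simp

lemma rel_add: "x \<in> rel_ideal q \<Longrightarrow> y \<in> rel_ideal q \<Longrightarrow> x + y \<in> rel_ideal q"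
  using additive_subgroup.a_closed[OF ideal.axioms(1)[OF rel_ideal_ideal], of x q y] by simp

lemma rel_lmult: "x \<in> rel_ideal q \<Longrightarrow> y * x \<in> rel_ideal q"
  using ideal.I_l_closed[OF rel_ideal_ideal, of x q y] by simp

lemma rel_rmult: "x \<in> rel_ideal q \<Longrightarrow> x * y \<in> rel_ideal q"
  using ideal.I_r_closed[OF rel_ideal_ideal, of x q y] by simp

lemma rel_minus: "x \<in> rel_ideal q \<Longrightarrow> - x \<in> rel_ideal q"
  using rel_lmult[of x q "- 1"] by simp

lemma rel_diff: "x \<in> rel_ideal q \<Longrightarrow> y \<in> rel_ideal q \<Longrightarrow> x - y \<in> rel_ideal q"
  using rel_add[OF _ rel_minus, of x q y] by simp

lemma rel_relation: "(l, r) \<in> relations q \<Longrightarrow> l - r \<in> rel_ideal q"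
  unfolding rel_ideal_def by (rule subsetD[OF ring.genideal_self[OF class_ring.ring_axioms]]) auto

text \<open>This is how elements are kept out of the ideal: with J the set of polynomials acting as
  zero on the model space, it shows that the ideal acts as zero.\<close>

lemma rel_minimal:
  assumes "0 \<in> J" "\<And>x y. x \<in> J \<Longrightarrow> y \<in> J \<Longrightarrow> x + y \<in> J"
    "\<And>x y. x \<in> J \<Longrightarrow> y * x \<in> J" "\<And>x y. x \<in> J \<Longrightarrow> x * y \<in> J"
    "\<And>l r. (l, r) \<in> relations q \<Longrightarrow> l - r \<in> J"
  shows "rel_ideal q \<subseteq> J"
  unfolding rel_ideal_def
proof (rule ring.genideal_minimal[OF class_ring.ring_axioms])
  have neg: "- x \<in> J" if "x \<in> J" for x
    using assms(3)[OF that, of "- 1"] by simp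
  show "ideal J (class_ring :: free_alg ring)"
  proof (rule idealI)
    show "ring (class_ring :: free_alg ring)" by (rule class_ring.ring_axioms)
    have inv: "inv\<^bsub>add_monoid class_ring\<^esub> a = - a" for a :: free_alg
      unfolding a_inv_def[symmetric] by (simp only: class_ring_simps)
    show "subgroup J (add_monoid (class_ring :: free_alg ring))"
      by (rule group.subgroupI) (use assms neg inv class_ring.add.is_group in auto)
  qed (use assms in auto)
qed (use assms(5) in auto)

lemma cls_eq_iff: "cls q x = cls q y \<longleftrightarrow> x - y \<in> rel_ideal q"
proof -
  have mem: "z \<in> cls q w \<longleftrightarrow> z - w \<in> rel_ideal q" for z w
  proof -
    have "z \<in> cls q w \<longleftrightarrow> (\<exists>h\<in>rel_ideal q. z = h + w)"
      by (auto simp: cls_def a_r_coset_def r_coset_def)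
    also have "\<dots> \<longleftrightarrow> z - w \<in> rel_ideal q"
      by (metis add_diff_cancel diff_add_cancel)
    finally show ?thesis .
  qed
  have swap: "y - x \<in> rel_ideal q" if "x - y \<in> rel_ideal q" for x y
    using rel_minus[OF that] by simp
  show ?thesis
  proof
    assume "cls q x = cls q y"
    then show "x - y \<in> rel_ideal q" using mem[of x x] mem[of x y] rel_0 by simp
  next
    assume xy: "x - y \<in> rel_ideal q"
    show "cls q x = cls q y"
    proof (intro Set.set_eqI iffI)
      fix z assume "z \<in> cls q x"
      then show "z \<in> cls q y" using rel_add[OF _ xy, of "z - x"] mem by simp
    next
      fix z assume "z \<in> cls q y"
      then show "z \<in> cls q x" using rel_add[OF _ swap[OF xy], of "z - y"] mem by simp
    qed
  qed
qed

section \<open>The quotient algebra as a type\<close>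

text \<open>A type cannot depend on the number \<open>q\<close>; instead it depends on a type that carries one
  of the two primitive cube roots of unity.\<close>

class cubic_root =
  fixes proot :: "'a itself \<Rightarrow> complex"
  assumes proot_cube: "proot TYPE('a) ^ 3 = 1" and proot_neq_1: "proot TYPE('a) \<noteq> 1"

quotient_type (overloaded) 'a omega =
  "free_alg" / "\<lambda>x y. x - y \<in> rel_ideal (proot TYPE('a::cubic_root))"
  morphisms rep_omega form
proof (rule equivpI)
  show "reflp (\<lambda>x y. x - y \<in> rel_ideal (proot TYPE('a)))"
    by (rule reflpI) (simp add: rel_0)
  show "symp (\<lambda>x y. x - y \<in> rel_ideal (proot TYPE('a)))"
    by (rule sympI) (metis rel_minus minus_diff_eq)
  show "transp (\<lambda>x y. x - y \<in> rel_ideal (proot TYPE('a)))"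
    by (rule transpI) (metis rel_add diff_add_cancel add_diff_eq)
qed

instantiation omega :: (cubic_root) "{ring, monoid_mult}"
begin

lift_definition zero_omega :: "'a omega" is 0 .
lift_definition one_omega :: "'a omega" is 1 .
lift_definition plus_omega :: "'a omega \<Rightarrow> 'a omega \<Rightarrow> 'a omega" is "(+)"
  by (metis rel_add add_diff_add)
lift_definition minus_omega :: "'a omega \<Rightarrow> 'a omega \<Rightarrow> 'a omega" is "(-)"
  by (metis rel_diff diff_diff_eq2 add_diff_eq diff_add_eq diff_diff_add)
lift_definition uminus_omega :: "'a omega \<Rightarrow> 'a omega" is uminus
  by (metis rel_minus minus_diff_minus)
lift_definition times_omega :: "'a omega \<Rightarrow> 'a omega \<Rightarrow> 'a omega" is "(*)"
proof -
  fix x x' y y' :: free_alg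
  assume "x - x' \<in> rel_ideal (proot TYPE('a))" "y - y' \<in> rel_ideal (proot TYPE('a))"
  then have "(x - x') * y + x' * (y - y') \<in> rel_ideal (proot TYPE('a))"
    by (intro rel_add rel_lmult rel_rmult)
  then show "x * y - x' * y' \<in> rel_ideal (proot TYPE('a))"
    by (simp add: algebra_simps)
qed

instance
  by standard (transfer; simp add: algebra_simps rel_0)+

end

section \<open>Normal words span the quotient algebra\<close>

definition sc :: "complex \<Rightarrow> 'a::cubic_root omega" where
  "sc z = form (scal z)"

definition gel :: "gen \<Rightarrow> 'a::cubic_root omega" where
  "gel g = form (var g)"

lemma form_eq_iff:
  "form x = (form y :: 'a::cubic_root omega) \<longleftrightarrow> x - y \<in> rel_ideal (proot TYPE('a))"
  by (rule omega.abs_eq_iff)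

lemma form_simps:
  "form (x + y) = form x + form y"
  "form (x - y) = form x - form y"
  "form (- x) = - form x"
  "form (x * y) = form x * form y"
  "form 0 = 0"
  "form 1 = 1"
  by (simp_all add: plus_omega.abs_eq minus_omega.abs_eq uminus_omega.abs_eq
      times_omega.abs_eq zero_omega_def one_omega_def)

lemma form_relation:
  "(l, r) \<in> relations (proot TYPE('a::cubic_root)) \<Longrightarrow> (form l :: 'a omega) = form r"
  by (simp add: form_eq_iff rel_relation)

lemma sc_commute: "x * sc z = sc z * x"
  unfolding sc_def by (induction x rule: omega.abs_induct) (metis form_simps(4) scal_commute)

lemma sc_simps: "sc (z * w) = sc z * sc w" "sc (z + w) = sc z + sc w" "sc 1 = 1" "sc 0 = 0"
  by (simp_all add: sc_def scal_mult scal_add form_simps)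

lemma proot_square: "proot TYPE('a::cubic_root) * proot TYPE('a) = - 1 - proot TYPE('a)"
proof -
  let ?q = "proot TYPE('a)"
  have "(?q - 1) * (?q * ?q + ?q + 1) = ?q ^ 3 - 1"
    by (simp add: algebra_simps power3_eq_cube)
  then have "?q * ?q + ?q + 1 = 0"
    using proot_cube[where 'a = 'a] proot_neq_1[where 'a = 'a] by simp
  moreover have "?q * ?q = (?q * ?q + ?q + 1) - 1 - ?q" by simp
  ultimately show ?thesis by simp
qed

interpretation om: primitive_root "\<lambda>z x :: 'a::cubic_root omega. sc z * x" "proot TYPE('a)"
proof unfold_locales
  fix z w :: complex and x y :: "'a omega"
  show "sc z * (x + y) = sc z * x + sc z * y" by (rule distrib_left)
  show "sc (z + w) * x = sc z * x + sc w * x" by (simp add: sc_simps distrib_right)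
  show "sc z * (sc w * x) = sc (z * w) * x" by (simp add: sc_simps mult.assoc)
  show "sc 1 * x = x" by (simp add: sc_simps)
qed (rule proot_square)

abbreviation om_linear :: "('a::cubic_root omega \<Rightarrow> 'b::cubic_root omega) \<Rightarrow> bool" where
  "om_linear \<equiv> Modules.module_hom (\<lambda>z x. sc z * x) (\<lambda>z x. sc z * x)"

lemma gel_sc_commute: "gel g * (sc z * x) = sc z * (gel g * x)"
  by (metis sc_commute mult.assoc)

lemma lsum_lmult: "x * om.lsum f xs = om.lsum (\<lambda>k. x * f k) xs"
  by (induction xs) (auto simp: distrib_left mult.assoc[symmetric] sc_commute)

lemma lsum_rmult: "om.lsum f xs * x = om.lsum (\<lambda>k. f k * x) xs"
  by (induction xs) (auto simp: distrib_right mult.assoc)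

locale root_of_unity =
  fixes q :: complex
  assumes q_square: "q * q = - 1 - q"
begin

lemma coefficients:
  "q * mu q = 1 + 2 * q" "q * (mu q)\<^sup>2 = 3 + 3 * q" "q\<^sup>2 = - 1 - q" "1 / q = - 1 - q"
  "mu q = 1 - q"
proof -
  have 1: "q * (- 1 - q) = 1" using q_square by (simp add: right_diff_distrib)
  then have "q \<noteq> 0" by auto
  then show i: "1 / q = - 1 - q" using 1 by (simp add: divide_eq_eq mult.commute)
  show q2: "q\<^sup>2 = - 1 - q" using q_square by (simp add: power2_eq_square)
  have "(- 1 - q) * q = 1" using 1 by (simp add: mult.commute)
  then have "1 / q\<^sup>2 = q" unfolding q2 using 1 by (metis eq_divide_eq mult_zero_left zero_neq_one mult.commute)
  then show mu: "mu q = 1 - q" by (simp add: mu_def)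
  show "q * mu q = 1 + 2 * q" unfolding mu by (simp add: right_diff_distrib q_square)
  have "(mu q)\<^sup>2 = - 3 * q"
    unfolding mu by (simp add: power2_eq_square left_diff_distrib right_diff_distrib q_square)
  then have "q * (mu q)\<^sup>2 = - 3 * (q * q)" by simp
  then show "q * (mu q)\<^sup>2 = 3 + 3 * q" by (simp add: q_square)
qed

end

lemmas coefficient_products = root_of_unity.coefficients[OF root_of_unity.intro[OF proot_square]]

subsection \<open>The relations\<close>

text \<open>These are the rewriting rules behind \<open>act\<close>: b and c move past a, c moves
  past b, third powers reduce, and a d expresses d through the other letters.\<close>

lemma function_relation:
  fixes q :: complex
  defines "q \<equiv> proot TYPE('a::cubic_root)"
  shows "(gel GB * gel GA :: 'a omega) = sc q * (gel GA * gel GB)"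
    "(gel GC * gel GA :: 'a omega) = sc q * (gel GA * gel GC)"
    "(gel GC * gel GB :: 'a omega) = gel GB * gel GC"
    "(gel GA * gel GD :: 'a omega) = 1 + sc (- 1 - q) * (gel GB * gel GC)"
    "(gel GA * (gel GA * gel GA) :: 'a omega) = 1"
    "(gel GB * (gel GB * gel GB) :: 'a omega) = 0"
    "(gel GC * (gel GC * gel GC) :: 'a omega) = 0"
proof -
  note c = coefficient_products[where 'a = 'a, folded q_def]
  note r = form_relation[where 'a = 'a, folded q_def, simplified function_relations_def, OF UnI1, OF UnI1]
  show "(gel GB * gel GA :: 'a omega) = sc q * (gel GA * gel GB)"
    "(gel GC * gel GA :: 'a omega) = sc q * (gel GA * gel GC)"
    "(gel GC * gel GB :: 'a omega) = gel GB * gel GC"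
    using r[of "xb * xa" "scal q * xa * xb"] r[of "xc * xa" "scal q * xa * xc"]
      r[of "xc * xb" "xb * xc"]
    by (simp_all add: gel_def form_simps sc_def mult.assoc)
  show "(gel GA * (gel GA * gel GA) :: 'a omega) = 1"
    "(gel GB * (gel GB * gel GB) :: 'a omega) = 0"
    "(gel GC * (gel GC * gel GC) :: 'a omega) = 0"
    using r[of "xa ^ 3" 1] r[of "xb ^ 3" 0] r[of "xc ^ 3" 0]
    by (simp_all add: gel_def form_simps power3_eq_cube mult.assoc)
  show "(gel GA * gel GD :: 'a omega) = 1 + sc (- 1 - q) * (gel GB * gel GC)"
    using r[of "xa * xd - scal (1 / q) * xb * xc" 1]
    by (simp add: gel_def form_simps sc_def c mult.assoc diff_eq_eq)
qed

lemma exterior_relation_bcd: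
  assumes "g \<in> {EB, EC, ED}" "h \<in> {EB, EC, ED}"
  shows "gel g * gel g = (0 :: 'a::cubic_root omega)"
    and "g \<noteq> h \<Longrightarrow> gel g * gel h = (- (gel h * gel g) :: 'a omega)"
proof -
  note r = form_relation[where 'a = 'a, OF UnI1, OF UnI2]
  have "(var g * var g, 0) \<in> exterior_relations (proot TYPE('a))"
    unfolding exterior_relations_def using assms(1) by (intro UnI1 UnI2) auto
  from r[OF this] show "gel g * gel g = (0 :: 'a omega)"
    by (simp add: gel_def form_simps)
  assume "g \<noteq> h"
  \<comment> \<open>The side condition in \<open>exterior_relations\<close> compares polynomials, so
    distinct letters must be shown to give distinct elements of the free algebra.\<close>
  have "var g \<noteq> var h"
  proof
    assume "var g = var h"
    then have "Poly_Mapping.lookup (var g) (Word [g]) = Poly_Mapping.lookup (var h) (Word [g])"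
      by simp
    with \<open>g \<noteq> h\<close> show False by (simp add: var_def lookup_single when_def)
  qed
  then have "(var g * var h + var h * var g, 0) \<in> exterior_relations (proot TYPE('a))"
    unfolding exterior_relations_def using assms by (intro UnI1) auto
  from r[OF this] show "gel g * gel h = (- (gel h * gel g) :: 'a omega)"
    by (simp add: gel_def form_simps add_eq_0_iff2)
qed

lemma exterior_relation_a:
  fixes q :: complex
  defines "q \<equiv> proot TYPE('a::cubic_root)"
  shows "(gel EA * gel EA :: 'a omega) = sc (1 - q) * (gel EB * gel EC)"
    "(gel EB * gel EA :: 'a omega) = sc (- q) * (gel EA * gel EB) + sc (1 + 2 * q) * (gel EB * gel ED)"
    "(gel EC * gel EA :: 'a omega) = sc (1 + q) * (gel EA * gel EC) + sc (- 1 + q) * (gel EC * gel ED)"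
    "(gel ED * gel EA :: 'a omega) = sc (- 1) * (gel EA * gel ED) + sc (- 1 + q) * (gel EB * gel EC)"
proof -
  note c = coefficient_products[where 'a = 'a, folded q_def]
  have qq: "q * q = - 1 - q" unfolding q_def by (rule proot_square)
  note r = form_relation[where 'a = 'a, folded q_def, simplified exterior_relations_def, OF UnI1, OF UnI2, OF UnI2]
  have neg: "sc (- z) = (- sc z :: 'a omega)" for z
    by (metis sc_simps(2,4) add.right_inverse minus_unique)
  have dif: "sc (z - w) = (sc z - sc w :: 'a omega)" for z w
    by (metis sc_simps(2) neg uminus_add_conv_diff add.commute)
  show "(gel EA * gel EA :: 'a omega) = sc (1 - q) * (gel EB * gel EC)"
    using r[of "ea * ea" "scal (mu q) * eb * ec"]
    by (simp add: gel_def form_simps sc_def c mult.assoc)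
  show "(gel ED * gel EA :: 'a omega) = sc (- 1) * (gel EA * gel ED) + sc (- 1 + q) * (gel EB * gel EC)"
    using r[of "ea * ed + ed * ea + scal (mu q) * eb * ec" 0]
    by (simp add: gel_def form_simps sc_def[symmetric] c mult.assoc neg dif sc_simps algebra_simps
        add_eq_0_iff2)
  have "(gel EA * gel EB + sc (- 1 - q) * (gel EB * gel EA) - sc (1 - q) * (gel EB * gel ED) :: 'a omega) = 0"
    using r[of "ea * eb + scal (q ^ 2) * eb * ea - scal (mu q) * eb * ed" 0]
    by (simp add: gel_def form_simps sc_def[symmetric] c mult.assoc)
  \<comment> \<open>The relation carries the coefficient q^2 = -1 - q on e_b e_a; multiplying by q,
    its inverse, solves for that product.\<close>
  then have "sc q * (sc (- 1 - q) * (gel EB * gel EA)) = sc q * (sc (1 - q) * (gel EB * gel ED) - gel EA * gel EB :: 'a omega)"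
    by (simp add: algebra_simps)
  then show "(gel EB * gel EA :: 'a omega) = sc (- q) * (gel EA * gel EB) + sc (1 + 2 * q) * (gel EB * gel ED)"
    by (simp add: om.scale_right_diff_distrib right_diff_distrib qq neg sc_simps(3))
  have "(gel EC * gel EA + sc (- 1 - q) * (gel EA * gel EC) + sc (1 - q) * (gel EC * gel ED) :: 'a omega) = 0"
    using r[of "ec * ea + scal (q ^ 2) * ea * ec + scal (mu q) * ec * ed" 0]
    by (simp add: gel_def form_simps sc_def[symmetric] c mult.assoc)
  then show "(gel EC * gel EA :: 'a omega) = sc (1 + q) * (gel EA * gel EC) + sc (- 1 + q) * (gel EC * gel ED)"
    by (simp add: neg dif sc_simps algebra_simps add_eq_0_iff2)
qed

lemma cross_relation:
  assumes "g \<in> {GA, GB, GC, GD}" "e \<in> {EA, EB, EC, ED}"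
  shows "gel g * gel e = om.lsum (\<lambda>(f, h). gel f * gel h :: 'a::cubic_root omega) (cross g e)"
proof -
  let ?q = "proot TYPE('a)"
  note c0 = coefficient_products[where 'a = 'a]
  note c = c0(3-5) c0(1,2)[unfolded c0(5)]
  have uv:
    "form v * form eb = (form eb * form v :: 'a omega)"
    "form u * form ec = (form ec * form u :: 'a omega)"
    "form u * form ed = (sc (- 1 - ?q) * (form ed * form u) :: 'a omega)"
    "form v * form ed = (sc ?q * (form ed * form v) :: 'a omega)"
    "form u * form eb = (form eb * form u + sc (1 + 2 * ?q) * (form ed * form v) :: 'a omega)"
    "form v * form ec = (form ec * form v + sc (1 + 2 * ?q) * (form ed * form u) :: 'a omega)"
    "form v * form ea = (sc (- 1 - ?q) * (form ea * form v) + sc (1 - ?q) * (form eb * form u) :: 'a omega)"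
    "form u * form ea = (sc ?q * (form ea * form u) + (sc (1 - ?q) * (form ec * form v)
      + sc (3 + 3 * ?q) * (form ed * form u)) :: 'a omega)"
    if "(u, v) \<in> {(xa, xc), (xb, xd)}" for u v
  proof -
    have r: "(l, r) \<in> relations ?q"
      if "(l, r) \<in> {(v * eb, eb * v), (u * ec, ec * u), (u * ed, scal (1 / ?q) * ed * u),
       (v * ed, scal ?q * ed * v), (u * eb, eb * u + scal (?q * mu ?q) * ed * v),
       (v * ec, ec * v + scal (?q * mu ?q) * ed * u),
       (v * ea, scal (1 / ?q) * ea * v + scal (mu ?q) * eb * u),
       (u * ea, scal ?q * ea * u + scal (mu ?q) * ec * v + scal (?q * (mu ?q) ^ 2) * ed * u)}" for l r
      unfolding cross_relations_def using \<open>(u, v) \<in> {(xa, xc), (xb, xd)}\<close> that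
      by (intro UnI2 UN_I[of "(u, v)"]) (simp_all only: prod.case)
    show "form v * form eb = (form eb * form v :: 'a omega)"
      using form_relation[OF r, of "v * eb" "eb * v"] by (simp add: form_simps)
    show "form u * form ec = (form ec * form u :: 'a omega)"
      using form_relation[OF r, of "u * ec" "ec * u"] by (simp add: form_simps)
    show "form u * form ed = (sc (- 1 - ?q) * (form ed * form u) :: 'a omega)"
      using form_relation[OF r, of "u * ed" "scal (1 / ?q) * ed * u"] by (simp add: form_simps sc_def c mult.assoc)
    show "form v * form ed = (sc ?q * (form ed * form v) :: 'a omega)"
      using form_relation[OF r, of "v * ed" "scal ?q * ed * v"] by (simp add: form_simps sc_def c mult.assoc)
    show "form u * form eb = (form eb * form u + sc (1 + 2 * ?q) * (form ed * form v) :: 'a omega)"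
      using form_relation[OF r, of "u * eb" "eb * u + scal (?q * mu ?q) * ed * v"] by (simp add: form_simps sc_def c mult.assoc)
    show "form v * form ec = (form ec * form v + sc (1 + 2 * ?q) * (form ed * form u) :: 'a omega)"
      using form_relation[OF r, of "v * ec" "ec * v + scal (?q * mu ?q) * ed * u"] by (simp add: form_simps sc_def c mult.assoc)
    show "form v * form ea = (sc (- 1 - ?q) * (form ea * form v) + sc (1 - ?q) * (form eb * form u) :: 'a omega)"
      using form_relation[OF r, of "v * ea" "scal (1 / ?q) * ea * v + scal (mu ?q) * eb * u"] by (simp add: form_simps sc_def c mult.assoc)
    show "form u * form ea = (sc ?q * (form ea * form u) + (sc (1 - ?q) * (form ec * form v)
      + sc (3 + 3 * ?q) * (form ed * form u)) :: 'a omega)"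
      using form_relation[OF r, of "u * ea" "scal ?q * ea * u + scal (mu ?q) * ec * v + scal (?q * (mu ?q) ^ 2) * ed * u"]
      by (simp add: form_simps sc_def c mult.assoc add.assoc)
  qed
  note ac = uv[of xa xc, simplified] and bd = uv[of xb xd, simplified]
  show ?thesis
    using assms
    by (elim insertE emptyE)
      (simp_all add: val_def gel_def ac bd sc_simps(3))
qed

subsection \<open>Left multiplication of normal words\<close>

abbreviation eword :: "gen list \<Rightarrow> 'a::cubic_root omega" where
  "eword I \<equiv> prod_list (map gel I)"

definition fword :: "nat \<times> nat \<times> nat \<Rightarrow> 'a::cubic_root omega" where
  "fword t = (case t of (m, n, k) \<Rightarrow> gel GA ^ m * gel GB ^ n * gel GC ^ k)"

definition nword :: "bkey \<Rightarrow> 'a::cubic_root omega" where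
  "nword k = eword (fst k) * fword (snd k)"

abbreviation nsum :: "svec \<Rightarrow> 'a::cubic_root omega" where
  "nsum \<equiv> om.lsum nword"

definition bkeys :: "bkey list" where
  "bkeys = List.product ekeys tkeys"

text \<open>Rewriting never leaves the finite set of normal words, which is decided by evaluation.
  Closure of this kind lets the soundness lemmas, valid for normal words only, be applied under
  \<open>lsum\<close>.\<close>

lemma wedge_keys:
  assumes "g \<in> {EA, EB, EC, ED}" "I \<in> set ekeys" "(J, c) \<in> set (wedge g I)"
  shows "J \<in> set ekeys" "length J = Suc (length I)"
proof -
  have "list_all (\<lambda>g. list_all (\<lambda>I. list_all (\<lambda>(J, c). J \<in> set ekeys \<and> length J = Suc (length I))
    (wedge g I)) ekeys) [EA, EB, EC, ED]"
    by code_simp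
  with assms show "J \<in> set ekeys" "length J = Suc (length I)"
    unfolding list_all_iff by fastforce+
qed

lemma push_keys:
  assumes "g \<in> {GA, GB, GC, GD}" "I \<in> set ekeys" "((J, x), c) \<in> set (push g I)"
  shows "J \<in> set ekeys" "length J = length I" "x \<in> {GA, GB, GC, GD}"
proof -
  have "list_all (\<lambda>g. list_all (\<lambda>I. list_all (\<lambda>((J, x), c). J \<in> set ekeys \<and> length J = length I
    \<and> x \<in> set [GA, GB, GC, GD]) (push g I)) ekeys) [GA, GB, GC, GD]"
    by code_simp
  with assms show "J \<in> set ekeys" "length J = length I" "x \<in> {GA, GB, GC, GD}"
    unfolding list_all_iff by fastforce+
qed

lemma act_keys:
  assumes "x \<in> {GA, GB, GC, GD}" "t \<in> set tkeys" "(s, c) \<in> set (act x t)"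
  shows "s \<in> set tkeys"
proof -
  have "list_all (\<lambda>x. list_all (\<lambda>t. list_all (\<lambda>(s, c). s \<in> set tkeys) (act x t)) tkeys) [GA, GB, GC, GD]"
    by code_simp
  with assms show ?thesis
    unfolding list_all_iff by fastforce
qed

lemma vbind_keys: "(l, d) \<in> set (vbind xs f) \<Longrightarrow> \<exists>k c e. (k, c) \<in> set xs \<and> (l, e) \<in> set (f k)"
  by (induction xs) (auto simp: vscale_def, blast+)

lemma rank_gen_less: "rank_gen g < 4 \<longleftrightarrow> g \<in> {EA, EB, EC, ED}"
  by (cases g) auto

lemma gen_cases4: "g \<in> {EA, EB, EC, ED} \<or> g \<in> {GA, GB, GC, GD}"
  by (cases g) auto

lemma lmul_keys:
  assumes "k \<in> set bkeys" "(l, c) \<in> set (lmul g k)"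
  shows "l \<in> set bkeys"
    and "length (fst l) = length (fst k) + (if rank_gen g < 4 then 1 else 0)"
proof -
  obtain I t where k: "k = (I, t)" "I \<in> set ekeys" "t \<in> set tkeys"
    using assms(1) by (auto simp: bkeys_def)
  have "l \<in> set bkeys \<and> length (fst l) = length (fst k) + (if rank_gen g < 4 then 1 else 0)"
  proof (cases "rank_gen g < 4")
    case True
    then show ?thesis
      using assms(2) k wedge_keys[of g I] unfolding rank_gen_less by (auto simp: bkeys_def rank_gen_less)
  next
    case False
    then have g: "g \<in> {GA, GB, GC, GD}"
      using gen_cases4[of g] by (auto simp: rank_gen_less)
    have "(l, c) \<in> set (vbind (push g I) (\<lambda>(J, x). map (\<lambda>(s, c). ((J, s), c)) (act x t)))"
      using assms(2) k False by simp
    from vbind_keys[OF this] obtain p d e where p: "(p, d) \<in> set (push g I)"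
        "(l, e) \<in> set (case p of (J, x) \<Rightarrow> map (\<lambda>(s, c). ((J, s), c)) (act x t))"
      by blast
    moreover obtain J x where "p = (J, x)" by (cases p)
    ultimately obtain s e where "((J, x), d) \<in> set (push g I)" "l = (J, s)" "(s, e) \<in> set (act x t)"
      by auto
    then show ?thesis
      using push_keys[OF g k(2)] act_keys[of x t] k g False by (auto simp: bkeys_def)
  qed
  then show "l \<in> set bkeys"
    and "length (fst l) = length (fst k) + (if rank_gen g < 4 then 1 else 0)" by auto
qed

lemma wedge3_sound:
  assumes "g \<in> {EB, EC, ED}" "set I \<subseteq> {EB, EC, ED}"
  shows "gel g * eword I = (om.lsum eword (wedge3 g I) :: 'a::cubic_root omega)"
  using assms(2)
proof (induction I)
  case (Cons h I)
  have h: "h \<in> {EB, EC, ED}" using Cons.prems by simp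
  have IH: "gel g * eword I = (om.lsum eword (wedge3 g I) :: 'a omega)"
    using Cons by simp
  consider "g = h" | "g \<noteq> h" "rank_gen g < rank_gen h" | "g \<noteq> h" "\<not> rank_gen g < rank_gen h"
    by blast
  then show ?case
  proof cases
    case 1
    then show ?thesis
      using exterior_relation_bcd(1)[OF assms(1) h, where 'a = 'a] by (simp add: mult.assoc[symmetric])
  next
    case 2
    then show ?thesis by (simp add: val_def sc_simps)
  next
    case 3
    have m1: "val (proot TYPE('a)) (- 1, 0) = - 1" by (simp add: val_def)
    have "gel g * (gel h * eword I) = (- (gel h * (gel g * eword I)) :: 'a omega)"
      using exterior_relation_bcd(2)[OF assms(1) h 3(1), where 'a = 'a]
      by (simp add: mult.assoc[symmetric])
    also have "\<dots> = - om.lsum (\<lambda>J. gel h * eword J) (wedge3 g I)"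
      unfolding IH lsum_lmult ..
    also have "- om.lsum (\<lambda>J. gel h * eword J) xs =
        (om.lsum eword (map (\<lambda>(J, c). (h # J, emul (- 1, 0) c)) xs) :: 'a omega)" for xs
      by (induction xs) (auto simp: om.val_emul m1 simp del: emul.simps)
    finally show ?thesis using 3 by simp
  qed
qed (simp add: val_def sc_simps)

lemma wedge3_set: "(J, c) \<in> set (wedge3 g I) \<Longrightarrow> set J \<subseteq> insert g (set I)"
  by (induction I arbitrary: J c) (fastforce split: if_splits)+

lemma wedge3_wedge3_sound:
  assumes "g \<in> {EB, EC, ED}" "h \<in> {EB, EC, ED}" "set I \<subseteq> {EB, EC, ED}"
  shows "gel g * (gel h * eword I) = (om.lsum eword (vbind (wedge3 h I) (wedge3 g)) :: 'a::cubic_root omega)"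
proof -
  have "gel g * (gel h * eword I) = om.lsum (\<lambda>J. gel g * eword J) (wedge3 h I)"
    unfolding wedge3_sound[OF assms(2,3)] lsum_lmult ..
  also have "\<dots> = om.lsum (\<lambda>J. om.lsum eword (wedge3 g J)) (wedge3 h I)"
    by (rule om.lsum_cong, rule wedge3_sound[OF assms(1)]) (use wedge3_set assms in fastforce)
  finally show ?thesis by simp
qed

lemma exterior_relation_a_mult:
  fixes q :: complex and x :: "'a::cubic_root omega"
  defines "q \<equiv> proot TYPE('a)"
  shows "gel EA * (gel EA * x) = sc (1 - q) * (gel EB * (gel EC * x))"
    "gel EB * (gel EA * x) = sc (- q) * (gel EA * (gel EB * x)) + sc (1 + 2 * q) * (gel EB * (gel ED * x))"
    "gel EC * (gel EA * x) = sc (1 + q) * (gel EA * (gel EC * x)) + sc (- 1 + q) * (gel EC * (gel ED * x))"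
    "gel ED * (gel EA * x) = sc (- 1) * (gel EA * (gel ED * x)) + sc (- 1 + q) * (gel EB * (gel EC * x))"
  unfolding q_def mult.assoc[symmetric] exterior_relation_a distrib_right by (rule refl)+

lemma wedge_sound:
  assumes "g \<in> {EA, EB, EC, ED}" "I \<in> set ekeys"
  shows "gel g * eword I = (om.lsum eword (wedge g I) :: 'a::cubic_root omega)"
proof (cases "\<exists>J. I = EA # J")
  case True
  then obtain J where I: "I = EA # J" by blast
  then have J: "set J \<subseteq> {EB, EC, ED}" using assms(2) by (auto simp: ekeys_def)
  note w = wedge3_wedge3_sound[OF _ _ J, where 'a = 'a, unfolded om.lsum_vbind]
  have eaw: "gel EA * (gel h * eword J) = (om.lsum (\<lambda>K. gel EA * eword K) (wedge3 h J) :: 'a omega)"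
    if "h \<in> {EB, EC, ED}" for h
    unfolding wedge3_sound[OF that J] lsum_lmult ..
  have "gel g * (gel EA * eword J) = (om.lsum eword (wedge_a g J) :: 'a omega)"
    using assms(1)
    by (elim insertE emptyE) (simp_all add: exterior_relation_a_mult w eaw val_def)
  then show ?thesis by (simp add: I)
next
  case False
  then have I: "set I \<subseteq> {EB, EC, ED}" using assms(2) by (auto simp: ekeys_def)
  show ?thesis
  proof (cases "g = EA")
    case True
    then have "wedge g I = [(EA # I, (1, 0))]" using False by (cases I; cases "hd I") auto
    then show ?thesis using True by (simp add: val_def sc_simps)
  next
    case g: False
    then have "wedge g I = wedge3 g I"
      using False assms(1) by (cases I; cases "hd I"; cases g) auto
    then show ?thesis using g assms(1) wedge3_sound[OF _ I, of g] by simp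
  qed
qed

lemma cross_keys:
  "g \<in> {GA, GB, GC, GD} \<Longrightarrow> e \<in> {EA, EB, EC, ED} \<Longrightarrow> ((f, h), c) \<in> set (cross g e) \<Longrightarrow>
    f \<in> {EA, EB, EC, ED} \<and> h \<in> {GA, GB, GC, GD}"
  by auto

lemma ekeys_Cons: "e # I \<in> set ekeys \<Longrightarrow> I \<in> set ekeys \<and> e \<in> {EA, EB, EC, ED}"
  by (auto simp: ekeys_def)

lemma push_sound:
  assumes "g \<in> {GA, GB, GC, GD}" "I \<in> set ekeys"
  shows "gel g * eword I = (om.lsum (\<lambda>(J, x). eword J * gel x) (push g I) :: 'a::cubic_root omega)"
  using assms
proof (induction I arbitrary: g)
  case Nil
  then show ?case by (simp add: val_def sc_simps)
next
  case (Cons e I)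
  let ?F = "\<lambda>(J, x). eword J * gel x :: 'a omega"
  have I: "I \<in> set ekeys" and e: "e \<in> {EA, EB, EC, ED}" using ekeys_Cons[OF Cons.prems(2)] by auto
  have step: "gel f * (gel h * eword I) =
      om.lsum ?F (vbind (push h I) (\<lambda>(J, x). map (\<lambda>(K, c). ((K, x), c)) (wedge f J)))"
    if "f \<in> {EA, EB, EC, ED}" "h \<in> {GA, GB, GC, GD}" for f h
  proof -
    have "gel f * (gel h * eword I) = om.lsum (\<lambda>k. gel f * ?F k) (push h I)"
      unfolding Cons.IH[OF that(2) I] lsum_lmult ..
    also have "\<dots> = om.lsum (\<lambda>k. om.lsum ?F (case k of (J, x) \<Rightarrow> map (\<lambda>(K, c). ((K, x), c)) (wedge f J))) (push h I)"
    proof (rule om.lsum_cong)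
      fix k c assume "(k, c) \<in> set (push h I)"
      moreover obtain J x where k: "k = (J, x)" by (cases k)
      ultimately have "J \<in> set ekeys" using push_keys(1)[OF that(2) I] by blast
      then have "gel f * (eword J * gel x) = om.lsum (\<lambda>K. eword K * gel x) (wedge f J)"
        by (simp add: mult.assoc[symmetric] wedge_sound[OF that(1)] lsum_rmult)
      then show "gel f * ?F k = om.lsum ?F (case k of (J, x) \<Rightarrow> map (\<lambda>(K, c). ((K, x), c)) (wedge f J))"
        by (simp add: k)
    qed
    finally show ?thesis by simp
  qed
  have "gel g * eword (e # I) = (gel g * gel e) * (eword I :: 'a omega)"
    by (simp add: mult.assoc)
  also have "\<dots> = om.lsum (\<lambda>k. (case k of (f, h) \<Rightarrow> gel f * gel h) * eword I) (cross g e)"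
    unfolding cross_relation[OF Cons.prems(1) e] lsum_rmult ..
  also have "\<dots> = om.lsum (\<lambda>k. om.lsum ?F (case k of (f, h) \<Rightarrow>
      vbind (push h I) (\<lambda>(J, x). map (\<lambda>(K, c). ((K, x), c)) (wedge f J)))) (cross g e)"
    by (rule om.lsum_cong) (use step cross_keys[OF Cons.prems(1) e] in \<open>force simp: mult.assoc\<close>)
  finally show ?case by simp
qed

lemma tkeys_iff: "(m, n, k) \<in> set tkeys \<longleftrightarrow> m \<in> {0, Suc 0, Suc (Suc 0)} \<and> n \<in> {0, Suc 0, Suc (Suc 0)} \<and> k \<in> {0, Suc 0, Suc (Suc 0)}"
  unfolding tkeys_def set_product mem_Times_iff by (simp add: numeral_2_eq_2)

lemma swap_power:
  assumes "y * x = sc z * (x * y)"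
  shows "y * x ^ m = sc (z ^ m) * (x ^ m * y)"
proof (induction m)
  case (Suc m)
  have "y * x ^ Suc m = sc z * (x * (y * x ^ m))"
    by (simp add: mult.assoc[symmetric] assms)
  also have "\<dots> = sc z * (sc (z ^ m) * (x * (x ^ m * y)))"
    unfolding Suc by (metis sc_commute mult.assoc)
  finally show ?case by (simp add: mult.assoc)
qed (simp add: sc_simps(3))

lemma act_sound_abc:
  assumes "x \<in> {GA, GB, GC}" "t \<in> set tkeys"
  shows "gel x * fword t = (om.lsum fword (act x t) :: 'a::cubic_root omega)"
proof -
  let ?q = "proot TYPE('a)"
  obtain m n k where t: "t = (m, n, k)" by (cases t)
  have mnk: "m \<in> {0, Suc 0, Suc (Suc 0)}" "n \<in> {0, Suc 0, Suc (Suc 0)}" "k \<in> {0, Suc 0, Suc (Suc 0)}"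
    using assms(2) unfolding t tkeys_iff by auto
  have qm: "val ?q (qpow m) = ?q ^ m" by (rule om.val_qpow)
  let ?a = "gel GA :: 'a omega" and ?b = "gel GB :: 'a omega" and ?c = "gel GC :: 'a omega"
  have cb: "?c * ?b ^ n = ?b ^ n * ?c"
    using swap_power[of ?c ?b 1 n] function_relation(3)[where 'a = 'a] by (simp add: sc_simps)
  from assms(1) consider "x = GA" | "x = GB" | "x = GC" by blast
  then show ?thesis
  proof cases
    case 1
    have "?a * ?a ^ m = ?a ^ cyc m"
      using mnk(1) function_relation(5)[where 'a = 'a] by auto
    then show ?thesis by (simp add: 1 t fword_def val_def sc_simps mult.assoc[symmetric])
  next
    case 2
    have "?b * fword t = sc (?q ^ m) * (?a ^ m * (?b * ?b ^ n) * ?c ^ k)"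
      using swap_power[OF function_relation(1)[where 'a = 'a], of m]
      by (simp add: t fword_def mult.assoc[symmetric])
    moreover have "?b * ?b ^ Suc (Suc 0) = 0"
      using function_relation(6)[where 'a = 'a] by simp
    ultimately show ?thesis
      using mnk(2) by (auto simp: 2 t fword_def qm)
  next
    case 3
    have "?c * (?a ^ m * y) = sc (?q ^ m) * (?a ^ m * (?c * y))" for y
      using swap_power[OF function_relation(2)[where 'a = 'a], of m]
      by (simp add: mult.assoc[symmetric])
    moreover have "?c * (?b ^ n * y) = ?b ^ n * (?c * y)" for y
      by (simp add: mult.assoc[symmetric] cb)
    ultimately have "?c * fword t = sc (?q ^ m) * (?a ^ m * ?b ^ n * (?c * ?c ^ k))"
      by (simp add: t fword_def mult.assoc)
    moreover have "?c * ?c ^ Suc (Suc 0) = 0"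
      using function_relation(7)[where 'a = 'a] by simp
    ultimately show ?thesis
      using mnk(3) by (auto simp: 3 t fword_def qm)
  qed
qed

lemma act_sound:
  assumes "x \<in> {GA, GB, GC, GD}" "t \<in> set tkeys"
  shows "gel x * fword t = (om.lsum fword (act x t) :: 'a::cubic_root omega)"
proof (cases "x = GD")
  case False
  then show ?thesis using act_sound_abc assms by blast
next
  case True
  let ?q = "proot TYPE('a)"
  let ?a = "gel GA :: 'a omega" and ?b = "gel GB :: 'a omega" and ?c = "gel GC :: 'a omega"
  \<comment> \<open>Inserting a^3 = 1 turns the action of d into the actions of a, b and c, already
    treated.\<close>
  have "gel GD = ?a * (?a * (?a * gel GD))"
    using function_relation(5)[where 'a = 'a] by (simp add: mult.assoc[symmetric])
  also have "\<dots> = ?a * (?a * (1 + sc (- 1 - ?q) * (?b * ?c)))"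
    by (simp add: function_relation(4))
  finally have d: "gel GD * fword t = ?a * (?a * (fword t + sc (- 1 - ?q) * (?b * (?c * fword t))))"
    by (simp add: mult.assoc distrib_right)
  \<comment> \<open>Four actions follow one another; \<open>K\<close> records that each intermediate
    list has exponents in range, so that the next action is again sound.\<close>
  define K where "K xs \<longleftrightarrow> (\<forall>(s, c)\<in>set xs. s \<in> set tkeys)" for xs :: "((nat \<times> nat \<times> nat) \<times> eis) list"
  have K_act: "K (vbind xs (act x))" if "K xs" "x \<in> {GA, GB, GC}" for x xs
  proof -
    have "s \<in> set tkeys" if s: "(s, c) \<in> set (vbind xs (act x))" for s c
    proof -
      from vbind_keys[OF s] obtain p d e where p: "(p, d) \<in> set xs" "(s, e) \<in> set (act x p)" by blast
      then have "p \<in> set tkeys" using \<open>K xs\<close> by (auto simp: K_def)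
      with p(2) show ?thesis using act_keys[of x p s e] \<open>x \<in> {GA, GB, GC}\<close> by blast
    qed
    then show ?thesis by (auto simp: K_def)
  qed
  have lm: "gel x * om.lsum fword xs = (om.lsum fword (vbind xs (act x)) :: 'a omega)"
    if "K xs" "x \<in> {GA, GB, GC}" for x xs
  proof -
    have "om.lsum (\<lambda>s. gel x * fword s) xs = (om.lsum (\<lambda>s. om.lsum fword (act x s)) xs :: 'a omega)"
      by (rule om.lsum_cong, rule act_sound_abc[OF that(2)]) (use that(1) in \<open>auto simp: K_def\<close>)
    then show ?thesis by (simp add: lsum_lmult)
  qed
  let ?y = "vbind (act GC t) (act GB)"
  let ?z = "[(t, (1, 0))] @ vscale (- 1, - 1) ?y"
  have Kc: "K (act GC t)" using act_keys[of GC t] assms(2) by (auto simp: K_def)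
  have Ky: "K ?y" using Kc by (rule K_act) simp
  then have Kz: "K ?z" using assms(2) by (auto simp: K_def vscale_def)
  have "?b * (?c * fword t) = om.lsum fword ?y"
    using act_sound_abc[of GC t, where 'a = 'a] lm[OF Kc, of GB] assms(2) by simp
  then have z: "fword t + sc (- 1 - ?q) * (?b * (?c * fword t)) = om.lsum fword ?z"
    by (simp add: val_def sc_simps(3) del: om.lsum_vbind)
  have z1: "?a * om.lsum fword ?z = om.lsum fword (vbind ?z (act GA))"
    by (rule lm[OF Kz]) simp
  have z2: "?a * om.lsum fword (vbind ?z (act GA)) = om.lsum fword (vbind (vbind ?z (act GA)) (act GA))"
    by (rule lm[OF K_act[OF Kz]]) simp_all
  have "gel GD * fword t = (om.lsum fword (vbind (vbind ?z (act GA)) (act GA)) :: 'a omega)"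
    unfolding d z z1 z2 ..
  also have "\<dots> = om.lsum fword (act GD t)"
  proof -
    obtain m n k where t: "t = (m, n, k)" by (cases t)
    have one: "val ?q (1, 0) = 1" by (simp add: val_def)
    show ?thesis
      by (cases "n < Suc (Suc 0)"; cases "k < Suc (Suc 0)")
        (simp_all add: t one sc_simps(3) om.val_emul vscale_def mult.assoc del: emul.simps)
  qed
  finally show ?thesis using True by simp
qed

text \<open>Soundness half: the rewriting computes left multiplication in the quotient. The
  consistency half, that the same rewriting respects all relations, is what makes normal words
  independent.\<close>

lemma lmul_sound:
  assumes "k \<in> set bkeys"
  shows "gel g * nword k = (nsum (lmul g k) :: 'a::cubic_root omega)"
proof -
  obtain I t where k: "k = (I, t)" "I \<in> set ekeys" "t \<in> set tkeys"
    using assms by (auto simp: bkeys_def)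
  show ?thesis
  proof (cases "rank_gen g < 4")
    case True
    then have "gel g * nword k = (om.lsum (\<lambda>J. eword J * fword t) (wedge g I) :: 'a omega)"
      using wedge_sound[of g I, where 'a = 'a] k
      by (simp add: rank_gen_less nword_def mult.assoc[symmetric] lsum_rmult)
    then show ?thesis using True by (simp add: k nword_def)
  next
    case False
    then have g: "g \<in> {GA, GB, GC, GD}"
      using gen_cases4[of g] by (auto simp: rank_gen_less)
    have "gel g * nword k = (om.lsum (\<lambda>p. (case p of (J, x) \<Rightarrow> eword J * gel x) * fword t) (push g I) :: 'a omega)"
      using push_sound[OF g k(2), where 'a = 'a] by (simp add: k nword_def mult.assoc[symmetric] lsum_rmult)
    also have "\<dots> = om.lsum (\<lambda>p. nsum (case p of (J, x) \<Rightarrow> map (\<lambda>(s, c). ((J, s), c)) (act x t))) (push g I)"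
    proof (rule om.lsum_cong)
      fix p c assume "(p, c) \<in> set (push g I)"
      moreover obtain J x where p: "p = (J, x)" by (cases p)
      ultimately have "x \<in> {GA, GB, GC, GD}" using push_keys(3)[OF g k(2)] by blast
      from act_sound[OF this k(3), where 'a = 'a]
      show "(case p of (J, x) \<Rightarrow> eword J * gel x) * fword t =
          (nsum (case p of (J, x) \<Rightarrow> map (\<lambda>(s, c). ((J, s), c)) (act x t)) :: 'a omega)"
        by (simp add: p mult.assoc lsum_lmult nword_def)
    qed
    finally show ?thesis using False by (simp add: k)
  qed
qed

text \<open>The span contains 1 and is stable under left multiplication by every generator, hence
  contains every word.\<close>

lemma span_nword: "om.span (nword ` set bkeys) = (UNIV :: 'a::cubic_root omega set)"
proof -
  let ?S = "om.span (nword ` set bkeys) :: 'a omega set"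
  have gel: "gel g * x \<in> ?S" if "x \<in> ?S" for g and x :: "'a omega"
    using that
  proof (rule om.span_induct)
    show "om.subspace {x :: 'a omega. gel g * x \<in> ?S}"
      by (rule om.subspaceI)
        (auto simp: distrib_left gel_sc_commute om.span_zero intro: om.span_add om.span_scale)
  next
    fix x :: "'a omega" assume "x \<in> nword ` set bkeys"
    then obtain k where k: "x = nword k" "k \<in> set bkeys" by blast
    have "nsum (lmul g k) \<in> ?S"
      by (rule om.lsum_in_subspace) (use lmul_keys(1)[OF k(2)] in \<open>auto intro: om.span_base\<close>)
    then show "gel g * x \<in> ?S"
      using lmul_sound[OF k(2), of g, where 'a = 'a] k(1) by simp
  qed
  have one: "1 \<in> ?S"
  proof -
    have "([], 0, 0, 0) \<in> set bkeys" by (simp add: bkeys_def ekeys_def tkeys_def)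
    moreover have "nword ([], 0, 0, 0) = (1 :: 'a omega)" by (simp add: nword_def fword_def)
    ultimately show ?thesis by (metis imageI om.span_base)
  qed
  have word: "prod_list (map gel us) \<in> ?S" for us
    by (induction us) (auto intro: one gel)
  have "form x \<in> ?S" for x
  proof (induction x rule: free_alg_induct)
    case (single u c)
    obtain us where u: "u = Word us" by (cases u)
    have "form (prod_list (map var us)) = (prod_list (map gel us) :: 'a omega)"
      by (induction us) (auto simp: form_simps gel_def)
    then have "form (Poly_Mapping.single u c) = (sc c * prod_list (map gel us) :: 'a omega)"
      by (simp add: u single_word form_simps sc_def)
    then show ?case using om.span_scale[OF word] by simp
  next
    case (add x y)
    then show ?case by (simp add: form_simps om.span_add)
  qed
  then have "x \<in> ?S" for x
    by (induction x rule: omega.abs_induct)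
  then show ?thesis by blast
qed

section \<open>Normal words are linearly independent\<close>

definition pscale :: "complex \<Rightarrow> ('k \<Rightarrow>\<^sub>0 complex) \<Rightarrow> ('k \<Rightarrow>\<^sub>0 complex)" where
  "pscale z w = Poly_Mapping.map ((*) z) w"

lemma lookup_pscale [simp]: "Poly_Mapping.lookup (pscale z w) k = z * Poly_Mapping.lookup w k"
  by (simp add: pscale_def map.rep_eq when_def)

interpretation pscale: vector_space pscale
  by unfold_locales (auto intro!: poly_mapping_eqI simp: lookup_add algebra_simps)

lemma keys_pscale: "Poly_Mapping.keys (pscale z w) \<subseteq> Poly_Mapping.keys w"
  by (auto simp: in_keys_iff)

definition lext :: "('k \<Rightarrow> 'l \<Rightarrow>\<^sub>0 complex) \<Rightarrow> ('k \<Rightarrow>\<^sub>0 complex) \<Rightarrow> ('l \<Rightarrow>\<^sub>0 complex)" where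
  "lext f w = (\<Sum>k\<in>Poly_Mapping.keys w. pscale (Poly_Mapping.lookup w k) (f k))"

lemma lext_superset:
  assumes "finite A" "Poly_Mapping.keys w \<subseteq> A"
  shows "lext f w = (\<Sum>k\<in>A. pscale (Poly_Mapping.lookup w k) (f k))"
  unfolding lext_def by (rule sum.mono_neutral_left) (use assms in \<open>auto simp: in_keys_iff\<close>)

lemma lext_add: "lext f (v + w) = lext f v + lext f w"
proof -
  let ?A = "Poly_Mapping.keys v \<union> Poly_Mapping.keys w"
  have "Poly_Mapping.keys (v + w) \<subseteq> ?A" by (rule keys_add)
  then show ?thesis
    by (simp add: lext_superset[of ?A] lookup_add pscale.scale_left_distrib sum.distrib)
qed

lemma lext_pscale: "lext f (pscale z w) = pscale z (lext f w)"
  using keys_pscale[of z w]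
  by (simp add: lext_superset[of "Poly_Mapping.keys w"] pscale.scale_sum_right)

lemma lext_hom: "Modules.module_hom pscale pscale (lext f)"
  by unfold_locales (auto simp: lext_add lext_pscale pscale.scale_right_distrib pscale.scale_left_distrib)

lemma lext_single [simp]: "lext f (Poly_Mapping.single k c) = pscale c (f k)"
  by (cases "c = 0") (simp_all add: lext_def)

lemma lext_zero [simp]: "lext f 0 = 0"
  by (simp add: lext_def)

lemma lext_diff: "lext f (v - w) = lext f v - lext f w"
  using lext_add[of f "v - w" w] by simp

lemma lext_uminus: "lext f (- v) = - lext f v"
  using lext_diff[of f 0 v] by simp

context root_of_unity
begin

sublocale pm: primitive_root pscale q
  by unfold_locales (rule q_square)

abbreviation delta :: "bkey \<Rightarrow> bkey \<Rightarrow>\<^sub>0 complex" where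
  "delta k \<equiv> Poly_Mapping.single k 1"

definition lop :: "gen \<Rightarrow> (bkey \<Rightarrow>\<^sub>0 complex) \<Rightarrow> (bkey \<Rightarrow>\<^sub>0 complex)" where
  "lop g = lext (\<lambda>k. pm.lsum delta (lmul g k))"

definition run :: "word \<Rightarrow> (bkey \<Rightarrow>\<^sub>0 complex) \<Rightarrow> (bkey \<Rightarrow>\<^sub>0 complex)" where
  "run u w = (case u of Word us \<Rightarrow> foldr lop us w)"

text \<open>Any choice of operators for the generators gives an action of the free algebra. That it
  factors through the presented algebra is the content of the checks on the relations.\<close>

definition rep :: "free_alg \<Rightarrow> (bkey \<Rightarrow>\<^sub>0 complex) \<Rightarrow> (bkey \<Rightarrow>\<^sub>0 complex)" where
  "rep x w = lext (\<lambda>u. run u w) x"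

lemma lop_linear: "lop g (v + w) = lop g v + lop g w" "lop g (pscale z w) = pscale z (lop g w)"
  by (simp_all add: lop_def lext_add lext_pscale)

lemma run_linear: "run u (v + w) = run u v + run u w" "run u (pscale z w) = pscale z (run u w)"
proof -
  obtain us where u: "u = Word us" by (cases u)
  show "run u (v + w) = run u v + run u w" "run u (pscale z w) = pscale z (run u w)"
    unfolding u run_def by (induction us) (auto simp: lop_linear)
qed

lemma run_add: "run (u + v) w = run u (run v w)"
  by (cases u; cases v) (simp add: run_def)

lemma rep_simps:
  "rep (x + y) w = rep x w + rep y w"
  "rep (x - y) w = rep x w - rep y w"
  "rep (- x) w = - rep x w"
  "rep 0 w = 0"
  "rep 1 w = w"
  "rep (scal z) w = pscale z w"
  "rep (var g) w = lop g w"
proof -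
  show "rep 1 w = w" "rep (scal z) w = pscale z w" "rep (var g) w = lop g w"
    unfolding single_one[symmetric]
    by (simp_all add: rep_def scal_def var_def run_def zero_word_def)
qed (simp_all add: rep_def lext_add lext_diff lext_uminus)

lemma rep_linear: "rep x (v + w) = rep x v + rep x w" "rep x (pscale z w) = pscale z (rep x w)"
  by (simp_all add: rep_def lext_def run_linear pscale.scale_right_distrib sum.distrib
      pscale.scale_sum_right mult.commute)

lemma rep_mult: "rep (x * y) w = rep x (rep y w)"
proof (induction x rule: free_alg_induct)
  case (single u c)
  show ?case
  proof (induction y rule: free_alg_induct)
    case (single v d)
    then show ?case by (simp add: rep_def mult_single run_add run_linear)
  next
    case (add y z)
    then show ?case by (simp add: distrib_left rep_simps rep_linear)
  qed
next
  case (add x z)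
  then show ?case by (simp add: distrib_right rep_simps)
qed

lemma rep_power: "rep (x ^ n) w = (rep x ^^ n) w"
  by (induction n) (auto simp: rep_simps rep_mult)

text \<open>The type \<open>bkey\<close> also contains unsorted words and exponents beyond 2, on
  which the rewriting has no meaning. The relations are asserted only on the span of the 432 genuine
  normal words.\<close>

definition W0 :: "(bkey \<Rightarrow>\<^sub>0 complex) set" where
  "W0 = pscale.span (delta ` set bkeys)"

lemma lop_lsum: "lop g (pm.lsum delta xs) = pm.lsum delta (vbind xs (lmul g))"
  unfolding lop_def by (simp add: pm.lsum_linear[OF lext_hom])

lemma run_wmul: "foldr lop us (pm.lsum delta xs) = pm.lsum delta (wmul us xs)"
  unfolding wmul_def by (induction us) (auto simp: lop_lsum simp del: pm.lsum_vbind)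

lemma lop_W0: "w \<in> W0 \<Longrightarrow> lop g w \<in> W0"
proof -
  assume "w \<in> W0"
  then show ?thesis unfolding W0_def
  proof (rule pscale.span_induct)
    show "pscale.subspace {w. lop g w \<in> pscale.span (delta ` set bkeys)}"
      using lop_linear(2)[of g 0]
      by (intro pscale.subspaceI) (auto simp: lop_linear pscale.span_zero intro: pscale.span_add pscale.span_scale)
  next
    fix x assume "x \<in> delta ` set bkeys"
    then obtain k where k: "x = delta k" "k \<in> set bkeys" by blast
    have "pm.lsum delta (lmul g k) \<in> pscale.span (delta ` set bkeys)"
      by (rule pm.lsum_in_subspace) (use lmul_keys(1)[OF k(2)] in \<open>auto intro: pscale.span_base\<close>)
    then show "lop g x \<in> pscale.span (delta ` set bkeys)"
      by (simp add: k(1) lop_def)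
  qed
qed

lemma rep_W0: "w \<in> W0 \<Longrightarrow> rep x w \<in> W0"
proof -
  assume w: "w \<in> W0"
  have "run u w \<in> W0" for u
  proof -
    obtain us where u: "u = Word us" by (cases u)
    show ?thesis unfolding u run_def by (induction us) (auto intro: lop_W0 w)
  qed
  then show ?thesis unfolding rep_def lext_def W0_def
    by (intro pscale.span_sum pscale.span_scale)
qed

lemma rep_zero: "rep x 0 = 0"
  using rep_linear(2)[of x 0 0] by simp

lemma rep_zeroI:
  assumes "\<And>k. k \<in> set bkeys \<Longrightarrow> rep x (delta k) = 0" "w \<in> W0"
  shows "rep x w = 0"
  using assms(2) unfolding W0_def
proof (rule pscale.span_induct)
  show "pscale.subspace {w. rep x w = 0}"
    by (rule pscale.subspaceI) (auto simp: rep_linear rep_zero)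
qed (use assms(1) in auto)

text \<open>The polynomials killing \<open>W0\<close> form a two-sided ideal. For a product x y with
  x in this set, y acts first and must not lead out of \<open>W0\<close>; this is where
  \<open>rep_W0\<close> enters.\<close>

lemma rel_ideal_rep:
  assumes "\<And>l r k. (l, r) \<in> relations q \<Longrightarrow> k \<in> set bkeys \<Longrightarrow> rep l (delta k) = rep r (delta k)"
    and "x \<in> rel_ideal q" "w \<in> W0"
  shows "rep x w = 0"
proof -
  have "rel_ideal q \<subseteq> {x. \<forall>w\<in>W0. rep x w = 0}"
  proof (rule rel_minimal)
    fix l r assume "(l, r) \<in> relations q"
    then show "l - r \<in> {x. \<forall>w\<in>W0. rep x w = 0}"
      using rep_zeroI[of "l - r"] assms(1) by (simp add: rep_simps)
  qed (auto simp: rep_simps rep_mult rep_zero rep_W0)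
  then show ?thesis using assms(2,3) by blast
qed

end

section \<open>Verification of the relations on the normal words\<close>

definition ext_rels :: "relt list" where
  "ext_rels = concat (map (\<lambda>g. map (\<lambda>h. [([g, h], (1,0)), ([h, g], (1,0))]) [EB, EC, ED]) [EB, EC, ED])
    @ map (\<lambda>g. [([g, g], (1,0))]) [EB, EC, ED]
    @ [[([EA, EA], (1,0)), ([EB, EC], (-1,1))],
       [([EA, ED], (1,0)), ([ED, EA], (1,0)), ([EB, EC], (1,-1))],
       [([EA, EB], (1,0)), ([EB, EA], (-1,-1)), ([EB, ED], (-1,1))],
       [([EC, EA], (1,0)), ([EA, EC], (-1,-1)), ([EC, ED], (1,-1))]]"

definition ewmul :: "gen list \<Rightarrow> (gen list \<times> eis) list \<Rightarrow> (gen list \<times> eis) list" where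
  "ewmul ws v = foldr (\<lambda>g v. vbind v (wedge g)) ws v"

text \<open>Both sides of an exterior relation act on the factor e_I alone, so 16 words suffice in
  place of 432.\<close>

lemma ext_rels_vanish:
  "list_all (\<lambda>I. list_all (\<lambda>r. collect (vbind r (\<lambda>ws. ewmul ws [(I, (1,0))])) = []) ext_rels) ekeys"
  by code_simp

text \<open>The compatibility of the cross relations with the exterior ones: moving a function past
  e and then e_I agrees with first normalizing e e_I and then moving the function past the result.
  The exponents are not yet touched, so this is again decided on the 16 words e_I.\<close>

lemma cross_rels_vanish:
  "list_all (\<lambda>I. list_all (\<lambda>g. list_all (\<lambda>e.
     collect (vbind (wedge e I) (push g) @ vscale (-1,0) (push g (e # I))) = [])
       [EA, EB, EC, ED]) [GA, GB, GC, GD]) ekeys"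
  by code_simp

text \<open>A function letter mixes the e-part and the exponents of a normal word, so these
  relations are evaluated on all 27 exponents for each of the 16 words e_I.\<close>

definition fun_rels_hold :: "gen list \<Rightarrow> bool" where
  "fun_rels_hold I = list_all (\<lambda>t. list_all (rel_zero (I, t)) fun_rels) tkeys"

lemma fun_rels_hold_0: "list_all fun_rels_hold (take 4 ekeys)"
  by code_simp

lemma fun_rels_hold_4: "list_all fun_rels_hold (take 4 (drop 4 ekeys))"
  by code_simp

lemma fun_rels_hold_8: "list_all fun_rels_hold (take 4 (drop 8 ekeys))"
  by code_simp

lemma fun_rels_hold_12: "list_all fun_rels_hold (drop 12 ekeys)"
  by code_simp

lemma fun_rels_vanish:
  assumes "k \<in> set bkeys" "r \<in> set fun_rels"
  shows "rel_zero k r"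
proof -
  obtain I t where k: "k = (I, t)" "I \<in> set ekeys" "t \<in> set tkeys"
    using assms(1) by (auto simp: bkeys_def)
  have "ekeys = take 4 ekeys @ take 4 (drop 4 ekeys) @ take 4 (drop 8 ekeys) @ drop 12 ekeys"
    by (simp add: ekeys_def)
  then have "list_all fun_rels_hold ekeys"
    using fun_rels_hold_0 fun_rels_hold_4 fun_rels_hold_8 fun_rels_hold_12 by (metis list_all_append)
  then show ?thesis using k assms(2) by (simp add: list_all_iff fun_rels_hold_def)
qed

context root_of_unity
begin

lemma lop_delta: "lop g (delta k) = pm.lsum delta (lmul g k)"
  by (simp add: lop_def)

lemma lop_diff: "lop g (v - w) = lop g v - lop g w"
  by (simp add: lop_def lext_diff)

lemma lop_hom: "Modules.module_hom pscale pscale (lop g)"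
  unfolding lop_def by (rule lext_hom)

lemma function_relations_rep:
  assumes "(l, r) \<in> function_relations q" "k \<in> set bkeys"
  shows "rep l (delta k) = rep r (delta k)"
proof -
  note c = coefficients(3-5) coefficients(1,2)[unfolded coefficients(5)]
  note S = fun_rels_def rep_simps rep_mult rep_power val_def c lop_linear lop_diff mult.assoc
    eval_nat_numeral
  \<comment> \<open>Each relation, a pair of polynomials, is matched with its entry in the table of
    words; the coefficients agree once mu and 1/q are written as 1 - q and -1 - q.\<close>
  have "\<exists>s\<in>set fun_rels. \<forall>w. rep l w - rep r w = pm.lsum (\<lambda>us. foldr lop us w) s"
    using assms(1) unfolding function_relations_def
    apply (elim insertE emptyE; clarify)
    subgoal by (rule bexI[of _ "fun_rels ! 0"]) (simp_all add: S, (simp add: algebra_simps)?)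
    subgoal by (rule bexI[of _ "fun_rels ! 1"]) (simp_all add: S, (simp add: algebra_simps)?)
    subgoal by (rule bexI[of _ "fun_rels ! 2"]) (simp_all add: S, (simp add: algebra_simps)?)
    subgoal by (rule bexI[of _ "fun_rels ! 3"]) (simp_all add: S, (simp add: algebra_simps)?)
    subgoal by (rule bexI[of _ "fun_rels ! 4"]) (simp_all add: S, (simp add: algebra_simps)?)
    subgoal by (rule bexI[of _ "fun_rels ! 5"]) (simp_all add: S, (simp add: algebra_simps)?)
    subgoal by (rule bexI[of _ "fun_rels ! 6"]) (simp_all add: S, (simp add: algebra_simps)?)
    subgoal by (rule bexI[of _ "fun_rels ! 7"]) (simp_all add: S, (simp add: algebra_simps)?)
    subgoal by (rule bexI[of _ "fun_rels ! 8"]) (simp_all add: S, (simp add: algebra_simps)?)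
    subgoal by (rule bexI[of _ "fun_rels ! 9"]) (simp_all add: S, (simp add: algebra_simps)?)
    subgoal by (rule bexI[of _ "fun_rels ! 10"]) (simp_all add: S, (simp add: algebra_simps)?)
    done
  then obtain s where s: "s \<in> set fun_rels" "\<And>w. rep l w - rep r w = pm.lsum (\<lambda>us. foldr lop us w) s"
    by blast
  have "pm.lsum delta [(k, (1, 0))] = delta k" by (simp add: val_def)
  then have "foldr lop us (delta k) = pm.lsum delta (wmul us [(k, (1, 0))])" for us
    using run_wmul[of us "[(k, (1, 0))]"] by simp
  then have "rep l (delta k) - rep r (delta k) =
      pm.lsum delta (collect (vbind s (\<lambda>us. wmul us [(k, (1, 0))])))"
    by (simp add: s(2))
  also have "\<dots> = 0"
    using fun_rels_vanish[OF assms(2) s(1)] unfolding rel_zero_def by simp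
  finally show ?thesis by simp
qed

lemma exterior_relations_rep:
  assumes "(l, r) \<in> exterior_relations q" "k \<in> set bkeys"
  shows "rep l (delta k) = rep r (delta k)"
proof -
  note c = coefficients(3-5) coefficients(1,2)[unfolded coefficients(5)]
  obtain I t where k: "k = (I, t)" "I \<in> set ekeys"
    using assms(2) by (auto simp: bkeys_def)
  note S = rep_simps rep_mult val_def c lop_linear lop_diff mult.assoc
  have bcd: "\<exists>g\<in>{EB, EC, ED}. x = var g" if "x \<in> {eb, ec, ed}" for x
    using that by blast
  consider x y where "x \<in> {eb, ec, ed}" "y \<in> {eb, ec, ed}" "l = x * y + y * x" "r = 0"
    | x where "x \<in> {eb, ec, ed}" "l = x * x" "r = 0"
    | "(l, r) = (ea * ea, scal (mu q) * eb * ec)"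
    | "(l, r) = (ea * ed + ed * ea + scal (mu q) * eb * ec, 0)"
    | "(l, r) = (ea * eb + scal (q ^ 2) * eb * ea - scal (mu q) * eb * ed, 0)"
    | "(l, r) = (ec * ea + scal (q ^ 2) * ea * ec + scal (mu q) * ec * ed, 0)"
    using assms(1) unfolding exterior_relations_def by blast
  then have "\<exists>s\<in>set ext_rels. \<forall>w. rep l w - rep r w = pm.lsum (\<lambda>us. foldr lop us w) s"
  proof cases
    case 1
    then obtain g h where gh: "g \<in> {EB, EC, ED}" "x = var g" "h \<in> {EB, EC, ED}" "y = var h"
      using bcd by metis
    then have "[([g, h], (1,0)), ([h, g], (1,0))] \<in> set ext_rels" by (auto simp: ext_rels_def)
    then show ?thesis using 1 gh by (intro bexI) (auto simp: S)
  next
    case 2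
    then obtain g where g: "g \<in> {EB, EC, ED}" "x = var g" using bcd by metis
    then have "[([g, g], (1,0))] \<in> set ext_rels" by (auto simp: ext_rels_def)
    then show ?thesis using 2 g by (intro bexI) (auto simp: S)
  next
    \<comment> \<open>The table begins with nine anticommutators and three squares, so the four
      relations involving e_a sit at positions 12 to 15.\<close>
    case 3
    then show ?thesis
      by (intro bexI[of _ "ext_rels ! 12"]) (simp_all add: ext_rels_def S, (simp add: algebra_simps)?)
  next
    case 4
    then show ?thesis
      by (intro bexI[of _ "ext_rels ! 13"]) (simp_all add: ext_rels_def S, (simp add: algebra_simps)?)
  next
    case 5
    then show ?thesis
      by (intro bexI[of _ "ext_rels ! 14"]) (simp_all add: ext_rels_def S, (simp add: algebra_simps)?)
  next
    case 6
    then show ?thesis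
      by (intro bexI[of _ "ext_rels ! 15"]) (simp_all add: ext_rels_def S, (simp add: algebra_simps)?)
  qed
  then obtain s where s: "s \<in> set ext_rels" "\<And>w. rep l w - rep r w = pm.lsum (\<lambda>us. foldr lop us w) s"
    by blast
  let ?d = "\<lambda>J. delta (J, t)"
  have ext: "us \<in> lists {EA, EB, EC, ED}" if "(us, c) \<in> set s" for us c
  proof -
    have "list_all (list_all (\<lambda>(us, c). list_all (\<lambda>g. rank_gen g < 4) us)) ext_rels" by code_simp
    then have "\<forall>g\<in>set us. g \<in> {EA, EB, EC, ED}"
      using s(1) that unfolding list_all_iff rank_gen_less by blast
    then show ?thesis by blast
  qed
  have "foldr lop us (?d I) = pm.lsum ?d (ewmul us [(I, (1, 0))])" if "us \<in> lists {EA, EB, EC, ED}" for us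
    using that
  proof induction
    case Nil
    show ?case by (simp add: ewmul_def val_def)
  next
    case (Cons g us)
    have "lop g (?d J) = pm.lsum ?d (wedge g J)" for J
      using Cons.hyps(1) by (auto simp: lop_delta rank_gen_less)
    then show ?case
      using Cons.IH by (simp add: ewmul_def pm.lsum_linear[OF lop_hom])
  qed
  then have "rep l (delta k) - rep r (delta k) =
      pm.lsum ?d (collect (vbind s (\<lambda>us. ewmul us [(I, (1, 0))])))"
    using ext by (auto simp: s(2) k intro!: pm.lsum_cong)
  also have "\<dots> = 0"
    using ext_rels_vanish k(2) s(1) unfolding list_all_iff by simp
  finally show ?thesis by simp
qed

lemma lsum_swap: "pm.lsum (\<lambda>x. pm.lsum (f x) ys) xs = pm.lsum (\<lambda>y. pm.lsum (\<lambda>x. f x y) xs) ys"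
proof (induction xs)
  case Nil
  show ?case by (induction ys) auto
next
  case (Cons x xs)
  obtain k c where x: "x = (k, c)" by (cases x)
  have "pm.lsum (\<lambda>y. pscale z (f k y) + g y) ys = pscale z (pm.lsum (f k) ys) + pm.lsum g ys" for z g
    by (induction ys) (auto simp: pscale.scale_right_distrib mult.commute add.left_commute)
  then show ?case using Cons by (simp add: x)
qed

lemma cross_relations_rep:
  assumes "(l, r) \<in> cross_relations q" "k \<in> set bkeys"
  shows "rep l (delta k) = rep r (delta k)"
proof -
  note c = coefficients(3-5) coefficients(1,2)[unfolded coefficients(5)]
  obtain I t where k: "k = (I, t)" "I \<in> set ekeys"
    using assms(2) by (auto simp: bkeys_def)
  obtain u v where "(u, v) \<in> {(xa, xc), (xb, xd)}"
    and lr: "(l, r) \<in> {(v * eb, eb * v), (u * ec, ec * u), (u * ed, scal (1 / q) * ed * u),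
     (v * ed, scal q * ed * v), (u * eb, eb * u + scal (q * mu q) * ed * v),
     (v * ec, ec * v + scal (q * mu q) * ed * u),
     (v * ea, scal (1 / q) * ea * v + scal (mu q) * eb * u),
     (u * ea, scal q * ea * u + scal (mu q) * ec * v + scal (q * (mu q) ^ 2) * ed * u)}"
    using assms(1) unfolding cross_relations_def by blast
  then obtain g h where gh: "(g, h) \<in> {(GA, GC), (GB, GD)}" and uv: "u = var g" "v = var h"
    by blast
  have m: "is_u g" "\<not> is_u h" "partner g = h" "partner h = g" "g \<in> set [GA, GB, GC, GD]" "h \<in> set [GA, GB, GC, GD]"
    using gh by auto
  \<comment> \<open>All eight kinds of cross relation have the same shape: a function generator
    times some e equals the combination listed by \<open>cross\<close>.\<close>
  have "\<exists>g\<in>set [GA, GB, GC, GD]. \<exists>e\<in>set [EA, EB, EC, ED]. \<forall>w. rep l w = lop g (lop e w) \<and>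
      rep r w = pm.lsum (\<lambda>(f, h). lop f (lop h w)) (cross g e)"
    using lr unfolding uv
    apply (elim insertE emptyE)
    subgoal using m by (intro bexI[of _ h] bexI[of _ EB]) (simp_all add: rep_simps rep_mult val_def c mult.assoc add.assoc)
    subgoal using m by (intro bexI[of _ g] bexI[of _ EC]) (simp_all add: rep_simps rep_mult val_def c mult.assoc add.assoc)
    subgoal using m by (intro bexI[of _ g] bexI[of _ ED]) (simp_all add: rep_simps rep_mult val_def c mult.assoc add.assoc)
    subgoal using m by (intro bexI[of _ h] bexI[of _ ED]) (simp_all add: rep_simps rep_mult val_def c mult.assoc add.assoc)
    subgoal using m by (intro bexI[of _ g] bexI[of _ EB]) (simp_all add: rep_simps rep_mult val_def c mult.assoc add.assoc)
    subgoal using m by (intro bexI[of _ h] bexI[of _ EC]) (simp_all add: rep_simps rep_mult val_def c mult.assoc add.assoc)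
    subgoal using m by (intro bexI[of _ h] bexI[of _ EA]) (simp_all add: rep_simps rep_mult val_def c mult.assoc add.assoc)
    subgoal using m by (intro bexI[of _ g] bexI[of _ EA]) (simp_all add: rep_simps rep_mult val_def c mult.assoc add.assoc)
    done
  then obtain g e where g: "g \<in> set [GA, GB, GC, GD]" "e \<in> set [EA, EB, EC, ED]"
      and lr: "\<And>w. rep l w = lop g (lop e w)"
        "\<And>w. rep r w = pm.lsum (\<lambda>(f, h). lop f (lop h w)) (cross g e)"
    by blast
  \<comment> \<open>The vector standing for e_J x f, with f the function part of the basis word.
    Both sides are images under the linear extension of \<open>?D\<close>, so equality of the lists
    of pairs (J, x) suffices.\<close>
  let ?D = "\<lambda>(J, x). pm.lsum (\<lambda>s. delta (J, s)) (act x t)"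
  have G: "lop g (delta (J, t)) = pm.lsum ?D (push g J)" if "g \<in> {GA, GB, GC, GD}" for g J
  proof -
    have "lmul g (J, t) = vbind (push g J) (\<lambda>(K, x). map (\<lambda>(s, c). ((K, s), c)) (act x t))"
      using that by auto
    moreover have "(\<lambda>p. pm.lsum delta (case p of (K, x) \<Rightarrow> map (\<lambda>(s, c). ((K, s), c)) (act x t))) = ?D"
      by (auto simp: fun_eq_iff)
    ultimately show ?thesis by (simp add: lop_delta)
  qed
  have E: "lop e (delta (J, s)) = pm.lsum (\<lambda>K. delta (K, s)) (wedge e J)" if "e \<in> {EA, EB, EC, ED}" for e J s
    using that by (auto simp: lop_delta)
  have "rep l (delta k) = pm.lsum ?D (vbind (wedge e I) (push g))"
    using g by (simp add: lr k E G pm.lsum_linear[OF lop_hom] del: list.set)  (simp add: E G pm.lsum_linear[OF lop_hom])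
  moreover have "rep r (delta k) = pm.lsum ?D (push g (e # I))"
  proof -
    have "lop f (lop h (delta k)) = pm.lsum ?D (vbind (push h I) (\<lambda>(J, x). map (\<lambda>(K, c). ((K, x), c)) (wedge f J)))"
      if "f \<in> {EA, EB, EC, ED}" "h \<in> {GA, GB, GC, GD}" for f h
    proof -
      have "lop f (?D p) = pm.lsum ?D (case p of (J, x) \<Rightarrow> map (\<lambda>(K, c). ((K, x), c)) (wedge f J))" for p
        by (cases p) (simp add: pm.lsum_linear[OF lop_hom] E[OF that(1)] lsum_swap[of _ "wedge f _"])
      then show ?thesis
        by (simp add: k G[OF that(2)] pm.lsum_linear[OF lop_hom])
    qed
    then have "pm.lsum (\<lambda>(f, h). lop f (lop h (delta k))) (cross g e) = pm.lsum (\<lambda>p. pm.lsum ?D (case p of (f, h) \<Rightarrow>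
        vbind (push h I) (\<lambda>(J, x). map (\<lambda>(K, c). ((K, x), c)) (wedge f J)))) (cross g e)"
      using cross_keys[of g e] g by (intro pm.lsum_cong) (auto split: prod.splits)
    then show ?thesis by (simp add: lr)
  qed
  ultimately have "rep l (delta k) - rep r (delta k) =
      pm.lsum ?D (collect (vbind (wedge e I) (push g) @ vscale (-1, 0) (push g (e # I))))"
    by (simp add: val_def del: push.simps)
  also have "collect (vbind (wedge e I) (push g) @ vscale (-1, 0) (push g (e # I))) = []"
    using cross_rels_vanish k(2) g unfolding list_all_iff by blast
  also have "pm.lsum ?D [] = 0" by simp
  finally show ?thesis by simp
qed

theorem rel_ideal_rep_zero:
  assumes "x \<in> rel_ideal q" "w \<in> W0"
  shows "rep x w = 0"
  using rel_ideal_rep[OF _ assms] function_relations_rep exterior_relations_rep cross_relations_rep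
  by blast

end

section \<open>Coordinates\<close>

definition unit_key :: bkey where
  "unit_key = ([], 0, 0, 0)"

text \<open>The coordinate vector is the result of acting on the basis vector that stands for 1. It
  does not depend on the chosen polynomial because the ideal acts as zero.\<close>

definition coords :: "'a::cubic_root omega \<Rightarrow> bkey \<Rightarrow>\<^sub>0 complex" where
  "coords x = root_of_unity.rep (proot TYPE('a)) (rep_omega x) (Poly_Mapping.single unit_key 1)"

lemma (in root_of_unity) unit_key_W0: "delta unit_key \<in> W0"
proof -
  have "unit_key \<in> set bkeys" by (simp add: unit_key_def bkeys_def ekeys_def tkeys_def)
  then show ?thesis by (auto simp: W0_def intro: pscale.span_base)
qed

interpretation rt: root_of_unity "proot TYPE('r::cubic_root)"
  by (intro root_of_unity.intro proot_square)

lemma coords_form: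
  "coords (form y :: 'a::cubic_root omega) = root_of_unity.rep (proot TYPE('a)) y (Poly_Mapping.single unit_key 1)"
proof -
  have "rep_omega (form y :: 'a omega) - y \<in> rel_ideal (proot TYPE('a))"
    by (metis form_eq_iff Quotient_omega Quotient_abs_rep)
  from rt.rel_ideal_rep_zero[OF this rt.unit_key_W0] show ?thesis
    by (simp add: coords_def rt.rep_simps)
qed

lemma coords_add: "coords (x + y :: 'a::cubic_root omega) = coords x + coords y"
proof (induction x rule: omega.abs_induct)
  fix x' show "coords (form x' + y) = coords (form x' :: 'a omega) + coords y"
    by (induction y rule: omega.abs_induct) (simp add: coords_form form_simps(1)[symmetric] rt.rep_simps)
qed

lemma coords_scale: "coords (sc z * x) = pscale z (coords x)"
  by (induction x rule: omega.abs_induct)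
    (simp add: sc_def form_simps(4)[symmetric] coords_form rt.rep_mult rt.rep_simps)

definition kword :: "bkey \<Rightarrow> gen list" where
  "kword k = (case k of (I, m, n, l) \<Rightarrow> I @ replicate m GA @ replicate n GB @ replicate l GC)"

lemma kword_prod: "prod_list (map gel (kword k)) = nword k"
proof -
  have "prod_list (map gel (replicate n g)) = gel g ^ n" for n g
    by (induction n) auto
  then show ?thesis by (cases k) (simp add: kword_def nword_def fword_def mult.assoc)
qed

text \<open>A normal word acting on 1 reproduces itself. Hence \<open>coords\<close> sends the
  normal words to distinct unit vectors, which is their linear independence.\<close>

lemma wmul_kword:
  "list_all (\<lambda>k. wmul (kword k) [(([], 0, 0, 0), (1, 0))] = [(k, (1, 0))]) bkeys"
  by code_simp

lemma coords_nword: "k \<in> set bkeys \<Longrightarrow> coords (nword k :: 'a::cubic_root omega) = Poly_Mapping.single k 1"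
proof -
  assume k: "k \<in> set bkeys"
  let ?q = "proot TYPE('a)" and ?d = "\<lambda>k. Poly_Mapping.single k 1 :: bkey \<Rightarrow>\<^sub>0 complex"
  have w: "form (prod_list (map var us)) = (prod_list (map gel us) :: 'a omega)" for us
    by (induction us) (auto simp: form_simps gel_def)
  have r: "root_of_unity.rep ?q (prod_list (map var us)) v = foldr (root_of_unity.lop ?q) us v" for us v
    by (induction us) (auto simp: rt.rep_simps rt.rep_mult)
  have "coords (nword k :: 'a omega) = foldr (root_of_unity.lop ?q) (kword k) (?d unit_key)"
    unfolding kword_prod[symmetric] w[symmetric] coords_form r ..
  also have "?d unit_key = primitive_root.lsum pscale ?q ?d [(([], 0, 0, 0), (1, 0))]"
    by (simp add: unit_key_def val_def)
  also have "foldr (root_of_unity.lop ?q) (kword k) \<dots> = primitive_root.lsum pscale ?q ?d [(k, (1, 0))]"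
    unfolding rt.run_wmul using wmul_kword k by (simp add: list_all_iff)
  also have "\<dots> = ?d k" by (simp add: val_def)
  finally show ?thesis .
qed

lemma hom_eq_on_span:
  assumes "om_linear (f :: 'a::cubic_root omega \<Rightarrow> 'a omega)"
    "om_linear g"
    "\<And>k. k \<in> K \<Longrightarrow> f (nword k) = g (nword k)" "x \<in> om.span (nword ` K)"
  shows "f x = g x"
proof -
  interpret f: Modules.module_hom "\<lambda>z x. sc z * x" "\<lambda>z x. sc z * x" f by fact
  interpret g: Modules.module_hom "\<lambda>z x. sc z * x" "\<lambda>z x. sc z * x" g by fact
  show ?thesis
    using assms(4)
  proof (rule om.span_induct)
    show "om.subspace {x. f x = g x}"
      by (rule om.subspaceI) (auto simp: f.add g.add f.scale g.scale f.zero g.zero)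
  qed (use assms(3) in auto)
qed

lemma om_homI:
  fixes f :: "'a::cubic_root omega \<Rightarrow> 'b::cubic_root omega"
  assumes "\<And>x y. f (x + y) = f x + f y" "\<And>z x. f (sc z * x) = sc z * f x"
  shows "om_linear f"
  by unfold_locales (use assms in \<open>auto simp: om.scale_right_distrib om.scale_left_distrib\<close>)

text \<open>The linear map with prescribed values on normal words; it rests on the coordinates being
  well defined on the quotient. The Hodge operator and the maps h and g of the certificate are of
  this kind.\<close>

definition lin_of :: "(bkey \<Rightarrow> svec) \<Rightarrow> 'a::cubic_root omega \<Rightarrow> 'a omega" where
  "lin_of F x = (\<Sum>k\<in>set bkeys. sc (Poly_Mapping.lookup (coords x) k) * nsum (F k))"

lemma lin_of_hom: "om_linear (lin_of F)"
  by (rule om_homI)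
    (simp_all add: lin_of_def coords_add coords_scale lookup_add om.scale_left_distrib sum.distrib om.scale_sum_right)

lemma lin_of_nword: "k \<in> set bkeys \<Longrightarrow> lin_of F (nword k) = nsum (F k)"
proof -
  assume k: "k \<in> set bkeys"
  have "lin_of F (nword k) = (\<Sum>l\<in>set bkeys. if l = k then nsum (F l) else 0)"
    unfolding lin_of_def coords_nword[OF k]
    by (rule sum.cong) (auto simp: lookup_single when_def sc_simps)
  then show ?thesis using k by (simp add: sum.delta)
qed

section \<open>Homogeneous lists and the spaces of forms\<close>

definition valid :: "nat \<Rightarrow> svec \<Rightarrow> bool" where
  "valid i xs \<longleftrightarrow> (\<forall>(k, c)\<in>set xs. k \<in> set bkeys \<and> length (fst k) = i)"

lemma validD: "valid i xs \<Longrightarrow> (k, c) \<in> set xs \<Longrightarrow> k \<in> set bkeys" "valid i xs \<Longrightarrow> (k, c) \<in> set xs \<Longrightarrow> length (fst k) = i"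
  by (auto simp: valid_def)

lemma valid_append: "valid i (xs @ ys) \<longleftrightarrow> valid i xs \<and> valid i ys"
  by (auto simp: valid_def)

lemma valid_vscale: "valid i (vscale c xs) \<longleftrightarrow> valid i xs"
  by (auto simp: valid_def vscale_def)

lemma valid_vbind:
  assumes "valid i xs" "\<And>k. k \<in> set bkeys \<Longrightarrow> length (fst k) = i \<Longrightarrow> valid j (f k)"
  shows "valid j (vbind xs f)"
proof -
  have "l \<in> set bkeys \<and> length (fst l) = j" if l: "(l, d) \<in> set (vbind xs f)" for l d
  proof -
    obtain k c e where k: "(k, c) \<in> set xs" "(l, e) \<in> set (f k)"
      using vbind_keys[OF l] by blast
    then have "valid j (f k)" using assms validD[OF assms(1) k(1)] by blast
    then show ?thesis using validD k(2) by blast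
  qed
  then show ?thesis by (auto simp: valid_def)
qed

lemma collect_keys: "(k, c) \<in> set (collect xs) \<Longrightarrow> k \<in> fst ` set xs"
proof (induction xs arbitrary: k c)
  case (Cons x xs)
  have ins: "(k, c) \<in> set (insert_term l d ys) \<Longrightarrow> k = l \<or> k \<in> fst ` set ys" for k c l d ys
    by (induction ys) (force simp: Let_def split: if_splits)+
  obtain l d where x: "x = (l, d)" by (cases x)
  have IH: "fst ` set (collect xs) \<subseteq> fst ` set xs" using Cons.IH by auto
  show ?case
  proof (cases "d = (0, 0)")
    case True
    then have "(k, c) \<in> set (collect xs)" using Cons.prems by (simp add: x)
    then show ?thesis using Cons.IH by (simp add: x)
  next
    case False
    then have "(k, c) \<in> set (insert_term l d (collect xs))" using Cons.prems by (simp add: x)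
    from ins[OF this] have "k = l \<or> k \<in> fst ` set xs" using IH by blast
    then show ?thesis by (simp add: x)
  qed
qed simp

lemma valid_collect: "valid i xs \<Longrightarrow> valid i (collect xs)"
  unfolding valid_def by (auto dest!: collect_keys)

lemma lin_of_lsum:
  "valid i xs \<Longrightarrow> lin_of F (nsum xs) = nsum (vbind xs F)"
  by (simp add: om.lsum_linear[OF lin_of_hom]) (rule om.lsum_cong, simp add: lin_of_nword validD)

definition forms :: "nat \<Rightarrow> 'a::cubic_root omega set" where
  "forms i = om.span (nword ` {k \<in> set bkeys. length (fst k) = i})"

lemma forms_subspace: "om.subspace (forms i)"
  unfolding forms_def by (rule om.subspace_span)

lemma lsum_forms: "valid i xs \<Longrightarrow> nsum xs \<in> forms i"
  unfolding forms_def by (rule om.lsum_in_subspace) (auto simp: valid_def intro!: om.span_base)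

lemma hom_forms:
  assumes "om_linear f"
    "\<And>k. k \<in> set bkeys \<Longrightarrow> length (fst k) = i \<Longrightarrow> f (nword k) \<in> forms j" "x \<in> forms i"
  shows "f x \<in> forms j"
proof -
  interpret f: Modules.module_hom "\<lambda>z x. sc z * x" "\<lambda>z x. sc z * x" f by fact
  show ?thesis
    using assms(3) unfolding forms_def[of i]
  proof (rule om.span_induct)
    show "om.subspace {x. f x \<in> forms j}"
      using forms_subspace[of j]
      by (intro om.subspaceI) (auto simp: f.add f.scale f.zero om.subspace_def)
  qed (use assms(2) in auto)
qed

section \<open>The differential\<close>

definition theta_form :: "'a::cubic_root omega" where
  "theta_form = gel EA + gel ED"

definition diff :: "nat \<Rightarrow> 'a::cubic_root omega \<Rightarrow> 'a omega" where
  "diff i w = - (theta_form * w - sc ((- 1) ^ i) * (w * theta_form))"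

lemma diff_hom: "om_linear (diff i)"
proof (rule om_homI)
  fix x y :: "'a omega" and z
  show "diff i (x + y) = diff i x + diff i y"
    by (simp add: diff_def distrib_left distrib_right)
  have "theta_form * (sc z * x) = sc z * (theta_form * x)" by (metis sc_commute mult.assoc)
  moreover have "sc ((- 1) ^ i) * (sc z * x * theta_form) = sc z * (sc ((- 1) ^ i) * (x * theta_form))"
    by (simp add: mult.assoc mult.commute)
  ultimately show "diff i (sc z * x) = sc z * diff i x"
    by (simp add: diff_def om.scale_right_diff_distrib)
qed

text \<open>The square e_a e_a = mu e_b e_c is cancelled by e_a e_d + e_d e_a = -mu e_b e_c, and e_d
  squares to zero.\<close>

lemma theta_form_square: "theta_form * theta_form = (0 :: 'a::cubic_root omega)"
proof -
  have "sc (1 - proot TYPE('a)) * (gel EB * gel EC) + sc (- 1 + proot TYPE('a)) * (gel EB * gel EC) = (0 :: 'a omega)"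
    by (simp add: om.scale_left_distrib[symmetric] sc_simps)
  then show ?thesis
    using exterior_relation_bcd(1)[of ED ED, where 'a = 'a]
    by (simp add: theta_form_def distrib_left distrib_right exterior_relation_a sc_simps add.assoc[symmetric])
qed

text \<open>A graded commutator with an odd element of square zero squares to zero: the two mixed
  terms theta w theta have opposite signs. The degree is a parameter here, so \<open>w\<close> may
  be arbitrary.\<close>

lemma diff_square: "diff (Suc i) (diff i w) = (0 :: 'a::cubic_root omega)"
proof -
  let ?s = "sc ((- 1) ^ i) :: 'a omega"
  have tt: "theta_form * (theta_form * x) = (0 :: 'a omega)" "x * theta_form * theta_form = (0 :: 'a omega)" for x
    by (simp_all add: mult.assoc[symmetric] theta_form_square) (simp add: mult.assoc theta_form_square)
  have s: "theta_form * (?s * x) = ?s * (theta_form * x)" for x by (metis sc_commute mult.assoc)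
  have neg: "sc ((- 1) ^ Suc i) * x = - (?s * x)" for x by simp
  have "diff (Suc i) (diff i w) = - (theta_form * diff i w + ?s * (diff i w * theta_form))"
    unfolding diff_def[of "Suc i"] neg by simp
  also have "theta_form * diff i w = ?s * (theta_form * (w * theta_form))"
    by (simp add: diff_def right_diff_distrib tt s)
  also have "diff i w * theta_form = - (theta_form * (w * theta_form))"
    by (simp add: diff_def left_diff_distrib mult.assoc tt(2)[unfolded mult.assoc])
  finally show ?thesis by simp
qed

fun chi :: "nat \<Rightarrow> eis" where
  "chi 0 = (0, 0)" | "chi (Suc 0) = (1, 0)" | "chi (Suc (Suc 0)) = (-1, 0)"
| "chi (Suc (Suc (Suc n))) = chi n"

text \<open>The right-hand side of $a^m b^n c^k \theta = \sum_i e_i f_i$, found by computing the 27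
  products; \<open>chi\<close> is the nontrivial character of order two modulo 3.\<close>

definition mul_theta :: "nat \<times> nat \<times> nat \<Rightarrow> svec" where
  "mul_theta t = (case t of (m, n, k) \<Rightarrow>
     [(([EA], m, n, k), qpow (m + n + 2 * k)),
      (([ED], m, n, k), eadd (qpow (k + 2 * m + 2 * n)) (emul (3, 3) (emul (chi (m + n)) (chi (Suc k)))))] @
     (if 0 < k then [(([EB], cyc m, n, k - 1), emul (1, -1) (emul (qpow n) (chi k)))] else []) @
     (if k < 2 then [(([EC], cyc (cyc m), n, Suc k), emul (1, -1) (emul (qpow (m + 2 + 2 * k)) (chi (m + n))))] else []) @
     (if 0 < n then [(([EC], cyc (cyc m), n - 1, k), emul (1, -1) (emul (qpow (2 * k)) (chi n)))] else []) @
     (if 0 < n \<and> 0 < k then [(([ED], m, n - 1, k - 1), emul (-3, 0) (emul (qpow (2 + 2 * m)) (emul (chi n) (chi k))))] else []))"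

lemma mul_theta_correct:
  "list_all (\<lambda>t. collect (wmul (kword ([], t)) [(([EA], 0, 0, 0), (1, 0)), (([ED], 0, 0, 0), (1, 0))]
     @ vscale (-1, 0) (mul_theta t)) = []) tkeys"
  by code_simp

lemma mul_theta_keys:
  "list_all (\<lambda>t. list_all (\<lambda>(k, c). length (fst k) = 1 \<and> fst k \<in> set ekeys \<and> snd k \<in> set tkeys) (mul_theta t)) tkeys"
  by code_simp

text \<open>Only left multiplication by generators is implemented. The product of e_I f with theta
  from the right is therefore formed by letting e_I act from the left on the tabulated product of f
  and theta; the parity of the degree supplies the sign.\<close>

definition diff_key :: "bkey \<Rightarrow> svec" where
  "diff_key k = collect (vscale (-1, 0) (lmul EA k @ lmul ED k)
     @ vscale (if even (length (fst k)) then (1, 0) else (-1, 0)) (wmul (fst k) (mul_theta (snd k))))"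

lemma valid_lmul: "k \<in> set bkeys \<Longrightarrow> rank_gen g < 4 \<Longrightarrow> valid (Suc (length (fst k))) (lmul g k)"
  using lmul_keys[of k] by (fastforce simp: valid_def)

lemma valid_lmul_fun: "k \<in> set bkeys \<Longrightarrow> \<not> rank_gen g < 4 \<Longrightarrow> valid (length (fst k)) (lmul g k)"
  using lmul_keys[of k] by (fastforce simp: valid_def)

lemma valid_wmul:
  "valid i xs \<Longrightarrow> valid (i + length (filter (\<lambda>g. rank_gen g < 4) us)) (wmul us xs)"
proof (induction us)
  case Nil
  then show ?case by (simp add: wmul_def)
next
  case (Cons g us)
  let ?j = "i + length (filter (\<lambda>g. rank_gen g < 4) us)"
  have "valid (?j + (if rank_gen g < 4 then 1 else 0)) (vbind (wmul us xs) (lmul g))"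
    using Cons.IH[OF Cons.prems] by (rule valid_vbind) (auto dest: valid_lmul valid_lmul_fun)
  then show ?case by (auto simp: wmul_def dest: valid_collect)
qed

lemma wmul_sound:
  assumes "valid i xs"
  shows "prod_list (map gel us) * nsum xs = (nsum (wmul us xs) :: 'a::cubic_root omega)"
proof (induction us)
  case (Cons g us)
  have "gel g * nsum (wmul us xs) = (om.lsum (\<lambda>k. nsum (lmul g k)) (wmul us xs) :: 'a omega)"
    unfolding lsum_lmult
    by (rule om.lsum_cong, rule lmul_sound) (use valid_wmul[OF assms] in \<open>auto dest: validD\<close>)
  then show ?case using Cons by (simp add: wmul_def mult.assoc)
qed (simp add: wmul_def)

lemma valid_mul_theta: "t \<in> set tkeys \<Longrightarrow> valid 1 (mul_theta t)"
  using mul_theta_keys by (fastforce simp: list_all_iff valid_def bkeys_def)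

lemma mul_theta_sound:
  assumes "t \<in> set tkeys"
  shows "fword t * theta_form = (nsum (mul_theta t) :: 'a::cubic_root omega)"
proof -
  let ?x = "[(([EA], 0, 0, 0), (1, 0)), (([ED], 0, 0, 0), (1, 0))] :: svec"
  have x: "valid 1 ?x" by (simp add: valid_def bkeys_def ekeys_def tkeys_def)
  have theta_form: "theta_form = (nsum ?x :: 'a omega)"
    by (simp add: theta_form_def nword_def fword_def val_def sc_simps)
  have "nword ([], t) * theta_form = (nsum (wmul (kword ([], t)) ?x) :: 'a omega)"
    unfolding kword_prod[of "([], t)", symmetric] theta_form by (rule wmul_sound[OF x])
  moreover have "nsum (wmul (kword ([], t)) ?x) - nsum (mul_theta t)
      = (nsum (collect (wmul (kword ([], t)) ?x @ vscale (-1, 0) (mul_theta t))) :: 'a omega)"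
    by (simp add: val_def)
  moreover have "collect (wmul (kword ([], t)) ?x @ vscale (-1, 0) (mul_theta t)) = []"
    using mul_theta_correct assms unfolding list_all_iff by blast
  ultimately show "fword t * theta_form = (nsum (mul_theta t) :: 'a omega)"
    by (simp only: om.lsum_Nil right_minus_eq) (simp add: nword_def)
qed

lemma bkeysE:
  assumes "k \<in> set bkeys"
  obtains I t where "k = (I, t)" "I \<in> set ekeys" "t \<in> set tkeys"
  using assms by (auto simp: bkeys_def)

lemma ekeys_rank: "I \<in> set ekeys \<Longrightarrow> filter (\<lambda>g. rank_gen g < 4) I = I"
  by (auto simp: ekeys_def)

lemma valid_diff_key: "k \<in> set bkeys \<Longrightarrow> valid (Suc (length (fst k))) (diff_key k)"
proof -
  assume k: "k \<in> set bkeys"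
  then obtain I t where kt: "k = (I, t)" "I \<in> set ekeys" "t \<in> set tkeys" by (rule bkeysE)
  have "valid (Suc (length (fst k))) (wmul (fst k) (mul_theta (snd k)))"
    using valid_wmul[OF valid_mul_theta[OF kt(3)], of I] by (simp add: kt ekeys_rank)
  then show ?thesis
    unfolding diff_key_def using k
    by (intro valid_collect) (simp add: valid_append valid_vscale valid_lmul)
qed

lemma diff_nword:
  assumes "k \<in> set bkeys" "length (fst k) = i"
  shows "diff i (nword k) = (nsum (diff_key k) :: 'a::cubic_root omega)"
proof -
  obtain I t where k: "k = (I, t)" "I \<in> set ekeys" "t \<in> set tkeys"
    using assms(1) by (rule bkeysE)
  let ?m1 = "(if even (length (fst k)) then (1, 0) else (-1, 0)) :: eis"
  have "nword k * theta_form = (eword I * (fword t * theta_form) :: 'a omega)" by (simp add: k nword_def mult.assoc)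
  also have "\<dots> = nsum (wmul I (mul_theta t))"
    unfolding mul_theta_sound[OF k(3)] by (rule wmul_sound[OF valid_mul_theta[OF k(3)]])
  finally have r: "nword k * theta_form = (nsum (wmul I (mul_theta t)) :: 'a omega)" .
  have l: "theta_form * nword k = (nsum (lmul EA k @ lmul ED k) :: 'a omega)"
    by (simp add: theta_form_def distrib_right lmul_sound[OF assms(1)] del: lmul.simps)
  have v: "val (proot TYPE('a)) ?m1 = (- 1) ^ i" using assms(2) by (auto simp: val_def)
  have "diff i (nword k) = - nsum (lmul EA k @ lmul ED k) + sc (val (proot TYPE('a)) ?m1) * (nsum (wmul I (mul_theta t)) :: 'a omega)"
    unfolding diff_def l r v by simp
  also have "\<dots> = nsum (diff_key k)"
    unfolding diff_key_def by (simp add: k val_def del: lmul.simps)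
  finally show ?thesis .
qed

lemma diff_lsum:
  assumes "valid i xs"
  shows "diff i (nsum xs) = (nsum (vbind xs diff_key) :: 'a::cubic_root omega)"
  by (simp add: om.lsum_linear[OF diff_hom]) (rule om.lsum_cong, use assms in \<open>simp add: diff_nword validD\<close>)

lemma diff_forms: "x \<in> forms i \<Longrightarrow> diff i x \<in> forms (Suc i)"
  by (rule hom_forms[OF diff_hom]) (use valid_diff_key in \<open>auto simp: diff_nword intro!: lsum_forms\<close>)

section \<open>The Hodge operator\<close>

text \<open>The prescribed coefficients become integral because 1 + q^2 = -q: thus 1/(1 + q^2) = 1 +
  q, q^2/(1 + q^2) = -q and 1/q^2 = q.\<close>

definition star_word :: "gen list \<Rightarrow> (gen list \<times> eis) list" where
  "star_word I = the (map_of
    [([], [([EA,EB,EC,ED], (1,0))]),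
     ([EA,EB,EC,ED], [([], (1,0))]),
     ([EA], [([EA,EB,EC], (-1,0)), ([EB,EC,ED], (-1,1))]),
     ([EB], [([EA,EB,ED], (-1,0))]),
     ([EC], [([EA,EC,ED], (-1,-1))]),
     ([ED], [([EB,EC,ED], (1,0))]),
     ([EA,EB], [([EA,EB], (-1,0)), ([EB,ED], (2,-2))]),
     ([EA,EC], [([EA,EC], (1,0))]),
     ([EA,ED], [([EB,EC], (2,2)), ([EA,ED], (1,2))]),
     ([EB,EC], [([EA,ED], (0,-2)), ([EB,EC], (-1,-2))]),
     ([EB,ED], [([EB,ED], (1,0))]),
     ([EC,ED], [([EC,ED], (-1,0))]),
     ([EA,EB,EC], [([EA], (-1,0)), ([ED], (-1,1))]),
     ([EA,EB,ED], [([EB], (-1,0))]),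
     ([EA,EC,ED], [([EC], (0,1))]),
     ([EB,EC,ED], [([ED], (1,0))])] I)"

definition star_key :: "bkey \<Rightarrow> svec" where
  "star_key k = map (\<lambda>(J, c). ((J, snd k), c)) (star_word (fst k))"

definition star :: "'a::cubic_root omega \<Rightarrow> 'a omega" where
  "star = lin_of star_key"

lemma star_word_keys:
  "list_all (\<lambda>I. length I \<le> 4 \<and> list_all (\<lambda>(J, c). J \<in> set ekeys \<and> length J = 4 - length I) (star_word I)) ekeys"
  by code_simp

lemma valid_star_key: "k \<in> set bkeys \<Longrightarrow> valid (4 - length (fst k)) (star_key k)"
  using star_word_keys by (elim bkeysE) (fastforce simp: valid_def star_key_def list_all_iff bkeys_def)

lemma star_hom: "om_linear star"
  unfolding star_def by (rule lin_of_hom)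

lemma star_nword: "k \<in> set bkeys \<Longrightarrow> star (nword k) = nsum (star_key k)"
  unfolding star_def by (rule lin_of_nword)

lemma star_lsum: "valid i xs \<Longrightarrow> star (nsum xs) = nsum (vbind xs star_key)"
  unfolding star_def by (rule lin_of_lsum)

lemma star_forms: "x \<in> forms i \<Longrightarrow> star x \<in> forms (4 - i)"
  by (rule hom_forms[OF star_hom]) (use valid_star_key in \<open>auto simp: star_nword intro!: lsum_forms\<close>)

section \<open>A certificate for the Maxwell operator\<close>

text \<open>Each entry is a form $w_j$ with a functional. Functionals supported in degree 2 see only
  $\mathrm{d}A$; they are coordinates on the eigenspaces of $\star$. The tables come from
  Gaussian elimination on the nine weight spaces of $\Omega^1$, and the factor 12 clears denominators.\<close>

definition flat_basis :: "(svec \<times> svec) list" where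
  "flat_basis = [
    ([(([EB],1,0,2),(1,0))], [(([EB],1,0,2),(12,0))]),
    ([(([EC],2,2,0),(1,0))], [(([EC],2,2,0),(12,0))]),
    ([(([EA],0,0,0),(1,0)), (([ED],0,0,0),(1,0))], [(([EA],0,0,0),(12,0))]),
    ([(([EC],2,0,1),(1,0)), (([ED],0,0,0),(-1,0))], [(([EC],2,0,1),(12,0)), (([EB],1,1,0),(0,-12))])]"

definition sd_basis :: "(svec \<times> svec) list" where
  "sd_basis = [
    ([(([ED],2,0,2),(0,1)), (([EB],0,1,2),(1,0))], [(([EB,ED],0,0,1),(4,-4)), (([EA,EB],0,0,1),(0,-12))]),
    ([(([ED],2,1,0),(1,-1)), (([EA],2,1,0),(1,0)), (([EC],1,1,1),(1,0))], [(([EA,EC],1,0,0),(-8,-4))]),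
    ([(([ED],1,1,2),(0,1)), (([EB],2,2,2),(-1,0)), (([ED],1,0,1),(-1,0)), (([EB],2,1,1),(0,-1))], [(([EB,ED],2,1,1),(-8,-4)), (([EA,EB],2,1,1),(-12,0))]),
    ([(([ED],1,2,0),(1,2)), (([EA],1,2,0),(0,1)), (([EC],0,2,1),(1,0))], [(([EA,EC],0,1,0),(-4,-8))]),
    ([(([EA],2,2,0),(1,0))], [(([EA,EC],1,1,0),(8,4))]),
    ([(([ED],2,0,1),(0,-1)), (([EC],1,0,2),(1,0))], [(([EB,ED],0,0,0),(4,8)), (([EA,EB],0,0,0),(12,12))]),
    ([(([EA],1,0,0),(1,0))], [(([EA,EC],0,0,1),(-8,-4))]),
    ([(([EA],0,1,0),(1,0))], [(([EA,EC],2,0,0),(-8,-4))]),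
    ([(([ED],1,0,2),(1,0))], [(([EB,ED],2,0,1),(-8,-4)), (([EA,EB],2,0,1),(-12,0))]),
    ([(([ED],1,1,0),(1,0)), (([ED],1,2,1),(0,-1)), (([EC],0,0,0),(-1,0))], [(([EA,EC],0,0,0),(4,-4))]),
    ([(([ED],0,0,1),(1,0))], [(([EB,ED],1,0,0),(8,4)), (([EA,EB],1,0,0),(12,0))]),
    ([(([ED],2,1,1),(1,0)), (([ED],2,0,0),(0,1))], [(([EB,ED],0,1,0),(-4,-8)), (([EA,EB],0,1,0),(-12,-12))])]"

definition asd_basis :: "(svec \<times> svec) list" where
  "asd_basis = [
    ([(([EB],0,1,2),(1,0)), (([EA],2,0,2),(0,-1))], [(([EA,EB],0,0,1),(4,8))]),
    ([(([ED],2,1,0),(0,-1)), (([EC],1,1,1),(1,0))], [(([EC,ED],1,0,0),(-8,-4))]),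
    ([(([EB],2,2,2),(-1,0)), (([EA],1,1,2),(0,-1)), (([EA],1,0,1),(1,0)), (([EB],2,1,1),(0,-1))], [(([EA,EB],2,1,1),(4,-4))]),
    ([(([ED],1,2,0),(1,0)), (([EC],0,2,1),(0,-1))], [(([EC,ED],0,1,0),(4,-4))]),
    ([(([ED],2,0,1),(1,0)), (([EB],0,0,0),(1,0))], [(([EA,EB],0,0,0),(-8,-4))]),
    ([(([ED],2,2,0),(1,0))], [(([EC,ED],1,2,1),(-4,-8))]),
    ([(([ED],1,0,0),(1,0))], [(([EC,ED],0,0,1),(8,4))]),
    ([(([ED],0,1,0),(1,0))], [(([EC,ED],2,0,0),(8,4))]),
    ([(([ED],1,0,2),(1,0)), (([EB],2,0,1),(0,1))], [(([EA,EB],2,0,1),(8,4))]),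
    ([(([ED],1,1,0),(-1,0)), (([ED],1,2,1),(0,1)), (([EB],2,2,0),(0,-1))], [(([EA,EB],2,2,0),(-8,-4))]),
    ([(([ED],0,0,1),(1,0)), (([EB],1,0,0),(0,-1))], [(([EA,EB],1,0,0),(-8,-4))]),
    ([(([ED],2,0,0),(0,1)), (([ED],2,1,1),(1,0)), (([EB],0,1,0),(1,1))], [(([EA,EB],0,1,0),(4,8))])]"

text \<open>The table of h. On exact forms the other two terms of the identity vanish, so h/12
  supplies a potential. Its 26 rows, the 54 rows of \<open>maxwell_part\<close> and the 28 forms w_j
  add up to 108 = 4 * 27, the dimension of the space of 1-forms; the identity thus leaves no slack
  in any of the three ranks.\<close>

definition exact_part :: "(bkey \<times> svec) list" where
  "exact_part = [
    (([EB],1,1,0), [(([],0,1,1),(-4,-8))]),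
    (([EB],1,2,1), [(([],0,2,2),(4,-4))]),
    (([EB],0,0,1), [(([],2,0,2),(-8,-4))]),
    (([EC],1,0,0), [(([],2,1,0),(8,4))]),
    (([EC],1,2,2), [(([],2,2,1),(8,4))]),
    (([EC],0,0,2), [(([],1,1,2),(-4,-8))]),
    (([EB],2,0,0), [(([],1,0,1),(8,4)), (([],1,1,2),(4,-4))]),
    (([EC],0,1,0), [(([],1,2,0),(-8,-4))]),
    (([EA],2,0,1), [(([],2,0,1),(-8,-4))]),
    (([EB],0,1,1), [(([],2,1,2),(4,8))]),
    (([EC],1,1,0), [(([],2,2,0),(-8,-4))]),
    (([EC],0,0,1), [(([],1,0,0),(8,4))]),
    (([EA],1,1,1), [(([],1,0,0),(-4,-8)), (([],1,1,1),(-8,-4))]),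
    (([EB],2,2,1), [(([],1,2,2),(4,-4))]),
    (([EA],0,0,2), [(([],0,0,2),(-8,-4))]),
    (([EC],2,0,0), [(([],0,1,0),(8,4))]),
    (([EC],2,2,2), [(([],0,2,1),(4,8))]),
    (([EA],1,0,2), [(([],1,0,2),(-4,4))]),
    (([EA],1,1,0), [(([],1,1,0),(-4,4))]),
    (([EA],1,2,1), [(([],1,2,1),(-4,4))]),
    (([EA],0,0,1), [(([],0,0,1),(-4,4))]),
    (([EB],1,1,1), [(([],0,1,2),(4,8))]),
    (([EC],2,2,1), [(([],0,2,0),(4,-4))]),
    (([EA],2,0,0), [(([],2,0,0),(-4,4))]),
    (([EA],2,1,1), [(([],2,1,1),(-4,4))]),
    (([EB],0,2,1), [(([],2,2,2),(4,-4))])]"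

text \<open>The table of g, which recovers from Max A the part of A that the forms w_j and the exact
  forms miss. It has 54 rows, the rank of Max.\<close>

definition maxwell_part :: "(bkey \<times> svec) list" where
  "maxwell_part = [
    (([ED],0,0,0), [(([ED],0,0,0),(-2,-2)), (([ED],0,2,2),(1,0)), (([EA],0,2,2),(1,0)), (([EA],0,1,1),(1,0)), (([ED],0,1,1),(1,0))]),
    (([EB],1,1,0), [(([EA],0,1,1),(-2,-2)), (([ED],0,0,0),(0,4)), (([ED],0,1,1),(-8,-6)), (([EC],2,1,2),(6,6))]),
    (([EB],1,2,1), [(([EA],0,2,2),(-2,0)), (([EA],0,1,1),(-2,0)), (([ED],0,1,1),(-2,4)), (([EC],2,1,2),(4,0)), (([ED],0,2,2),(0,2)), (([ED],0,0,0),(4,4))]),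
    (([EA],0,1,1), [(([ED],0,0,0),(6,4)), (([ED],0,1,1),(0,7)), (([EC],2,1,2),(2,-6)), (([EA],0,1,1),(-2,1)), (([ED],0,2,2),(0,1)), (([EA],0,2,2),(0,1))]),
    (([ED],0,1,1), [(([EC],2,1,2),(-2,0)), (([ED],0,0,0),(-2,-2)), (([ED],0,1,1),(1,-2)), (([ED],0,2,2),(1,0)), (([EA],0,2,2),(1,0)), (([EA],0,1,1),(1,0))]),
    (([EA],0,0,0), [(([ED],0,2,2),(0,1)), (([EA],0,2,2),(0,1)), (([EA],0,1,1),(0,1)), (([ED],0,1,1),(0,1)), (([ED],0,0,0),(2,2))]),
    (([ED],2,0,2), [(([ED],2,0,2),(-4,-2)), (([EB],0,1,2),(0,2))]),
    (([EA],2,1,0), [(([ED],2,1,0),(2,4)), (([EC],1,1,1),(0,2))]),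
    (([EC],1,2,2), [(([EA],2,2,1),(-2,0)), (([ED],2,1,0),(10,8)), (([EC],1,1,1),(4,6)), (([EB],0,2,0),(0,-6)), (([ED],2,2,1),(0,-4))]),
    (([EA],2,2,1), [(([EB],0,2,0),(0,4)), (([EA],2,2,1),(0,-2))]),
    (([ED],2,2,1), [(([ED],2,2,1),(-2,0)), (([EC],1,1,1),(0,-2)), (([EB],0,2,0),(0,2)), (([ED],2,1,0),(-2,-4))]),
    (([EC],0,0,2), [(([EA],1,0,1),(0,-2)), (([EB],2,1,1),(-6,-6)), (([ED],1,0,1),(4,4))]),
    (([ED],1,1,2), [(([ED],1,1,2),(-4,-2)), (([EB],2,2,2),(0,-2)), (([ED],1,0,1),(0,-2)), (([EB],2,1,1),(-4,-2)), (([EA],1,0,1),(-2,-2))]),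
    (([EC],0,1,0), [(([ED],1,2,0),(2,-2)), (([EC],0,2,1),(-2,-2))]),
    (([EA],1,0,1), [(([EB],2,1,1),(0,-4)), (([EA],1,0,1),(0,-2))]),
    (([ED],1,0,1), [(([EB],2,1,1),(0,-2)), (([ED],1,0,1),(-2,0))]),
    (([EB],0,0,0), [(([EC],1,0,2),(0,-2))]),
    (([EA],2,0,1), [(([EA],2,1,2),(2,2)), (([EC],1,0,2),(4,2)), (([ED],2,1,2),(6,4))]),
    (([EB],0,1,1), [(([ED],2,1,2),(0,2))]),
    (([EB],0,2,2), [(([EB],0,2,2),(-2,-2)), (([ED],2,1,2),(4,4))]),
    (([EC],1,1,0), [(([ED],2,2,0),(2,0)), (([EC],1,2,1),(2,0))]),
    (([EC],0,0,1), [(([ED],1,0,0),(2,4)), (([ED],1,1,1),(2,-2)), (([EC],0,1,2),(-2,-2))]),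
    (([EA],1,1,1), [(([EA],1,2,2),(0,2)), (([ED],1,1,1),(-6,-6)), (([EC],0,1,2),(-4,-2)), (([ED],1,2,2),(2,6))]),
    (([EB],2,0,2), [(([EB],2,0,2),(-2,-2))]),
    (([EA],1,0,0), [(([EB],2,1,0),(-2,-2)), (([ED],1,0,0),(-2,0)), (([ED],1,1,1),(2,0)), (([EC],0,1,2),(0,-2))]),
    (([EB],2,2,1), [(([ED],1,2,2),(2,0))]),
    (([ED],1,0,0), [(([ED],1,0,0),(-2,0)), (([ED],1,1,1),(0,2))]),
    (([EC],0,2,0), [(([EC],0,2,0),(-2,-2))]),
    (([EA],0,0,2), [(([ED],0,0,2),(-2,0)), (([EB],1,0,1),(2,0))]),
    (([EC],2,0,0), [(([ED],0,1,0),(-2,2)), (([EC],2,1,1),(0,-2))]),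
    (([ED],0,0,2), [(([ED],0,0,2),(-2,0))]),
    (([EB],1,1,2), [(([EB],1,1,2),(-2,-2)), (([EB],1,0,1),(0,-2))]),
    (([EA],0,1,0), [(([EB],1,2,0),(4,2)), (([EA],0,2,1),(0,-2))]),
    (([EC],2,1,1), [(([ED],0,1,0),(2,4)), (([EC],2,1,1),(-2,-2)), (([EA],0,2,1),(2,0)), (([EB],1,2,0),(2,2)), (([ED],0,2,1),(-2,0))]),
    (([ED],0,1,0), [(([ED],0,2,1),(-2,0))]),
    (([EA],1,1,0), [(([ED],1,1,0),(0,4)), (([EC],0,1,1),(2,2)), (([ED],1,2,1),(-2,0))]),
    (([EC],0,0,0), [(([ED],1,1,0),(-2,-2)), (([ED],1,2,1),(-2,0))]),
    (([EB],2,1,2), [(([EB],2,1,2),(-2,-2)), (([ED],1,0,2),(2,4))]),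
    (([EC],0,1,1), [(([ED],1,2,1),(-2,0))]),
    (([EC],0,2,2), [(([EC],0,2,2),(-2,-2)), (([ED],1,2,1),(-4,-4))]),
    (([EA],0,0,1), [(([EA],0,1,2),(-2,0)), (([ED],0,1,2),(0,4)), (([EC],2,0,2),(4,2))]),
    (([EC],2,2,1), [(([EC],2,1,0),(-2,0)), (([ED],0,2,0),(-2,0))]),
    (([EB],1,0,0), [(([EA],0,1,2),(0,-2)), (([ED],0,1,2),(-2,-4)), (([EC],2,0,2),(-2,0))]),
    (([EB],1,1,1), [(([EB],1,2,2),(-2,0)), (([ED],0,1,2),(-2,0))]),
    (([EC],2,0,2), [(([ED],0,1,2),(0,2))]),
    (([EC],2,1,0), [(([EC],2,1,0),(-2,-2))]),
    (([EA],0,2,0), [(([EA],0,2,0),(0,-2)), (([ED],0,2,0),(2,2))]),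
    (([EA],2,0,0), [(([ED],2,0,0),(2,6)), (([EC],1,0,1),(-2,0))]),
    (([EA],2,1,1), [(([EA],2,2,2),(-2,-2)), (([ED],2,0,0),(2,4)), (([ED],2,2,2),(-4,0)), (([EC],1,1,2),(-2,-4))]),
    (([EB],0,0,2), [(([EB],0,0,2),(-2,-2))]),
    (([EB],0,1,0), [(([ED],2,0,0),(-2,0)), (([EA],2,2,2),(-2,-2)), (([ED],2,2,2),(-4,-2)), (([EC],1,1,2),(0,-2))]),
    (([EC],1,0,1), [(([ED],2,0,0),(0,-2))]),
    (([EC],1,1,2), [(([ED],2,2,2),(0,-2))]),
    (([EC],1,2,0), [(([EC],1,2,0),(-2,-2))])]"

section \<open>Finite checks of the certificate\<close>

definition basis :: "(svec \<times> svec) list" where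
  "basis = flat_basis @ sd_basis @ asd_basis"

definition entry :: "(bkey \<times> svec) list \<Rightarrow> bkey \<Rightarrow> svec" where
  "entry T k = (case map_of T k of None \<Rightarrow> [] | Some v \<Rightarrow> v)"

definition scaled :: "eis \<Rightarrow> svec \<Rightarrow> svec" where
  "scaled c v = (if c = (0, 0) then [] else vscale c v)"

fun dot_term :: "bkey \<Rightarrow> eis \<Rightarrow> svec \<Rightarrow> eis" where
  "dot_term k c [] = (0, 0)"
| "dot_term k c ((l, d) # ys) = (if k = l then eadd (emul c d) (dot_term k c ys) else dot_term k c ys)"

fun dot :: "svec \<Rightarrow> svec \<Rightarrow> eis" where
  "dot [] ys = (0, 0)"
| "dot ((k, c) # xs) ys = eadd (dot_term k c ys) (dot xs ys)"

text \<open>Adding a 1-form and its curvature loses nothing, since each functional is supported in a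
  single degree: the four flat ones read the potential, the other 24 the curvature. All 28 can then
  be treated alike.\<close>

definition with_diff :: "svec \<Rightarrow> svec" where
  "with_diff xs = xs @ vbind xs diff_key"

definition maxwell_key :: "bkey \<Rightarrow> svec" where
  "maxwell_key k = vbind (collect (vbind (collect (vbind (diff_key k) star_key)) diff_key)) star_key"

definition degree_keys :: "nat \<Rightarrow> bkey list" where
  "degree_keys i = filter (\<lambda>k. length (fst k) = i) bkeys"

text \<open>The difference of the two sides of the overview's identity at one basis word, with 12
  times the word moved across as -12.\<close>

definition decomposition_defect :: "bkey \<Rightarrow> svec" where
  "decomposition_defect k = collect ((k, (-12, 0)) #
     concat (map (\<lambda>(w, c). scaled (dot c (with_diff [(k, (1, 0))])) w) basis) @
     vbind (entry exact_part k) diff_key @ vbind (maxwell_key k) (entry maxwell_part))"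

definition defect_free :: "gen list \<Rightarrow> bool" where
  "defect_free I = list_all (\<lambda>t. decomposition_defect (I, t) = []) tkeys"

lemma defect_free_EA: "defect_free [EA]"
  by code_simp

lemma defect_free_EB: "defect_free [EB]"
  by code_simp

lemma defect_free_EC: "defect_free [EC]"
  by code_simp

lemma defect_free_ED: "defect_free [ED]"
  by code_simp

lemma decomposition_defect_Nil:
  assumes "k \<in> set bkeys" "length (fst k) = 1"
  shows "decomposition_defect k = []"
proof -
  obtain I t where k: "k = (I, t)" "I \<in> set ekeys" "t \<in> set tkeys"
    using assms(1) by (auto simp: bkeys_def)
  then have "I \<in> {[EA], [EB], [EC], [ED]}" using assms(2) by (auto simp: ekeys_def)
  then have "defect_free I" using defect_free_EA defect_free_EB defect_free_EC defect_free_ED by blast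
  then show ?thesis using k by (simp add: defect_free_def list_all_iff)
qed

lemma biorthogonal_check:
  "map (\<lambda>(w, c). map (dot c) (map (\<lambda>(w, c). collect (with_diff w)) basis)) basis =
   map (\<lambda>i. map (\<lambda>j. if i = j then (12, 0) else (0, 0)) [0..<28]) [0..<28]"
  by code_simp

text \<open>For functionals in degree 2 this reflects d d = 0. The real content lies in the four
  flat functionals, which must detect closed forms modulo exact ones.\<close>

lemma exact_check:
  "list_all (\<lambda>k. let v = collect (with_diff (diff_key k)) in list_all (\<lambda>(w, c). dot c v = (0, 0)) basis) (degree_keys 0)"
  by code_simp

lemma duality_check:
  "list_all (\<lambda>(w, c). collect (vbind w diff_key) = []) flat_basis"
  "list_all (\<lambda>(w, c). collect (vbind (vbind w diff_key) star_key @ vscale (-1, 0) (vbind w diff_key)) = []) sd_basis"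
  "list_all (\<lambda>(w, c). collect (vbind (vbind w diff_key) star_key @ vbind w diff_key) = []) asd_basis"
  by code_simp+

text \<open>Each functional is an eigenvector of the transpose of the Hodge operator, with
  eigenvalue 1 or -1. It therefore vanishes on the opposite eigenspace, which keeps the two kinds of
  coefficient apart.\<close>

lemma covector_check:
  "list_all (\<lambda>k. let v = star_key k in list_all (\<lambda>(w, c). eadd (dot c v) (emul (-1, 0) (dot c [(k, (1, 0))])) = (0, 0)) sd_basis) (degree_keys 2)"
  "list_all (\<lambda>k. let v = star_key k in list_all (\<lambda>(w, c). eadd (dot c v) (dot c [(k, (1, 0))]) = (0, 0)) asd_basis) (degree_keys 2)"
  by code_simp+

lemma basis_keys:
  "list_all (\<lambda>(w, c). list_all (\<lambda>(k, d). length (fst k) = 1 \<and> fst k \<in> set ekeys \<and> snd k \<in> set tkeys) w) basis"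
  by code_simp

lemma exact_part_keys:
  "list_all (\<lambda>(k, v). list_all (\<lambda>(l, d). length (fst l) = 0 \<and> fst l \<in> set ekeys \<and> snd l \<in> set tkeys) v) exact_part"
  by code_simp

lemma covector_keys:
  "list_all (\<lambda>(w, c). list_all (\<lambda>(k, d). length (fst k) = 2) c) (sd_basis @ asd_basis)"
  by code_simp

lemma degree_keys_iff: "k \<in> set (degree_keys i) \<longleftrightarrow> k \<in> set bkeys \<and> length (fst k) = i"
  by (auto simp: degree_keys_def)

lemma lsum_scaled: "om.lsum f (scaled c v) = sc (val (proot TYPE('a)) c) * (om.lsum f v :: 'a::cubic_root omega)"
  by (simp add: scaled_def val_def)

lemma lsum_concat: "om.lsum f (concat xss) = (\<Sum>xs\<leftarrow>xss. om.lsum f xs)"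
  by (induction xss) auto

section \<open>Functionals on forms and the coefficients of a potential\<close>

definition covec :: "svec \<Rightarrow> 'a::cubic_root omega \<Rightarrow> complex" where
  "covec c x = (\<Sum>(k, d)\<leftarrow>c. val (proot TYPE('a)) d * Poly_Mapping.lookup (coords x) k)"

lemma covec_add: "covec c (x + y) = covec c x + covec c y"
  by (induction c) (auto simp: covec_def coords_add lookup_add algebra_simps)

lemma covec_scale: "covec c (sc z * x) = z * covec c x"
  by (induction c) (auto simp: covec_def coords_scale algebra_simps)

lemma covec_zero: "covec c (0 :: 'a::cubic_root omega) = 0"
  using covec_scale[of c 0 "0 :: 'a omega"] by simp

lemma covec_minus: "covec c (- x) = - covec c (x :: 'a::cubic_root omega)"
  using covec_add[of c x "- x"] by (simp add: covec_zero add_eq_0_iff)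

lemma covec_lsum:
  assumes "\<And>k d. (k, d) \<in> set xs \<Longrightarrow> k \<in> set bkeys"
  shows "covec c (nsum xs :: 'a::cubic_root omega) = val (proot TYPE('a)) (dot c xs)"
proof -
  let ?q = "proot TYPE('a)"
  have z: "val ?q (0, 0) = 0" by (simp add: val_def)
  have 1: "val ?q d * Poly_Mapping.lookup (coords (nsum xs :: 'a omega)) k = val ?q (dot_term k d xs)" for k d
    using assms
  proof (induction xs)
    case Nil
    have "coords (0 :: 'a omega) = 0" using coords_scale[of 0 "0 :: 'a omega"] by simp
    then show ?case by (simp add: z)
  next
    case (Cons y ys)
    obtain l e where y: "y = (l, e)" by (cases y)
    have "l \<in> set bkeys" using Cons.prems[of l e] by (simp add: y)
    moreover have "val ?q d * Poly_Mapping.lookup (coords (nsum ys :: 'a omega)) k = val ?q (dot_term k d ys)"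
    proof (rule Cons.IH)
      fix k d assume "(k, d) \<in> set ys"
      then show "k \<in> set bkeys" by (intro Cons.prems[of k d]) simp
    qed
    ultimately show ?case
      by (auto simp: y coords_add coords_scale coords_nword lookup_add lookup_single when_def om.val_eadd om.val_emul
          distrib_left simp del: emul.simps eadd.simps)
  qed
  show ?thesis
    unfolding covec_def by (induction c) (auto simp: z 1 om.val_eadd simp del: eadd.simps)
qed

lemma covec_degree:
  assumes "x \<in> forms i" "\<And>k d. (k, d) \<in> set c \<Longrightarrow> length (fst k) \<noteq> i"
  shows "covec c (x :: 'a::cubic_root omega) = 0"
  using assms(1) unfolding forms_def
proof (rule om.span_induct)
  show "om.subspace {x :: 'a omega. covec c x = 0}"
    by (rule om.subspaceI) (auto simp: covec_add covec_scale covec_zero)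
next
  fix x :: "'a omega" assume "x \<in> nword ` {k \<in> set bkeys. length (fst k) = i}"
  then obtain l where l: "x = nword l" "l \<in> set bkeys" "length (fst l) = i" by blast
  have "\<forall>(k, d)\<in>set c. length (fst k) \<noteq> i"
  proof
    fix p assume "p \<in> set c"
    then show "case p of (k, d) \<Rightarrow> length (fst k) \<noteq> i"
      using assms(2)[of "fst p" "snd p"] by (simp add: split_beta)
  qed
  then show "covec c x = 0"
    unfolding covec_def l(1) coords_nword[OF l(2)] l(3)[symmetric]
    by (induction c) (auto simp: lookup_single when_def)
qed

definition pairing :: "svec \<Rightarrow> 'a::cubic_root omega \<Rightarrow> complex" where
  "pairing c A = covec c (A + diff 1 A)"

lemma diff_add: "diff i (x + y) = diff i x + diff i (y :: 'a::cubic_root omega)"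
  and diff_scale: "diff i (sc z * x) = sc z * diff i (x :: 'a::cubic_root omega)"
  using diff_hom[of i, where 'a = 'a] unfolding module_hom_iff by auto

lemma star_add: "star (x + y) = star x + star (y :: 'a::cubic_root omega)"
  and star_scale: "star (sc z * x) = sc z * star (x :: 'a::cubic_root omega)"
  using star_hom[where 'a = 'a] unfolding module_hom_iff by auto

lemma lin_of_add: "lin_of F (x + y) = lin_of F x + lin_of F (y :: 'a::cubic_root omega)"
  and lin_of_scale: "lin_of F (sc z * x) = sc z * lin_of F (x :: 'a::cubic_root omega)"
  using lin_of_hom[of F, where 'a = 'a] unfolding module_hom_iff by auto

lemma diff_zero [simp]: "diff i 0 = (0 :: 'a::cubic_root omega)"
  and diff_minus: "diff i (- x) = - diff i (x :: 'a::cubic_root omega)"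
  using diff_scale[of i 0 0] diff_scale[of i "- 1" x] by (simp_all add: sc_simps)

lemma star_zero [simp]: "star 0 = (0 :: 'a::cubic_root omega)"
  and star_minus: "star (- x) = - star (x :: 'a::cubic_root omega)"
  using star_scale[of 0 0] star_scale[of "- 1" x] by (simp_all add: sc_simps)

lemma pairing_add: "pairing c (x + y) = pairing c x + pairing c y"
  and pairing_scale: "pairing c (sc z * x) = z * pairing c x"
  unfolding pairing_def
  by (simp_all add: diff_add diff_scale covec_add covec_scale distrib_left add_ac)

definition maxwell :: "'a::cubic_root omega \<Rightarrow> 'a omega" where
  "maxwell A = star (diff 2 (star (diff 1 A)))"

lemma valid_with_diff:
  assumes "valid 1 xs"
  shows "A = nsum xs \<Longrightarrow> A + diff 1 A = (nsum (with_diff xs) :: 'a::cubic_root omega)"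
    and "(k, d) \<in> set (with_diff xs) \<Longrightarrow> k \<in> set bkeys"
proof -
  show "A = nsum xs \<Longrightarrow> A + diff 1 A = (nsum (with_diff xs) :: 'a omega)"
    using diff_lsum[OF assms, where 'a = 'a] by (simp add: with_diff_def)
  have "valid 2 (vbind xs diff_key)"
    by (rule valid_vbind[OF assms]) (use valid_diff_key in \<open>fastforce simp: numeral_2_eq_2\<close>)
  then show "(k, d) \<in> set (with_diff xs) \<Longrightarrow> k \<in> set bkeys"
    using assms by (auto simp: with_diff_def dest: validD)
qed

lemma pairing_lsum:
  assumes "valid 1 xs"
  shows "pairing c (nsum xs :: 'a::cubic_root omega) = val (proot TYPE('a)) (dot c (with_diff xs))"
  unfolding pairing_def valid_with_diff(1)[OF assms refl]
  by (rule covec_lsum) (rule valid_with_diff(2)[OF assms])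

abbreviation basis_form :: "nat \<Rightarrow> 'a::cubic_root omega" where
  "basis_form j \<equiv> nsum (fst (basis ! j))"

abbreviation coefficient :: "nat \<Rightarrow> 'a::cubic_root omega \<Rightarrow> complex" where
  "coefficient j \<equiv> pairing (snd (basis ! j))"

lemma length_basis: "length flat_basis = 4" "length sd_basis = 12" "length asd_basis = 12" "length basis = 28"
  by (simp_all add: basis_def flat_basis_def sd_basis_def asd_basis_def)

lemma valid_basis: "j < 28 \<Longrightarrow> valid 1 (fst (basis ! j))"
proof -
  assume "j < 28"
  then have "basis ! j \<in> set basis" using length_basis by simp
  then show ?thesis
    using basis_keys unfolding list_all_iff valid_def bkeys_def by (fastforce split: prod.splits)
qed

lemma basis_form_forms: "j < 28 \<Longrightarrow> basis_form j \<in> forms 1"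
  by (rule lsum_forms[OF valid_basis])

lemma coefficient_basis_form:
  assumes "i < 28" "j < 28"
  shows "coefficient i (basis_form j :: 'a::cubic_root omega) = (if i = j then 12 else 0)"
proof -
  have v: "valid 1 (fst (basis ! j))" by (rule valid_basis[OF assms(2)])
  have vc: "k \<in> set bkeys" if "(k, d) \<in> set (collect (with_diff (fst (basis ! j))))" for k d
    using collect_keys[OF that] valid_with_diff(2)[OF v] by auto
  have "coefficient i (basis_form j :: 'a omega) = covec (snd (basis ! i)) (nsum (collect (with_diff (fst (basis ! j)))) :: 'a omega)"
    unfolding pairing_def valid_with_diff(1)[OF v refl] by simp
  also have "\<dots> = val (proot TYPE('a)) (dot (snd (basis ! i)) (collect (with_diff (fst (basis ! j)))))"
    by (rule covec_lsum) (rule vc)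
  also have "dot (snd (basis ! i)) (collect (with_diff (fst (basis ! j)))) = (if i = j then (12, 0) else (0, 0))"
    using arg_cong[OF biorthogonal_check, of "\<lambda>M. M ! i ! j"] assms length_basis
    by (simp add: split_beta)
  finally show ?thesis by (simp add: val_def)
qed

lemma coefficient_exact:
  assumes "j < 28" "x \<in> forms 0"
  shows "coefficient j (diff 0 x :: 'a::cubic_root omega) = 0"
  using assms(2) unfolding forms_def
proof (rule om.span_induct)
  have z: "coefficient j (0 :: 'a omega) = 0" by (simp add: pairing_def covec_zero)
  show "om.subspace {x :: 'a omega. coefficient j (diff 0 x) = 0}"
    by (rule om.subspaceI) (auto simp: diff_add diff_scale pairing_add pairing_scale z)
next
  fix x :: "'a omega" assume "x \<in> nword ` {k \<in> set bkeys. length (fst k) = 0}"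
  then obtain k where k: "x = nword k" "k \<in> set bkeys" "length (fst k) = 0" by blast
  let ?v = "with_diff (diff_key k)"
  have v: "valid 1 (diff_key k)" using valid_diff_key[OF k(2)] k(3) by simp
  have vc: "l \<in> set bkeys" if "(l, d) \<in> set (collect ?v)" for l d
    using collect_keys[OF that] valid_with_diff(2)[OF v] by auto
  have "diff 0 x = nsum (diff_key k)" unfolding k(1) by (rule diff_nword[OF k(2,3)])
  then have "diff 0 x + diff 1 (diff 0 x) = nsum ?v" by (rule valid_with_diff(1)[OF v])
  then have "coefficient j (diff 0 x) = covec (snd (basis ! j)) (nsum (collect ?v) :: 'a omega)"
    by (simp only: pairing_def om.lsum_collect)
  also have "\<dots> = val (proot TYPE('a)) (dot (snd (basis ! j)) (collect ?v))"
    by (rule covec_lsum) (rule vc)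
  also have "dot (snd (basis ! j)) (collect ?v) = (0, 0)"
  proof -
    have "k \<in> set (degree_keys 0)" "basis ! j \<in> set basis"
      using k assms(1) length_basis by (simp_all add: degree_keys_iff)
    then show ?thesis
      using exact_check unfolding list_all_iff Let_def by (fastforce split: prod.splits)
  qed
  finally show "coefficient j (diff 0 x) = 0" by (simp add: val_def)
qed

section \<open>The decomposition identity and the duality of the forms w_j\<close>

lemma valid_entry: "valid 0 (entry exact_part k)"
proof (cases "map_of exact_part k")
  case None
  then show ?thesis by (simp add: entry_def valid_def)
next
  case (Some v)
  then have "(k, v) \<in> set exact_part" by (rule map_of_SomeD)
  then have "\<forall>(l, d)\<in>set v. length (fst l) = 0 \<and> fst l \<in> set ekeys \<and> snd l \<in> set tkeys"
    using exact_part_keys unfolding list_all_iff by fastforce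
  then show ?thesis using Some by (fastforce simp: entry_def valid_def bkeys_def)
qed

text \<open>Both sides are linear in A, so it is enough to compare them on the 108 normal words of
  degree 1, where the difference is the evaluation of \<open>decomposition_defect\<close>.\<close>

lemma decomposition:
  assumes "A \<in> forms 1"
  shows "sc 12 * A = (\<Sum>j<28. sc (coefficient j A) * basis_form j) + diff 0 (lin_of (entry exact_part) A)
    + lin_of (entry maxwell_part) (maxwell (A :: 'a::cubic_root omega))"
proof (rule hom_eq_on_span[of "\<lambda>A. sc 12 * A" "\<lambda>A. (\<Sum>j<28. sc (coefficient j A) * basis_form j)
    + diff 0 (lin_of (entry exact_part) A) + lin_of (entry maxwell_part) (maxwell A)"
    "{k \<in> set bkeys. length (fst k) = 1}" A])
  show "A \<in> om.span (nword ` {k \<in> set bkeys. length (fst k) = 1})"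
    using assms by (simp add: forms_def)
  show "om_linear (\<lambda>A :: 'a omega. sc 12 * A)"
    by (rule om_homI) (simp_all add: distrib_left mult.commute)
  show "om_linear (\<lambda>A :: 'a omega. (\<Sum>j<28. sc (coefficient j A) * basis_form j)
    + diff 0 (lin_of (entry exact_part) A) + lin_of (entry maxwell_part) (maxwell A))"
    by (rule om_homI)
      (simp_all add: maxwell_def diff_add diff_scale star_add star_scale lin_of_add lin_of_scale pairing_add pairing_scale
        om.scale_left_distrib om.scale_right_distrib sum.distrib om.scale_sum_right add_ac)
next
  fix k assume "k \<in> {k \<in> set bkeys. length (fst k) = 1}"
  then have k: "k \<in> set bkeys" "length (fst k) = 1" by auto
  let ?q = "proot TYPE('a)" and ?A = "nword k :: 'a omega"
  have A: "?A = nsum [(k, (1, 0))]" by (simp add: val_def sc_simps)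
  have vk: "valid 1 [(k, (1, 0))]" using k by (simp add: valid_def)
  have v2: "valid 2 (diff_key k)" using valid_diff_key[OF k(1)] k(2) by (simp add: numeral_2_eq_2)
  have v2s: "valid 2 (vbind (diff_key k) star_key)"
    by (rule valid_vbind[OF v2]) (use valid_star_key in fastforce)
  have v3: "valid 3 (vbind (collect (vbind (diff_key k) star_key)) diff_key)"
    by (rule valid_vbind[OF valid_collect[OF v2s]]) (use valid_diff_key in \<open>fastforce simp: numeral_3_eq_3\<close>)
  have v1: "valid 1 (maxwell_key k)"
    unfolding maxwell_key_def by (rule valid_vbind[OF valid_collect[OF v3]]) (use valid_star_key in fastforce)
  have dA: "diff 1 ?A = nsum (diff_key k)" by (rule diff_nword[OF k])
  have "star (diff 1 ?A) = nsum (collect (vbind (diff_key k) star_key))"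
    unfolding dA star_lsum[OF v2] by simp
  then have "diff 2 (star (diff 1 ?A)) = nsum (collect (vbind (collect (vbind (diff_key k) star_key)) diff_key))"
    using diff_lsum[OF valid_collect[OF v2s], where 'a = 'a] by simp
  then have mA: "maxwell ?A = nsum (maxwell_key k)"
    unfolding maxwell_def maxwell_key_def using star_lsum[OF valid_collect[OF v3], where 'a = 'a] by simp
  have lm: "lin_of (entry maxwell_part) (maxwell ?A) = nsum (vbind (maxwell_key k) (entry maxwell_part))"
    unfolding mA by (rule lin_of_lsum[OF v1])
  have le: "diff 0 (lin_of (entry exact_part) ?A) = nsum (vbind (entry exact_part k) diff_key)"
    unfolding lin_of_nword[OF k(1)] by (rule diff_lsum[OF valid_entry])
  have "nsum (concat (map (\<lambda>(w, c). scaled (dot c (with_diff [(k, (1, 0))])) w) basis))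
      = (\<Sum>p\<leftarrow>basis. sc (pairing (snd p) ?A) * nsum (fst p) :: 'a omega)"
    unfolding A pairing_lsum[OF vk] lsum_concat
    by (simp add: split_beta lsum_scaled o_def)
  also have "\<dots> = (\<Sum>j<28. sc (coefficient j ?A) * basis_form j)"
    by (simp add: sum_list_sum_nth length_basis atLeast0LessThan)
  finally have lb: "nsum (concat (map (\<lambda>(w, c). scaled (dot c (with_diff [(k, (1, 0))])) w) basis))
      = (\<Sum>j<28. sc (coefficient j ?A) * basis_form j :: 'a omega)" .
  have "nsum (decomposition_defect k) = sc (- 12) * ?A + ((\<Sum>j<28. sc (coefficient j ?A) * basis_form j)
    + (diff 0 (lin_of (entry exact_part) ?A) + lin_of (entry maxwell_part) (maxwell ?A)))"
    unfolding decomposition_defect_def om.lsum_collect om.lsum_Cons om.lsum_append lb le lm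
    by (simp add: val_def)
  moreover have "decomposition_defect k = []" by (rule decomposition_defect_Nil[OF k])
  ultimately show "sc 12 * ?A = (\<Sum>j<28. sc (coefficient j ?A) * basis_form j)
    + diff 0 (lin_of (entry exact_part) ?A) + lin_of (entry maxwell_part) (maxwell ?A)"
    by (simp add: add.assoc)
qed

lemma lin_of_exact_forms: "A \<in> forms 1 \<Longrightarrow> lin_of (entry exact_part) A \<in> forms 0"
  by (rule hom_forms[OF lin_of_hom]) (use valid_entry in \<open>auto simp: lin_of_nword intro!: lsum_forms\<close>)

text \<open>The form with index 2 is theta itself, closed because theta squares to zero; it shows
  how a closed form can fail to be exact.\<close>

lemma basis_flat:
  assumes "j < 4"
  shows "diff 1 (basis_form j) = (0 :: 'a::cubic_root omega)"
proof -
  have "basis ! j \<in> set flat_basis" using assms by (auto simp: basis_def nth_append length_basis)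
  then have "collect (vbind (fst (basis ! j)) diff_key) = []"
    using duality_check(1) unfolding list_all_iff split_beta by blast
  moreover have "diff 1 (basis_form j) = (nsum (collect (vbind (fst (basis ! j)) diff_key)) :: 'a omega)"
    using diff_lsum[OF valid_basis, of j, where 'a = 'a] assms by simp
  ultimately show ?thesis by simp
qed

lemma star_diff_basis:
  assumes "j < 28"
  shows "star (diff 1 (basis_form j)) = (nsum (vbind (vbind (fst (basis ! j)) diff_key) star_key) :: 'a::cubic_root omega)"
    and "diff 1 (basis_form j) = (nsum (vbind (fst (basis ! j)) diff_key) :: 'a::cubic_root omega)"
proof -
  show d: "diff 1 (basis_form j) = (nsum (vbind (fst (basis ! j)) diff_key) :: 'a omega)"
    by (rule diff_lsum[OF valid_basis[OF assms]])
  have "valid 2 (vbind (fst (basis ! j)) diff_key)"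
    by (rule valid_vbind[OF valid_basis[OF assms]]) (use valid_diff_key in \<open>fastforce simp: numeral_2_eq_2\<close>)
  then show "star (diff 1 (basis_form j)) = (nsum (vbind (vbind (fst (basis ! j)) diff_key) star_key) :: 'a omega)"
    unfolding d by (rule star_lsum)
qed

lemma basis_sd:
  assumes "4 \<le> j" "j < 16"
  shows "star (diff 1 (basis_form j)) = diff 1 (basis_form j :: 'a::cubic_root omega)"
proof -
  have j: "j < 28" using assms by simp
  have "basis ! j \<in> set sd_basis" using assms by (auto simp: basis_def nth_append length_basis)
  then have z: "collect (vbind (vbind (fst (basis ! j)) diff_key) star_key @ vscale (-1, 0) (vbind (fst (basis ! j)) diff_key)) = []"
    using duality_check(2) unfolding list_all_iff split_beta by blast
  have "star (diff 1 (basis_form j)) - diff 1 (basis_form j) =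
      (nsum (collect (vbind (vbind (fst (basis ! j)) diff_key) star_key @ vscale (-1, 0) (vbind (fst (basis ! j)) diff_key))) :: 'a omega)"
    unfolding star_diff_basis(1)[OF j] unfolding star_diff_basis(2)[OF j] by (simp add: val_def)
  then show ?thesis unfolding z by simp
qed

lemma basis_asd:
  assumes "16 \<le> j" "j < 28"
  shows "star (diff 1 (basis_form j)) = - diff 1 (basis_form j :: 'a::cubic_root omega)"
proof -
  have "basis ! j \<in> set asd_basis" using assms by (auto simp: basis_def nth_append length_basis)
  then have z: "collect (vbind (vbind (fst (basis ! j)) diff_key) star_key @ vbind (fst (basis ! j)) diff_key) = []"
    using duality_check(3) unfolding list_all_iff split_beta by blast
  have "star (diff 1 (basis_form j)) + diff 1 (basis_form j) =
      (nsum (collect (vbind (vbind (fst (basis ! j)) diff_key) star_key @ vbind (fst (basis ! j)) diff_key)) :: 'a omega)"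
    unfolding star_diff_basis(1)[OF assms(2)] unfolding star_diff_basis(2)[OF assms(2)] by simp
  then show ?thesis unfolding z by (simp add: eq_neg_iff_add_eq_0)
qed

text \<open>From index 4 on the functionals are supported in degree 2 and cannot see the summand A
  of A + dA.\<close>

lemma coefficient_curvature:
  assumes "4 \<le> j" "j < 28" "A \<in> forms 1"
  shows "coefficient j A = covec (snd (basis ! j)) (diff 1 (A :: 'a::cubic_root omega))"
proof -
  have "basis ! j \<in> set (sd_basis @ asd_basis)"
    using assms by (auto simp: basis_def nth_append length_basis)
  then have "length (fst k) = 2" if "(k, d) \<in> set (snd (basis ! j))" for k d
    using covector_keys that unfolding list_all_iff by fastforce
  then have "covec (snd (basis ! j)) A = 0"
    by (intro covec_degree[OF assms(3)]) fastforce
  then show ?thesis by (simp add: pairing_def covec_add)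
qed

lemma covec_star:
  assumes "F \<in> forms 2"
  shows "4 \<le> j \<Longrightarrow> j < 16 \<Longrightarrow> covec (snd (basis ! j)) (star F) = covec (snd (basis ! j)) (F :: 'a::cubic_root omega)"
    and "16 \<le> j \<Longrightarrow> j < 28 \<Longrightarrow> covec (snd (basis ! j)) (star F) = - covec (snd (basis ! j)) (F :: 'a::cubic_root omega)"
proof -
  have ind: "covec c (star F) = z * covec c F"
    if "\<And>k. k \<in> set (degree_keys 2) \<Longrightarrow> val (proot TYPE('a)) (dot c (star_key k)) = z * val (proot TYPE('a)) (dot c [(k, (1, 0))])" for c z
    using assms unfolding forms_def
  proof (rule om.span_induct)
    show "om.subspace {F :: 'a omega. covec c (star F) = z * covec c F}"
      by (rule om.subspaceI) (auto simp: star_add star_scale covec_add covec_scale covec_zero distrib_left)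
  next
    fix x :: "'a omega" assume "x \<in> nword ` {k \<in> set bkeys. length (fst k) = 2}"
    then obtain k where k: "x = nword k" "k \<in> set bkeys" "length (fst k) = 2" by blast
    have "covec c (star x) = val (proot TYPE('a)) (dot c (star_key k))"
      unfolding k(1) star_nword[OF k(2)]
      by (rule covec_lsum) (use valid_star_key[OF k(2)] in \<open>auto dest: validD\<close>)
    moreover have "covec c x = val (proot TYPE('a)) (dot c [(k, (1, 0))])"
      using covec_lsum[of "[(k, (1, 0))]" c, where 'a = 'a] k by (simp add: val_def sc_simps)
    ultimately show "covec c (star x) = z * covec c x"
      using that[of k] k by (simp add: degree_keys_iff)
  qed
  note v = om.val_eadd om.val_emul
  have z0: "val (proot TYPE('a)) (0, 0) = 0" and m1: "val (proot TYPE('a)) (-1, 0) = -1" by (simp_all add: val_def)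
  show "4 \<le> j \<Longrightarrow> j < 16 \<Longrightarrow> covec (snd (basis ! j)) (star F) = covec (snd (basis ! j)) F"
  proof -
    assume "4 \<le> j" "j < 16"
    then have "basis ! j \<in> set sd_basis" by (auto simp: basis_def nth_append length_basis)
    then have "eadd (dot (snd (basis ! j)) (star_key k)) (emul (-1, 0) (dot (snd (basis ! j)) [(k, (1, 0))])) = (0, 0)"
      if "k \<in> set (degree_keys 2)" for k
      using covector_check(1) that unfolding list_all_iff Let_def by (fastforce split: prod.splits)
    from arg_cong[OF this, of _ "val (proot TYPE('a))"]
    show ?thesis using ind[of "snd (basis ! j)" 1] by (simp add: v z0 m1 del: dot.simps eadd.simps emul.simps)
  qed
  show "16 \<le> j \<Longrightarrow> j < 28 \<Longrightarrow> covec (snd (basis ! j)) (star F) = - covec (snd (basis ! j)) F"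
  proof -
    assume "16 \<le> j" "j < 28"
    then have "basis ! j \<in> set asd_basis" by (auto simp: basis_def nth_append length_basis)
    then have "eadd (dot (snd (basis ! j)) (star_key k)) (dot (snd (basis ! j)) [(k, (1, 0))]) = (0, 0)"
      if "k \<in> set (degree_keys 2)" for k
      using covector_check(2) that unfolding list_all_iff Let_def by (fastforce split: prod.splits)
    from arg_cong[OF this, of _ "val (proot TYPE('a))"]
    show ?thesis using ind[of "snd (basis ! j)" "-1"]
      by (simp add: v z0 m1 eq_neg_iff_add_eq_0 del: dot.simps eadd.simps emul.simps)
  qed
qed

section \<open>Images of vector spaces and dimension\<close>

text \<open>A space given as a record is described as the image of a subspace of a type under a
  linear map, which need not be injective. The presented algebra, the kernel of Max, its quotient by
  exact forms and the subspaces of that quotient are all of this kind, so their dimensions are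
  computed in one place.\<close>

locale vs_image = vector_space scale
  for scale :: "complex \<Rightarrow> 'v::ab_group_add \<Rightarrow> 'v" +
  fixes U :: "(complex, 'w, 'm) module_scheme" and \<kappa> :: "'v \<Rightarrow> 'w" and S :: "'v set"
  assumes S: "subspace S"
    and carrier_eq: "carrier U = \<kappa> ` S"
    and add_eq: "x \<in> S \<Longrightarrow> y \<in> S \<Longrightarrow> \<kappa> x \<oplus>\<^bsub>U\<^esub> \<kappa> y = \<kappa> (x + y)"
    and zero_eq: "\<zero>\<^bsub>U\<^esub> = \<kappa> 0"
    and smult_eq: "x \<in> S \<Longrightarrow> z \<odot>\<^bsub>U\<^esub> \<kappa> x = \<kappa> (scale z x)"
begin

lemmas S_closed = subspace_0[OF S] subspace_add[OF S] subspace_scale[OF S] subspace_neg[OF S]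

lemma vectorspace: "vectorspace class_ring U"
proof (rule vs_criteria)
  show "\<forall>v\<in>carrier U. \<exists>w\<in>carrier U. v \<oplus>\<^bsub>U\<^esub> w = \<zero>\<^bsub>U\<^esub>"
  proof
    fix v assume "v \<in> carrier U"
    then obtain x where x: "x \<in> S" "v = \<kappa> x" by (auto simp: carrier_eq)
    then show "\<exists>w\<in>carrier U. v \<oplus>\<^bsub>U\<^esub> w = \<zero>\<^bsub>U\<^esub>"
      by (intro bexI[of _ "\<kappa> (- x)"]) (simp_all add: carrier_eq add_eq zero_eq S_closed)
  qed
qed (auto simp: carrier_eq add_eq zero_eq smult_eq S_closed class_field scale_left_distrib
    scale_right_distrib ac_simps)

lemma image_subspace:
  assumes "subspace T" "T \<subseteq> S"
  shows "VectorSpace.subspace class_ring (\<kappa> ` T) U"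
proof (rule subspace.intro[OF vectorspace])
  have "add U (\<kappa> x) (\<kappa> y) = \<kappa> (x + y)" "smult U z (\<kappa> x) = \<kappa> (scale z x)" if "x \<in> T" "y \<in> T" for x y z
    using that subsetD[OF assms(2)] by (simp_all add: add_eq smult_eq)
  then show "submodule class_ring (\<kappa> ` T) U"
    using assms subspace_add[OF assms(1)] subspace_scale[OF assms(1)] subspace_0[OF assms(1)] vectorspace
    by (auto simp: submodule_def vectorspace_def carrier_eq zero_eq)
qed

lemma restrict:
  assumes "subspace T" "T \<subseteq> S"
  shows "vs_image scale (U\<lparr>carrier := \<kappa> ` T\<rparr>) \<kappa> T"
  by unfold_locales (use assms add_eq smult_eq zero_eq in \<open>auto simp: subset_iff\<close>)

lemma lincomb_image:
  assumes "finite J" "\<And>j. j \<in> J \<Longrightarrow> b j \<in> S" "inj_on (\<lambda>j. \<kappa> (b j)) J"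
  shows "module.lincomb U a ((\<lambda>j. \<kappa> (b j)) ` J) = \<kappa> (\<Sum>j\<in>J. scale (a (\<kappa> (b j))) (b j))"
  using assms
proof (induction J)
  interpret V: vectorspace class_ring U by (rule vectorspace)
  case empty
  then show ?case by (simp add: V.lincomb_def zero_eq)
next
  interpret V: vectorspace class_ring U by (rule vectorspace)
  case (insert j J)
  have T: "(\<Sum>j\<in>J. scale (a (\<kappa> (b j))) (b j)) \<in> S"
    using insert.prems(1) by (intro subspace_sum[OF S] subspace_scale[OF S]) auto
  have "V.lincomb a (insert (\<kappa> (b j)) ((\<lambda>j. \<kappa> (b j)) ` J)) =
      (a (\<kappa> (b j)) \<odot>\<^bsub>U\<^esub> \<kappa> (b j)) \<oplus>\<^bsub>U\<^esub> V.lincomb a ((\<lambda>j. \<kappa> (b j)) ` J)"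
    unfolding V.lincomb_def
    by (rule V.finsum_insert) (use insert in \<open>auto simp: carrier_eq smult_eq S_closed\<close>)
  then show ?case
    using insert T by (simp add: add_eq smult_eq S_closed)
qed

text \<open>Functionals dual to the b_j whose common zeros in S are exactly what the map sends to
  zero: duality makes the images of the b_j independent, and the expansion with coefficients p_j x
  agrees with x under all functionals, hence in the image.\<close>

lemma dual_basis_dim:
  assumes "finite J" and b: "\<And>j. j \<in> J \<Longrightarrow> b j \<in> S"
    and p_hom: "\<And>j x y. p j (x + y) = p j x + p j y" "\<And>j z x. p j (scale z x) = z * p j x"
    and dual: "\<And>i j. i \<in> J \<Longrightarrow> j \<in> J \<Longrightarrow> p i (b j) = (if i = j then 1 else (0 :: complex))"
    and sep: "\<And>x. x \<in> S \<Longrightarrow> \<kappa> x = \<kappa> 0 \<longleftrightarrow> (\<forall>j\<in>J. p j x = 0)"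
  shows "has_dim U (card J)"
proof -
  interpret V: vectorspace class_ring U by (rule vectorspace)
  have p0: "p j 0 = 0" for j using p_hom(2)[of j 0 0] by simp
  have p_sum: "p j (\<Sum>i\<in>J. scale (c i) (b i)) = (\<Sum>i\<in>J. c i * p j (b i))" for j c
    using assms(1) by (induction J) (auto simp: p_hom p0)
  have p_comb: "p j (\<Sum>i\<in>J. scale (c i) (b i)) = c j" if "j \<in> J" for j c
  proof -
    have "p j (\<Sum>i\<in>J. scale (c i) (b i)) = (\<Sum>i\<in>J. if i = j then c i else 0)"
      unfolding p_sum using dual[OF that] by (intro sum.cong) auto
    then show ?thesis using assms(1) that by (simp add: sum.delta)
  qed
  have kappa_eq: "\<kappa> x = \<kappa> y \<longleftrightarrow> (\<forall>j\<in>J. p j x = p j y)" if "x \<in> S" "y \<in> S" for x y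
  proof -
    have pm: "p j (x - y) = p j x - p j y" for j
      using p_hom(1)[of j "x - y" y] by simp
    have "\<kappa> x = \<kappa> y \<longleftrightarrow> \<kappa> (x - y) = \<kappa> 0"
    proof
      assume "\<kappa> x = \<kappa> y"
      then have "\<kappa> x \<oplus>\<^bsub>U\<^esub> \<kappa> (- y) = \<kappa> y \<oplus>\<^bsub>U\<^esub> \<kappa> (- y)" by simp
      then show "\<kappa> (x - y) = \<kappa> 0" using that by (simp add: add_eq S_closed)
    next
      assume "\<kappa> (x - y) = \<kappa> 0"
      then have "\<kappa> (x - y) \<oplus>\<^bsub>U\<^esub> \<kappa> y = \<kappa> 0 \<oplus>\<^bsub>U\<^esub> \<kappa> y" by simp
      then show "\<kappa> x = \<kappa> y" using that by (simp add: add_eq S_closed subspace_diff[OF S])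
    qed
    then show ?thesis using sep[of "x - y"] that subspace_diff[OF S] by (simp add: pm)
  qed
  let ?B = "(\<lambda>j. \<kappa> (b j)) ` J"
  have inj: "inj_on (\<lambda>j. \<kappa> (b j)) J"
  proof (rule inj_onI)
    fix i j assume ij: "i \<in> J" "j \<in> J" "\<kappa> (b i) = \<kappa> (b j)"
    then have "p i (b i) = p i (b j)" using kappa_eq b by blast
    then show "i = j" using ij dual[OF ij(1) ij(1)] dual[OF ij(1,2)] by (auto split: if_splits)
  qed
  have comb_S: "(\<Sum>j\<in>J. scale (c j) (b j)) \<in> S" for c
    using b by (intro subspace_sum[OF S] subspace_scale[OF S]) auto
  have lc: "V.lincomb a ?B = \<kappa> (\<Sum>j\<in>J. scale (a (\<kappa> (b j))) (b j))" for a
    by (rule lincomb_image[OF assms(1) b inj])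
  have B: "finite ?B" "?B \<subseteq> carrier U" using assms(1) b by (auto simp: carrier_eq)
  have indpt: "V.lin_indpt ?B"
  proof (rule V.finite_lin_indpt2[OF B])
    fix a :: "'w \<Rightarrow> complex"
    assume "V.lincomb a ?B = \<zero>\<^bsub>U\<^esub>"
    then have "\<forall>j\<in>J. p j (\<Sum>j\<in>J. scale (a (\<kappa> (b j))) (b j)) = 0"
      using sep[OF comb_S, of "\<lambda>j. a (\<kappa> (b j))"] unfolding lc zero_eq by simp
    then show "\<forall>v\<in>?B. a v = \<zero>\<^bsub>class_ring\<^esub>"
      using p_comb[of _ "\<lambda>j. a (\<kappa> (b j))"] by auto
  qed
  have "V.gen_set ?B"
  proof
    show "V.span ?B \<subseteq> carrier U" by (rule V.span_is_subset2[OF B(2)])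
    show "carrier U \<subseteq> V.span ?B"
    proof
      fix X assume "X \<in> carrier U"
      then obtain x where x: "x \<in> S" "X = \<kappa> x" by (auto simp: carrier_eq)
      \<comment> \<open>Coefficients in \<open>lincomb\<close> are indexed by vectors and not by J;
        injectivity recovers the index.\<close>
      define a where "a v = p (the_inv_into J (\<lambda>j. \<kappa> (b j)) v) x" for v
      have a: "a (\<kappa> (b j)) = p j x" if "j \<in> J" for j
        using the_inv_into_f_f[OF inj that] by (simp add: a_def)
      have "V.lincomb a ?B = \<kappa> (\<Sum>j\<in>J. scale (p j x) (b j))"
        unfolding lc using a by (metis (no_types, lifting) sum.cong)
      also have "\<dots> = X"
        using kappa_eq[OF comb_S x(1)] p_comb x(2) by metis
      finally show "X \<in> V.span ?B"
        unfolding V.span_def using B(1) by force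
    qed
  qed
  then have "V.basis ?B" using indpt B unfolding V.basis_def by blast
  moreover have "card ?B = card J" by (rule card_image[OF inj])
  ultimately show ?thesis
    unfolding has_dim_def using V.dim_basis[of ?B] B \<open>V.gen_set ?B\<close> vectorspace
    by (auto simp: V.fin_dim_def)
qed

end

section \<open>The algebra of forms\<close>

text \<open>The bridge to the statement: an injective map of the quotient type onto the carrier of
  \<open>Omega\<close>, under which all notions of the statement correspond to those computed with
  above.\<close>

definition to_coset :: "'a::cubic_root omega \<Rightarrow> free_alg set" where
  "to_coset w = cls (proot TYPE('a)) (rep_omega w)"

lemma to_coset_form: "to_coset (form x :: 'a::cubic_root omega) = cls (proot TYPE('a)) x"
proof -
  have "form (rep_omega (form x :: 'a omega)) = (form x :: 'a omega)"
    by (rule Quotient_abs_rep[OF Quotient_omega])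
  then show ?thesis by (simp add: to_coset_def cls_eq_iff form_eq_iff)
qed

lemma to_coset_eq_iff: "to_coset v = to_coset w \<longleftrightarrow> v = (w :: 'a::cubic_root omega)"
proof (induction v rule: omega.abs_induct)
  fix x show "to_coset (form x :: 'a omega) = to_coset w \<longleftrightarrow> form x = w"
    by (induction w rule: omega.abs_induct) (simp add: to_coset_form cls_eq_iff form_eq_iff)
qed

lemma range_to_coset: "range (to_coset :: 'a::cubic_root omega \<Rightarrow> _) = range (cls (proot TYPE('a)))"
proof
  show "range (to_coset :: 'a omega \<Rightarrow> _) \<subseteq> range (cls (proot TYPE('a)))" by (auto simp: to_coset_def)
  show "range (cls (proot TYPE('a))) \<subseteq> range (to_coset :: 'a omega \<Rightarrow> _)"
    by (auto simp: to_coset_form[symmetric])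
qed

text \<open>Operations on cosets become operations of the type; scalars act by multiplication with
  the class of a constant, which is central.\<close>

lemma Omega_simps:
  fixes x y :: "'a::cubic_root omega" and z :: complex
  defines "q \<equiv> proot TYPE('a)"
  shows "carrier (Omega q) = range (to_coset :: 'a omega \<Rightarrow> _)"
    and "to_coset x \<otimes>\<^bsub>Omega q\<^esub> to_coset y = to_coset (x * y)"
    and "to_coset x \<oplus>\<^bsub>Omega q\<^esub> to_coset y = to_coset (x + y)"
    and "\<zero>\<^bsub>Omega q\<^esub> = to_coset (0 :: 'a omega)"
    and "z \<odot>\<^bsub>Omega q\<^esub> to_coset x = to_coset (sc z * x)"
proof -
  let ?R = "class_ring :: free_alg ring"
  note I = rel_ideal_ideal[of q]
  show "carrier (Omega q) = range (to_coset :: 'a omega \<Rightarrow> _)"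
    unfolding range_to_coset q_def[symmetric]
    by (auto simp: Omega_def Let_def FactRing_def A_RCOSETS_def' cls_def)
  have m: "cls q u \<otimes>\<^bsub>?R Quot rel_ideal q\<^esub> cls q v = cls q (u * v)" for u v
    using ideal.rcoset_mult_add[OF I, of u v] by (simp add: FactRing_def cls_def)
  show mult: "to_coset x \<otimes>\<^bsub>Omega q\<^esub> to_coset y = to_coset (x * y)" for x y :: "'a omega"
  proof (induction x rule: omega.abs_induct)
    fix u show "to_coset (form u :: 'a omega) \<otimes>\<^bsub>Omega q\<^esub> to_coset y = to_coset (form u * y)"
      by (induction y rule: omega.abs_induct)
        (simp add: to_coset_form form_simps(4)[symmetric] Omega_def Let_def m q_def[symmetric])
  qed
  show "to_coset x \<oplus>\<^bsub>Omega q\<^esub> to_coset y = to_coset (x + y)"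
  proof (induction x rule: omega.abs_induct)
    have a: "cls q u \<oplus>\<^bsub>?R Quot rel_ideal q\<^esub> cls q v = cls q (u + v)" for u v
      using abelian_subgroup.a_rcos_sum[OF abelian_subgroupI3[OF ideal.axioms(1)[OF I] ring.is_abelian_group[OF class_ring.ring_axioms]], of u v]
      by (simp add: FactRing_def cls_def)
    fix u show "to_coset (form u :: 'a omega) \<oplus>\<^bsub>Omega q\<^esub> to_coset y = to_coset (form u + y)"
      by (induction y rule: omega.abs_induct)
        (simp add: to_coset_form form_simps(1)[symmetric] Omega_def Let_def a q_def[symmetric])
  qed
  show "\<zero>\<^bsub>Omega q\<^esub> = to_coset (0 :: 'a omega)"
  proof -
    have "cls q 0 = rel_ideal q"
      unfolding cls_def by (auto simp: a_r_coset_def r_coset_def)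
    then show ?thesis
      unfolding form_simps(5)[symmetric] to_coset_form by (simp add: Omega_def Let_def FactRing_def q_def)
  qed
  show "z \<odot>\<^bsub>Omega q\<^esub> to_coset x = to_coset (sc z * x)"
  proof -
    have "z \<odot>\<^bsub>Omega q\<^esub> to_coset x = to_coset (sc z :: 'a omega) \<otimes>\<^bsub>Omega q\<^esub> to_coset x"
      unfolding sc_def to_coset_form by (simp add: Omega_def Let_def q_def)
    then show ?thesis by (simp add: mult)
  qed
qed

lemma omega_image: "vs_image (\<lambda>z x :: 'a::cubic_root omega. sc z * x) (Omega (proot TYPE('a))) to_coset UNIV"
  by unfold_locales (simp_all add: Omega_simps om.scale_left_distrib om.scale_right_distrib)

lemma Omega_minus:
  fixes x y :: "'a::cubic_root omega"
  shows "\<ominus>\<^bsub>Omega (proot TYPE('a))\<^esub> to_coset x = to_coset (- x)"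
    and "to_coset x \<ominus>\<^bsub>Omega (proot TYPE('a))\<^esub> to_coset y = to_coset (x - y)"
proof -
  interpret V: vectorspace class_ring "Omega (proot TYPE('a))"
    by (rule vs_image.vectorspace[OF omega_image])
  show m: "\<ominus>\<^bsub>Omega (proot TYPE('a))\<^esub> to_coset x = to_coset (- x)" for x :: "'a omega"
    by (rule V.minus_equality) (simp_all add: Omega_simps)
  show "to_coset x \<ominus>\<^bsub>Omega (proot TYPE('a))\<^esub> to_coset y = to_coset (x - y)"
    by (simp add: a_minus_def m Omega_simps)
qed

lemma dext_to_coset: "dext (proot TYPE('a)) i (to_coset w) = to_coset (diff i (w :: 'a::cubic_root omega))"
proof -
  have "theta (proot TYPE('a)) = to_coset (theta_form :: 'a omega)"
    by (simp add: theta_def theta_form_def gel_def to_coset_form[symmetric] form_simps)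
  then show ?thesis
    by (simp add: dext_def diff_def Omega_simps Omega_minus)
qed

lemma form_expand:
  "form p = (\<Sum>u\<in>Poly_Mapping.keys p. sc (Poly_Mapping.lookup p u) *
    (case u of Word us \<Rightarrow> prod_list (map gel us)) :: 'a::cubic_root omega)"
proof -
  have s: "form (sum g A) = (\<Sum>a\<in>A. form (g a) :: 'a omega)" if "finite A" for g :: "word \<Rightarrow> free_alg" and A
    using that by (induction A) (auto simp: form_simps)
  have w: "form (prod_list (map var us)) = (prod_list (map gel us) :: 'a omega)" for us
    by (induction us) (auto simp: form_simps gel_def)
  have "p = (\<Sum>u\<in>Poly_Mapping.keys p. Poly_Mapping.single u (Poly_Mapping.lookup p u))"
    by (rule poly_mapping_eqI) (simp add: lookup_sum lookup_single when_def in_keys_iff sum.delta)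
  then have "form p = (\<Sum>u\<in>Poly_Mapping.keys p. form (Poly_Mapping.single u (Poly_Mapping.lookup p u)) :: 'a omega)"
    using s[OF finite_keys] by metis
  also have "\<dots> = (\<Sum>u\<in>Poly_Mapping.keys p. sc (Poly_Mapping.lookup p u) * (case u of Word us \<Rightarrow> prod_list (map gel us)))"
    by (rule sum.cong) (auto split: word.splits simp: single_word form_simps sc_def w)
  finally show ?thesis .
qed

definition form_words :: "nat \<Rightarrow> word set" where
  "form_words i = {Word (us @ vs) | us vs. us \<in> lists {EA, EB, EC, ED} \<and> length us = i \<and>
     vs \<in> lists {GA, GB, GC, GD}}"

lemma form_words_forms:
  assumes "Word ws \<in> form_words i"
  shows "prod_list (map gel ws) \<in> (forms i :: 'a::cubic_root omega set)"
proof -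
  obtain us vs where ws: "ws = us @ vs" "set us \<subseteq> {EA, EB, EC, ED}" "length us = i" "set vs \<subseteq> {GA, GB, GC, GD}"
    using assms by (auto simp: form_words_def in_lists_conv_set)
  let ?u = "[(unit_key, (1, 0))] :: svec"
  have u: "valid 0 ?u" by (simp add: valid_def unit_key_def bkeys_def ekeys_def tkeys_def)
  have "filter (\<lambda>g. rank_gen g < 4) us = us" "filter (\<lambda>g. rank_gen g < 4) vs = []"
    using ws(2,4) by (auto simp: filter_id_conv filter_empty_conv)
  then have "valid i (wmul ws ?u)"
    using valid_wmul[OF u, of ws] ws by simp
  moreover have "nsum ?u = (1 :: 'a omega)"
    by (simp add: unit_key_def nword_def fword_def val_def sc_simps)
  ultimately show ?thesis
    using wmul_sound[OF u, of ws, where 'a = 'a] lsum_forms[of i "wmul ws ?u", where 'a = 'a] by simp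
qed

text \<open>\<open>Forms\<close> admits arbitrary words of i letters e_j followed by functions.
  Rewriting such a word preserves the number of e-letters, and conversely every normal word has this
  shape.\<close>

lemma Forms_eq: "Forms (proot TYPE('a)) i = to_coset ` (forms i :: 'a::cubic_root omega set)"
proof -
  let ?P = "{p. Poly_Mapping.keys p \<subseteq> form_words i}"
  let ?T = "form ` ?P :: 'a omega set"
  have "Forms (proot TYPE('a)) i = to_coset ` ?T"
    by (simp add: Forms_def form_words_def image_image to_coset_form)
  moreover have "?T = forms i"
  proof
    show "?T \<subseteq> forms i"
    proof
      fix x assume "x \<in> ?T"
      then obtain p where p: "x = form p" "Poly_Mapping.keys p \<subseteq> form_words i" by blast
      show "x \<in> forms i"
        unfolding p(1) form_expand
        by (intro om.subspace_sum[OF forms_subspace] om.subspace_scale[OF forms_subspace])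
          (use p(2) form_words_forms in \<open>auto split: word.splits\<close>)
    qed
    have sub: "om.subspace ?T"
    proof (rule om.subspaceI)
      show "0 \<in> ?T" by (rule image_eqI[of _ _ 0]) (simp_all add: form_simps)
    next
      fix x y assume "x \<in> ?T" "y \<in> ?T"
      then obtain p r where "x = form p" "y = form r" "p \<in> ?P" "r \<in> ?P" by blast
      then show "x + y \<in> ?T"
        using keys_add[of p r] by (intro image_eqI[of _ _ "p + r"]) (auto simp: form_simps)
    next
      fix z x assume "x \<in> ?T"
      then obtain p where "x = form p" "p \<in> ?P" by blast
      moreover have "Poly_Mapping.keys (scal z * p) \<subseteq> Poly_Mapping.keys p"
        using keys_mult[of "scal z" p] by (auto simp: scal_def split: if_splits)
      ultimately show "sc z * x \<in> ?T"
        by (intro image_eqI[of _ _ "scal z * p"]) (auto simp: form_simps sc_def)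
    qed
    show "forms i \<subseteq> ?T"
      unfolding forms_def
    proof (rule om.span_minimal[OF _ sub], safe)
      fix I m n k assume k: "(I, m, n, k) \<in> set bkeys" "i = length (fst (I, m, n, k))"
      let ?p = "Poly_Mapping.single (Word (kword (I, m, n, k))) (1 :: complex)"
      have I: "set I \<subseteq> {EA, EB, EC, ED}" using k(1) by (auto simp: bkeys_def ekeys_def)
      have "form ?p = (nword (I, m, n, k) :: 'a omega)"
        by (simp add: form_expand kword_prod sc_simps)
      moreover have "Word (kword (I, m, n, k)) \<in> form_words (length I)"
        unfolding form_words_def mem_Collect_eq
        by (rule exI[of _ I], rule exI[of _ "replicate m GA @ replicate n GB @ replicate k GC"])
          (use I in \<open>auto simp: kword_def in_lists_conv_set\<close>)
      ultimately show "(nword (I, m, n, k) :: 'a omega) \<in> form ` {p. Poly_Mapping.keys p \<subseteq> form_words (length (fst (I, m, n, k)))}"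
        by (intro image_eqI[of _ _ ?p]) auto
    qed
  qed
  ultimately show ?thesis by simp
qed

lemma Fun_alg_eq: "Fun_alg (proot TYPE('a)) = to_coset ` (forms 0 :: 'a::cubic_root omega set)"
proof -
  have "Word ` lists {GA, GB, GC, GD} = form_words 0"
    by (auto simp: form_words_def)
  then have "Fun_alg (proot TYPE('a)) = Forms (proot TYPE('a)) 0"
    by (simp add: Fun_alg_def Forms_def form_words_def)
  then show ?thesis by (simp add: Forms_eq)
qed

lemma fun_gen_forms_0:
  assumes "set vs \<subseteq> {GA, GB, GC, GD}" "f \<in> (forms 0 :: 'a::cubic_root omega set)"
  shows "prod_list (map gel vs) * f \<in> forms 0"
  using assms(2)
proof (rule hom_forms[rotated 2])
  show "om_linear (\<lambda>x. prod_list (map gel vs) * x :: 'a omega)"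
    by (rule om_homI) (simp_all add: distrib_left, metis sc_commute mult.assoc)
next
  fix k assume k: "k \<in> set bkeys" "length (fst k) = 0"
  then have v: "valid 0 [(k, (1, 0))]" by (simp add: valid_def)
  have f: "filter (\<lambda>g. rank_gen g < 4) vs = []" using assms(1) by (auto simp: filter_empty_conv)
  show "prod_list (map gel vs) * nword k \<in> (forms 0 :: 'a omega set)"
    using wmul_sound[OF v, of vs, where 'a = 'a] valid_wmul[OF v, of vs] lsum_forms[of 0, where 'a = 'a]
    by (simp add: f val_def sc_simps)
qed

lemma fword_mult_forms_0: "t \<in> set tkeys \<Longrightarrow> f \<in> forms 0 \<Longrightarrow> fword t * f \<in> (forms 0 :: 'a::cubic_root omega set)"
proof -
  assume "f \<in> (forms 0 :: 'a omega set)"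
  moreover have "set (kword ([], t)) \<subseteq> {GA, GB, GC, GD}" by (cases t) (auto simp: kword_def)
  ultimately have "prod_list (map gel (kword ([], t))) * f \<in> forms 0" by (intro fun_gen_forms_0)
  then show ?thesis unfolding kword_prod by (simp add: nword_def)
qed

lemma fword_forms_0: "t \<in> set tkeys \<Longrightarrow> fword t \<in> (forms 0 :: 'a::cubic_root omega set)"
proof -
  assume "t \<in> set tkeys"
  then have "nword ([], t) \<in> (forms 0 :: 'a omega set)"
    unfolding forms_def by (intro om.span_base imageI) (auto simp: bkeys_def ekeys_def)
  then show ?thesis by (simp add: nword_def)
qed

section \<open>The Hodge operator of the presented algebra\<close>

text \<open>The table fixes \<open>star\<close> on normal words by acting on e_I and leaving the
  exponents alone. Linearity in the function factor extends this to every g, from which right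
  linearity over functions follows.\<close>

lemma star_eword_mult:
  assumes "I \<in> set ekeys" "g \<in> (forms 0 :: 'a::cubic_root omega set)"
  shows "star (eword I * g) = om.lsum eword (star_word I) * g"
proof (rule hom_eq_on_span[of "\<lambda>g. star (eword I * g)" "\<lambda>g. om.lsum eword (star_word I) * g" "{k \<in> set bkeys. length (fst k) = 0}"])
  have c: "x * (sc z * y) = sc z * (x * y)" for x y :: "'a omega" and z
    by (metis sc_commute mult.assoc)
  show "om_linear (\<lambda>g :: 'a omega. star (eword I * g))"
    by (rule om_homI) (simp_all add: distrib_left star_add c star_scale)
  show "om_linear (\<lambda>g :: 'a omega. om.lsum eword (star_word I) * g)"
    by (rule om_homI) (simp_all add: distrib_left c)
  show "g \<in> om.span (nword ` {k \<in> set bkeys. length (fst k) = 0})"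
    using assms(2) by (simp add: forms_def)
next
  fix k assume "k \<in> {k \<in> set bkeys. length (fst k) = 0}"
  then obtain t where k: "k = ([], t)" "t \<in> set tkeys" by (auto elim: bkeysE)
  have It: "(I, t) \<in> set bkeys" using assms(1) k(2) by (simp add: bkeys_def)
  have "eword I * nword k = (nword (I, t) :: 'a omega)" by (simp add: k nword_def)
  then show "star (eword I * nword k) = (om.lsum eword (star_word I) * nword k :: 'a omega)"
    using star_nword[OF It, where 'a = 'a] by (simp add: star_key_def k nword_def lsum_rmult)
qed

lemma star_right_linear:
  assumes "f \<in> (forms 0 :: 'a::cubic_root omega set)"
  shows "star (w * f) = star w * f"
proof (rule hom_eq_on_span[of "\<lambda>w. star (w * f)" "\<lambda>w. star w * f" "set bkeys"])
  show "om_linear (\<lambda>w :: 'a omega. star (w * f))"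
    by (rule om_homI) (simp_all add: distrib_right star_add mult.assoc star_scale)
  show "om_linear (\<lambda>w :: 'a omega. star w * f)"
    by (rule om_homI) (simp_all add: distrib_right star_add mult.assoc star_scale)
next
  fix k assume "k \<in> set bkeys"
  then obtain I t where k: "k = (I, t)" "I \<in> set ekeys" "t \<in> set tkeys" by (rule bkeysE)
  have "star (nword k * f) = om.lsum eword (star_word I) * (fword t * f)"
    using star_eword_mult[OF k(2) fword_mult_forms_0[OF k(3) assms]] by (simp add: k nword_def mult.assoc)
  also have "\<dots> = star (nword k) * f"
    using star_eword_mult[OF k(2) fword_forms_0[OF k(3)], where 'a = 'a] by (simp add: k nword_def mult.assoc)
  finally show "star (nword k * f) = star (nword k) * f" .
qed (simp add: span_nword)

text \<open>In \<open>hodge_values\<close> the argument is a polynomial, from which the word cannot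
  be read off; indexing by words allows comparison with \<open>star_word\<close>.\<close>

definition hodge_images :: "complex \<Rightarrow> (gen list \<times> free_alg) list" where
  "hodge_images q =
    [([], ea * eb * ec * ed),
     ([EA,EB,EC,ED], 1),
     ([EA], - (ea * eb * ec) - scal (mu q) * eb * ec * ed),
     ([EB], - (ea * eb * ed)),
     ([EC], scal (q ^ 2) * ea * ec * ed),
     ([ED], eb * ec * ed),
     ([EA,EB], - (ea * eb) + scal (2 * mu q) * eb * ed),
     ([EA,EC], ea * ec),
     ([EA,ED], scal (1 / (1 + q ^ 2)) * (scal 2 * eb * ec - scal (q ^ 2 * mu q) * ea * ed)),
     ([EB,EC], scal (q ^ 2 / (1 + q ^ 2)) * (scal 2 * ea * ed + scal (mu q) * eb * ec)),
     ([EB,ED], eb * ed),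
     ([EC,ED], - (ec * ed)),
     ([EA,EB,EC], - ea - scal (mu q) * ed),
     ([EA,EB,ED], - eb),
     ([EA,EC,ED], scal (1 / q ^ 2) * ec),
     ([EB,EC,ED], ed)]"

lemma hodge_values_eq: "hodge_values q = (\<lambda>(I, y). (prod_list (map var I), y)) ` set (hodge_images q)"
  by (simp add: hodge_values_def hodge_images_def mult.assoc)

lemma form_prod_var: "form (prod_list (map var us)) = (eword us :: 'a::cubic_root omega)"
  by (induction us) (auto simp: form_simps gel_def)

lemma hodge_images_star:
  fixes q :: complex
  defines "q \<equiv> proot TYPE('a::cubic_root)"
  assumes "(I, y) \<in> set (hodge_images q)"
  shows "form y = (om.lsum eword (star_word I) :: 'a omega)"
proof -
  have qq: "q * q = - 1 - q" unfolding q_def by (rule proot_square)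
  then interpret r: root_of_unity q by unfold_locales
  note c = r.coefficients
  have q1: "q * (- 1 - q) = 1" by (simp add: right_diff_distrib qq)
  then have q0: "q \<noteq> 0" by auto
  have d: "1 / (1 + q\<^sup>2) = 1 + q" "q\<^sup>2 / (1 + q\<^sup>2) = - q" "1 / q\<^sup>2 = q"
  proof -
    \<comment> \<open>All denominators of the prescribed values reduce to this unit and to powers of
      q.\<close>
    have e: "1 + q\<^sup>2 = - q" unfolding c(3) by simp
    show "1 / (1 + q\<^sup>2) = 1 + q" unfolding e using c(4) by simp
    show "q\<^sup>2 / (1 + q\<^sup>2) = - q" unfolding e using q0 by (simp add: power2_eq_square)
    have "q * q\<^sup>2 = 1" unfolding c(3) by (rule q1)
    then show "1 / q\<^sup>2 = q" using q0 by (simp add: divide_eq_eq)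
  qed
  have g: "q\<^sup>2 * mu q = - 2 - q" unfolding c by (simp add: algebra_simps qq)
  have double: "sc (z * 2) * x = sc z * x + sc z * x" "sc 2 * x = x + x" for z and x :: "'a omega"
    using om.scale_left_distrib[of z z x] om.scale_left_distrib[of 1 1 x]
    by (simp_all add: mult_2_right sc_simps(3))
  show ?thesis
    using assms(2) unfolding hodge_images_def unfolding d g set_simps unfolding q_def
    by (elim insertE emptyE; simp only: prod.inject; elim conjE; hypsubst)
      (simp_all add: star_word_def form_simps gel_def[symmetric] sc_def[symmetric] sc_simps(3)
        val_def c(3,5)[unfolded q_def] mult.assoc,
       (simp_all add: algebra_simps qq[unfolded q_def] double)?)
qed

lemma hodge_values_star:
  fixes q :: complex
  defines "q \<equiv> proot TYPE('a::cubic_root)"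
  shows "(x, y) \<in> hodge_values q \<Longrightarrow> \<exists>I\<in>set ekeys. form x = (eword I :: 'a omega) \<and> form y = (om.lsum eword (star_word I) :: 'a omega)"
    and "I \<in> set ekeys \<Longrightarrow> \<exists>(x, y)\<in>hodge_values q. form x = (eword I :: 'a omega) \<and> form y = (om.lsum eword (star_word I) :: 'a omega)"
proof -
  have keys: "fst ` set (hodge_images q) = set ekeys" by (auto simp: hodge_images_def ekeys_def)
  assume "(x, y) \<in> hodge_values q"
  then obtain I where I: "(I, y) \<in> set (hodge_images q)" "x = prod_list (map var I)"
    unfolding hodge_values_eq by auto
  then have "I \<in> set ekeys" using keys by force
  then show "\<exists>I\<in>set ekeys. form x = (eword I :: 'a omega) \<and> form y = (om.lsum eword (star_word I) :: 'a omega)"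
    using hodge_images_star[where 'a = 'a] I form_prod_var unfolding q_def by blast
next
  have keys: "fst ` set (hodge_images q) = set ekeys" by (auto simp: hodge_images_def ekeys_def)
  assume "I \<in> set ekeys"
  then obtain y where y: "(I, y) \<in> set (hodge_images q)" using keys by force
  then have "(prod_list (map var I), y) \<in> hodge_values q" unfolding hodge_values_eq by force
  then show "\<exists>(x, y)\<in>hodge_values q. form x = (eword I :: 'a omega) \<and> form y = (om.lsum eword (star_word I) :: 'a omega)"
    using hodge_images_star[where 'a = 'a] y form_prod_var unfolding q_def by blast
qed

text \<open>Restricted to the carrier because \<open>is_hodge\<close> demands an extensional
  function; with this the description by \<open>THE\<close> has a unique solution.\<close>

definition hodge_fun :: "'a::cubic_root itself \<Rightarrow> free_alg set \<Rightarrow> free_alg set" where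
  "hodge_fun _ = (\<lambda>X\<in>carrier (Omega (proot TYPE('a))). to_coset (star (inv_into UNIV to_coset X :: 'a omega)))"

lemma hodge_fun_to_coset: "hodge_fun TYPE('a) (to_coset w) = to_coset (star (w :: 'a::cubic_root omega))"
proof -
  have "inj (to_coset :: 'a omega \<Rightarrow> _)" by (rule injI) (simp add: to_coset_eq_iff)
  then show ?thesis by (simp add: hodge_fun_def Omega_simps)
qed

lemma is_hodge_fun: "is_hodge (proot TYPE('a)) (hodge_fun TYPE('a::cubic_root))"
  unfolding is_hodge_def
proof (intro conjI allI impI ballI)
  show "hodge_fun TYPE('a) \<in> extensional (carrier (Omega (proot TYPE('a))))"
    by (simp add: hodge_fun_def)
next
  fix i :: nat
  show "hodge_fun TYPE('a) \<in> Forms (proot TYPE('a)) i \<rightarrow> Forms (proot TYPE('a)) (4 - i)"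
    using star_forms[of _ i, where 'a = 'a] by (auto simp: Forms_eq hodge_fun_to_coset)
next
  fix v w assume "v \<in> carrier (Omega (proot TYPE('a)))" "w \<in> carrier (Omega (proot TYPE('a)))"
  then obtain x y :: "'a omega" where "v = to_coset x" "w = to_coset y" by (auto simp: Omega_simps)
  then show "hodge_fun TYPE('a) (v \<oplus>\<^bsub>Omega (proot TYPE('a))\<^esub> w) =
      hodge_fun TYPE('a) v \<oplus>\<^bsub>Omega (proot TYPE('a))\<^esub> hodge_fun TYPE('a) w"
    by (simp add: Omega_simps hodge_fun_to_coset star_add)
next
  fix w f assume "w \<in> carrier (Omega (proot TYPE('a)))" "f \<in> Fun_alg (proot TYPE('a))"
  then obtain x y :: "'a omega" where "w = to_coset x" "f = to_coset y" "y \<in> forms 0" by (auto simp: Omega_simps Fun_alg_eq)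
  then show "hodge_fun TYPE('a) (w \<otimes>\<^bsub>Omega (proot TYPE('a))\<^esub> f) =
      hodge_fun TYPE('a) w \<otimes>\<^bsub>Omega (proot TYPE('a))\<^esub> f"
    by (simp add: Omega_simps hodge_fun_to_coset star_right_linear)
next
  fix p assume "p \<in> hodge_values (proot TYPE('a))"
  then obtain x y I where p: "p = (x, y)" "I \<in> set ekeys" "form x = (eword I :: 'a omega)"
      "form y = (om.lsum eword (star_word I) :: 'a omega)"
    using hodge_values_star(1)[where 'a = 'a] by (cases p) blast
  have one: "1 \<in> (forms 0 :: 'a omega set)"
    using fword_forms_0[of "(0, 0, 0)", where 'a = 'a] by (simp add: fword_def tkeys_def)
  have "hodge_fun TYPE('a) (to_coset (form x :: 'a omega)) = to_coset (form y :: 'a omega)"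
    unfolding hodge_fun_to_coset p(3,4) using star_eword_mult[OF p(2) one] by simp
  then show "case p of (x, y) \<Rightarrow> hodge_fun TYPE('a) (cls (proot TYPE('a)) x) = cls (proot TYPE('a)) y"
    by (simp add: p(1) to_coset_form)
qed

text \<open>Additivity, right linearity over functions and the values on the e_I determine the
  operator on every normal word e_I f, hence everywhere.\<close>

lemma is_hodge_unique:
  assumes "is_hodge (proot TYPE('a::cubic_root)) S"
  shows "S = hodge_fun TYPE('a)"
proof -
  let ?q = "proot TYPE('a)"
  have ext: "S \<in> extensional (carrier (Omega ?q))"
    and S_add: "S (to_coset (x + y)) = S (to_coset x) \<oplus>\<^bsub>Omega ?q\<^esub> S (to_coset y)"
    and S_mult: "f \<in> forms 0 \<Longrightarrow> S (to_coset (x * f)) = S (to_coset x) \<otimes>\<^bsub>Omega ?q\<^esub> to_coset f"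
    and S_val: "(u, v) \<in> hodge_values ?q \<Longrightarrow> S (to_coset (form u :: 'a omega)) = to_coset (form v :: 'a omega)"
    for x y f :: "'a omega" and u v
    using assms unfolding is_hodge_def Omega_simps(3)[symmetric] Omega_simps(2)[symmetric]
    by (auto simp: Omega_simps(1) Fun_alg_eq to_coset_form)
  \<comment> \<open>\<open>is_hodge\<close> states additivity but not complex homogeneity. Constants
    are functions and central, so homogeneity is the case of right linearity in which the function
    is constant.\<close>
  have sc0: "sc z \<in> (forms 0 :: 'a omega set)" for z
    using om.subspace_scale[OF forms_subspace[of 0, where 'a = 'a] fword_forms_0[of "(0, 0, 0)"], of z] by (simp add: fword_def tkeys_def)
  have "w \<in> om.span (nword ` set bkeys) \<Longrightarrow> S (to_coset w) = to_coset (star w)" for w :: "'a omega"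
  proof (erule om.span_induct)
    have sc: "S (to_coset (sc z * x)) = to_coset (star (sc z * x))" if "S (to_coset x) = to_coset (star x)" for z and x :: "'a omega"
      using S_mult[OF sc0, of x z] that by (simp add: Omega_simps star_scale sc_commute[symmetric] star_right_linear[OF sc0])
    have nword: "S (to_coset (nword k :: 'a omega)) = to_coset (star (nword k :: 'a omega))" if kb: "k \<in> set bkeys" for k
    proof -
      obtain I t where k: "k = (I, t)" "I \<in> set ekeys" "t \<in> set tkeys" using kb by (rule bkeysE)
      obtain x y where "(x, y) \<in> hodge_values ?q" "form x = (eword I :: 'a omega)"
          "form y = (om.lsum eword (star_word I) :: 'a omega)"
        using hodge_values_star(2)[OF k(2), where 'a = 'a] by blast
      then have "S (to_coset (eword I :: 'a omega)) = to_coset (om.lsum eword (star_word I) :: 'a omega)"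
        using S_val by metis
      then show ?thesis
        using S_mult[OF fword_forms_0[OF k(3)], of "eword I"] star_eword_mult[OF k(2) fword_forms_0[OF k(3)], where 'a = 'a]
        by (simp add: k nword_def Omega_simps)
    qed
    show "om.subspace {w :: 'a omega. S (to_coset w) = to_coset (star w)}"
    proof (rule om.subspaceI)
      have "unit_key \<in> set bkeys" by (simp add: unit_key_def bkeys_def ekeys_def tkeys_def)
      from sc[OF nword[OF this], of 0] show "0 \<in> {w :: 'a omega. S (to_coset w) = to_coset (star w)}" by simp
    qed (auto simp: S_add Omega_simps star_add sc)
    fix x :: "'a omega" assume "x \<in> nword ` set bkeys"
    then show "S (to_coset x) = to_coset (star x)" using nword by blast
  qed
  then have "S (to_coset w) = hodge_fun TYPE('a) (to_coset w)" for w :: "'a omega"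
    by (simp add: span_nword hodge_fun_to_coset)
  moreover have "hodge_fun TYPE('a) \<in> extensional (carrier (Omega ?q))" by (simp add: hodge_fun_def)
  ultimately show ?thesis
    using ext by (intro extensionalityI) (auto simp: Omega_simps(1))
qed

lemma hodge_to_coset: "hodge (proot TYPE('a)) (to_coset w) = to_coset (star (w :: 'a::cubic_root omega))"
proof -
  have "hodge (proot TYPE('a)) = hodge_fun TYPE('a)"
    unfolding hodge_def using is_hodge_fun[where 'a = 'a] is_hodge_unique[where 'a = 'a] by (rule the_equality)
  then show ?thesis by (simp add: hodge_fun_to_coset)
qed

section \<open>Kernel of the Maxwell operator modulo exact forms\<close>

definition exact_set :: "'a::cubic_root omega set" where
  "exact_set = diff 0 ` forms 0"

definition max_ker :: "'a::cubic_root omega set" where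
  "max_ker = {A \<in> forms 1. maxwell A = 0}"

definition sd_forms :: "'a::cubic_root omega set" where
  "sd_forms = {A \<in> max_ker. star (diff 1 A) = diff 1 A}"

definition asd_forms :: "'a::cubic_root omega set" where
  "asd_forms = {A \<in> max_ker. star (diff 1 A) = - diff 1 A}"

definition flat_forms :: "'a::cubic_root omega set" where
  "flat_forms = {A \<in> max_ker. diff 1 A = 0}"

lemma diff_exact: "A \<in> exact_set \<Longrightarrow> diff 1 A = (0 :: 'a::cubic_root omega)"
  using diff_square[of 0, where 'a = 'a] by (auto simp: exact_set_def)

lemma maxwell_linear: "maxwell (A + B) = maxwell A + maxwell B" "maxwell (sc z * A) = sc z * maxwell A"
  by (simp_all add: maxwell_def diff_add diff_scale star_add star_scale)

lemma forms_closed: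
  fixes x y :: "'a::cubic_root omega"
  shows "0 \<in> (forms i :: 'a omega set)" "x \<in> forms i \<Longrightarrow> y \<in> forms i \<Longrightarrow> x + y \<in> forms i" "x \<in> forms i \<Longrightarrow> sc z * x \<in> forms i"
  using forms_subspace[of i, where 'a = 'a] unfolding om.subspace_def by auto

lemma maxwell_zero: "maxwell 0 = (0 :: 'a::cubic_root omega)"
  by (simp add: maxwell_def)

lemma exact_subspace: "om.subspace (exact_set :: 'a::cubic_root omega set)"
proof (rule om.subspaceI)
  show "0 \<in> (exact_set :: 'a omega set)"
    unfolding exact_set_def by (rule image_eqI[of _ _ 0]) (simp_all add: forms_closed)
next
  fix x y :: "'a omega" assume "x \<in> exact_set" "y \<in> exact_set"
  then obtain u v where "x = diff 0 u" "y = diff 0 v" "u \<in> forms 0" "v \<in> forms 0" by (auto simp: exact_set_def)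
  then show "x + y \<in> exact_set"
    unfolding exact_set_def by (intro image_eqI[of _ _ "u + v"]) (simp_all add: forms_closed diff_add)
next
  fix z and x :: "'a omega" assume "x \<in> exact_set"
  then obtain u where "x = diff 0 u" "u \<in> forms 0" by (auto simp: exact_set_def)
  then show "sc z * x \<in> exact_set"
    unfolding exact_set_def by (intro image_eqI[of _ _ "sc z * u"]) (simp_all add: forms_closed diff_scale)
qed

lemma max_ker_subspace: "om.subspace (max_ker :: 'a::cubic_root omega set)"
  by (rule om.subspaceI) (auto simp: max_ker_def forms_closed maxwell_linear maxwell_zero)

lemma om_subspace_closed:
  "om.subspace (S :: 'a::cubic_root omega set) \<Longrightarrow> 0 \<in> S \<and> (\<forall>x\<in>S. \<forall>y\<in>S. x + y \<in> S) \<and> (\<forall>z. \<forall>x\<in>S. sc z * x \<in> S)"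
  unfolding om.subspace_def by auto

lemma dual_subspaces:
  "om.subspace (sd_forms :: 'a::cubic_root omega set)" "om.subspace (asd_forms :: 'a omega set)" "om.subspace (flat_forms :: 'a omega set)"
proof -
  note K = om_subspace_closed[OF max_ker_subspace, where 'a = 'a]
  show "om.subspace (sd_forms :: 'a omega set)"
    using K by (intro om.subspaceI) (auto simp: sd_forms_def diff_add diff_scale star_add star_scale)
  show "om.subspace (asd_forms :: 'a omega set)"
    using K by (intro om.subspaceI) (auto simp: asd_forms_def diff_add diff_scale star_add star_scale)
  show "om.subspace (flat_forms :: 'a omega set)"
    using K by (intro om.subspaceI) (auto simp: flat_forms_def diff_add diff_scale)
qed

lemma exact_closed: "(exact_set :: 'a::cubic_root omega set) \<subseteq> flat_forms"
proof
  fix A :: "'a omega" assume A: "A \<in> exact_set"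
  then have "A \<in> forms 1" using diff_forms[of _ 0, where 'a = 'a] by (auto simp: exact_set_def)
  then show "A \<in> flat_forms" using diff_exact[OF A] by (simp add: flat_forms_def max_ker_def maxwell_def)
qed

lemma closed_dual: "(flat_forms :: 'a::cubic_root omega set) \<subseteq> sd_forms \<inter> asd_forms"
  by (auto simp: flat_forms_def sd_forms_def asd_forms_def)

lemma dual_max_ker: "(sd_forms :: 'a::cubic_root omega set) \<subseteq> max_ker" "(asd_forms :: 'a omega set) \<subseteq> max_ker"
    "(flat_forms :: 'a omega set) \<subseteq> max_ker"
  by (auto simp: flat_forms_def sd_forms_def asd_forms_def)

lemma two_torsion: "x = - x \<Longrightarrow> x = (0 :: 'a::cubic_root omega)"
proof -
  assume "x = - x"
  then have "x + x = 0" by (metis add.right_inverse)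
  then have "sc (1 / 2) * (sc 2 * x) = 0"
    using om.scale_left_distrib[of 1 1 x] by (simp add: sc_simps)
  then show ?thesis by (simp add: sc_simps(3))
qed

lemma sd_asd_closed: "(sd_forms \<inter> asd_forms :: 'a::cubic_root omega set) \<subseteq> flat_forms"
  using two_torsion by (fastforce simp: flat_forms_def sd_forms_def asd_forms_def)

text \<open>If the Hodge operator maps dw to dw or -dw, then d star dw equals d d w up to sign and
  is zero.\<close>

lemma basis_form_max_ker:
  assumes "j < 28" "star (diff 1 (basis_form j)) = diff 1 (basis_form j :: 'a::cubic_root omega) \<or>
    star (diff 1 (basis_form j)) = - diff 1 (basis_form j :: 'a omega)"
  shows "basis_form j \<in> (max_ker :: 'a omega set)"
proof -
  have "diff 2 (diff 1 (basis_form j)) = (0 :: 'a omega)"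
    using diff_square[of 1 "basis_form j :: 'a omega"] by (simp add: numeral_2_eq_2)
  then have "diff 2 (star (diff 1 (basis_form j))) = (0 :: 'a omega)"
    using assms(2) by (auto simp: diff_minus)
  then show ?thesis
    using basis_form_forms[OF assms(1), where 'a = 'a] by (simp add: max_ker_def maxwell_def)
qed

lemma basis_form_mem:
  "j < 4 \<Longrightarrow> basis_form j \<in> (flat_forms :: 'a::cubic_root omega set)"
  "j < 16 \<Longrightarrow> basis_form j \<in> (sd_forms :: 'a omega set)"
  "j < 4 \<or> 16 \<le> j \<and> j < 28 \<Longrightarrow> basis_form j \<in> (asd_forms :: 'a omega set)"
  "j < 28 \<Longrightarrow> basis_form j \<in> (max_ker :: 'a omega set)"
proof -
  show c: "basis_form j \<in> (flat_forms :: 'a omega set)" if "j < 4" for j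
    using basis_form_max_ker[of j, where 'a = 'a] basis_flat[OF that, where 'a = 'a] that
    by (simp add: flat_forms_def)
  show s: "basis_form j \<in> (sd_forms :: 'a omega set)" if "j < 16" for j
  proof (cases "j < 4")
    case True
    then show ?thesis using c closed_dual by blast
  next
    case False
    then show ?thesis
      using basis_form_max_ker[of j, where 'a = 'a] basis_sd[of j, where 'a = 'a] that by (simp add: sd_forms_def)
  qed
  show a: "basis_form j \<in> (asd_forms :: 'a omega set)" if "j < 4 \<or> 16 \<le> j \<and> j < 28" for j
  proof (cases "j < 4")
    case True
    then show ?thesis using c closed_dual by blast
  next
    case False
    then show ?thesis
      using basis_form_max_ker[of j, where 'a = 'a] basis_asd[of j, where 'a = 'a] that by (simp add: asd_forms_def)
  qed
  show "basis_form j \<in> (max_ker :: 'a omega set)" if "j < 28"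
    using s[of j] a[of j] dual_max_ker that by (cases "j < 16") auto
qed

lemma max_ker_decomposition:
  assumes "A \<in> (max_ker :: 'a::cubic_root omega set)"
  shows "A - (\<Sum>j<28. sc (coefficient j A / 12) * basis_form j) \<in> exact_set"
proof -
  have A: "A \<in> forms 1" "maxwell A = 0" using assms by (auto simp: max_ker_def)
  let ?h = "lin_of (entry exact_part) A"
  have "A = sc (1 / 12) * (sc 12 * A)" by (simp add: sc_simps(3))
  also have "\<dots> = sc (1 / 12) * ((\<Sum>j<28. sc (coefficient j A) * basis_form j) + diff 0 ?h)"
    unfolding decomposition[OF A(1)] A(2) using lin_of_scale[of _ 0 "0 :: 'a omega"] by simp
  also have "\<dots> = (\<Sum>j<28. sc (coefficient j A / 12) * basis_form j) + diff 0 (sc (1 / 12) * ?h)"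
    by (simp add: distrib_left om.scale_sum_right diff_scale)
  finally have "A - (\<Sum>j<28. sc (coefficient j A / 12) * basis_form j) = diff 0 (sc (1 / 12) * ?h)"
    by (simp add: algebra_simps)
  then show ?thesis
    unfolding exact_set_def using lin_of_exact_forms[OF A(1)] forms_closed(3) by blast
qed

lemma exactI:
  assumes "A \<in> (max_ker :: 'a::cubic_root omega set)" "\<And>j. j < 28 \<Longrightarrow> coefficient j A = 0"
  shows "A \<in> exact_set"
proof -
  have "(\<Sum>j<28. sc (coefficient j A / 12) * basis_form j) = (0 :: 'a omega)"
    by (rule sum.neutral) (simp add: assms(2))
  then show ?thesis using max_ker_decomposition[OF assms(1)] by simp
qed

text \<open>The functional changes sign under the Hodge operator while the curvature is fixed by it,
  so its value equals its own negative.\<close>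

lemma coefficient_sd: "A \<in> (sd_forms :: 'a::cubic_root omega set) \<Longrightarrow> 16 \<le> j \<Longrightarrow> j < 28 \<Longrightarrow> coefficient j A = 0"
  using coefficient_curvature[of j A] covec_star(2)[of "diff 1 A" j] diff_forms[of A 1]
  by (simp add: sd_forms_def max_ker_def numeral_2_eq_2)

lemma coefficient_asd: "A \<in> (asd_forms :: 'a::cubic_root omega set) \<Longrightarrow> 4 \<le> j \<Longrightarrow> j < 16 \<Longrightarrow> coefficient j A = 0"
  using coefficient_curvature[of j A] covec_star(1)[of "diff 1 A" j] diff_forms[of A 1]
  by (simp add: asd_forms_def max_ker_def numeral_2_eq_2 covec_minus)

lemma coefficient_closed: "A \<in> (flat_forms :: 'a::cubic_root omega set) \<Longrightarrow> 4 \<le> j \<Longrightarrow> j < 28 \<Longrightarrow> coefficient j A = 0"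
  using coefficient_curvature[of j A] by (simp add: flat_forms_def max_ker_def covec_zero)

section \<open>Transport to the presented algebra\<close>

lemma exact_forms_to_coset: "exact_forms (proot TYPE('a)) = to_coset ` (exact_set :: 'a::cubic_root omega set)"
  unfolding exact_forms_def Forms_eq exact_set_def by (simp add: image_image dext_to_coset)

lemma ker_Max_to_coset: "ker_Max (proot TYPE('a)) = to_coset ` (max_ker :: 'a::cubic_root omega set)"
proof -
  have "Max_op (proot TYPE('a)) (to_coset A) = to_coset (maxwell A)" for A :: "'a omega"
    by (simp add: Max_op_def codiff_def dext_to_coset hodge_to_coset maxwell_def)
  then show ?thesis by (auto simp: ker_Max_def Forms_eq max_ker_def Omega_simps(4) to_coset_eq_iff)
qed

lemma dual_to_coset:
  "self_dual (proot TYPE('a)) = to_coset ` (sd_forms :: 'a::cubic_root omega set)"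
  "antiself_dual (proot TYPE('a)) = to_coset ` (asd_forms :: 'a omega set)"
  "flat (proot TYPE('a)) = to_coset ` (flat_forms :: 'a omega set)"
  by (auto simp: self_dual_def antiself_dual_def flat_def sd_forms_def asd_forms_def flat_forms_def ker_Max_to_coset curvature_def
      dext_to_coset hodge_to_coset to_coset_eq_iff Omega_minus Omega_simps(4))

text \<open>The class of A modulo exact forms, as it appears in \<open>Max_quot\<close>: a set whose
  elements are themselves cosets of the ideal.\<close>

definition form_class :: "'a::cubic_root omega \<Rightarrow> free_alg set set" where
  "form_class A = (\<lambda>X. to_coset (X + A)) ` exact_set"

lemma coset_form_class:
  assumes "add V = add (Omega (proot TYPE('a::cubic_root)))"
  shows "exact_forms (proot TYPE('a)) +>\<^bsub>V\<^esub> to_coset A = form_class (A :: 'a omega)"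
  unfolding exact_forms_to_coset form_class_def a_r_coset_def r_coset_def
  by (auto simp: assms Omega_simps)

lemma form_class_eq_iff: "form_class A = form_class B \<longleftrightarrow> A - B \<in> (exact_set :: 'a::cubic_root omega set)"
proof
  note E = om_subspace_closed[OF exact_subspace, where 'a = 'a]
  assume "form_class A = form_class B"
  moreover have "to_coset (0 + A) \<in> form_class A" unfolding form_class_def using E by blast
  ultimately obtain X where "X \<in> exact_set" "0 + A = X + B" by (auto simp: form_class_def to_coset_eq_iff)
  then show "A - B \<in> exact_set" by simp
next
  note E = om_subspace_closed[OF exact_subspace, where 'a = 'a]
  assume AB: "A - B \<in> (exact_set :: 'a omega set)"
  then have BA: "B - A \<in> exact_set" using E om.subspace_neg[OF exact_subspace AB] by simp
  have "form_class A \<subseteq> form_class B" if "A - B \<in> exact_set" for A B :: "'a omega"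
  proof
    fix c assume "c \<in> form_class A"
    then obtain X where "X \<in> exact_set" "c = to_coset (X + A)" by (auto simp: form_class_def)
    moreover from this have "X + (A - B) \<in> exact_set" using that E by blast
    ultimately show "c \<in> form_class B"
      unfolding form_class_def by (intro image_eqI[of _ _ "X + (A - B)"]) simp_all
  qed
  then show "form_class A = form_class B" using AB BA by blast
qed

lemma Ker_Max_space_image:
  "vs_image (\<lambda>z x :: 'a::cubic_root omega. sc z * x) (Ker_Max_space (proot TYPE('a))) to_coset max_ker"
  unfolding Ker_Max_space_def ker_Max_to_coset
  by (rule vs_image.restrict[OF omega_image max_ker_subspace]) simp

lemma Max_quot_image:
  "vs_image (\<lambda>z x :: 'a::cubic_root omega. sc z * x) (Max_quot (proot TYPE('a))) form_class max_ker"
proof unfold_locales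
  let ?q = "proot TYPE('a)"
  note E = om_subspace_closed[OF exact_subspace, where 'a = 'a]
  have add: "add (Ker_Max_space ?q) = add (Omega ?q)" by (simp add: Ker_Max_space_def)
  have smult: "smult (Ker_Max_space ?q) = smult (Omega ?q)" by (simp add: Ker_Max_space_def)
  note coset = coset_form_class[OF add]
  show "om.subspace (max_ker :: 'a omega set)" by (rule max_ker_subspace)
  show "carrier (Max_quot ?q) = form_class ` (max_ker :: 'a omega set)"
  proof -
    have "carrier (Ker_Max_space ?q) = to_coset ` (max_ker :: 'a omega set)"
      by (simp add: Ker_Max_space_def ker_Max_to_coset)
    then show ?thesis
      unfolding Max_quot_def quot_space_def by (auto simp: A_RCOSETS_def' coset)
  qed
  show "\<zero>\<^bsub>Max_quot ?q\<^esub> = form_class (0 :: 'a omega)"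
    by (simp add: Max_quot_def quot_space_def exact_forms_to_coset form_class_def)
  fix x y :: "'a omega"
  show "form_class x \<oplus>\<^bsub>Max_quot ?q\<^esub> form_class y = form_class (x + y)"
  proof -
    have "form_class x \<oplus>\<^bsub>Max_quot ?q\<^esub> form_class y = (\<Union>X\<in>exact_set. \<Union>Y\<in>exact_set. {to_coset ((X + x) + (Y + y))})"
      unfolding Max_quot_def quot_space_def set_add_def set_mult_def form_class_def
      by (simp add: add Omega_simps)
    also have "\<dots> = form_class (x + y)"
    proof (intro equalityI subsetI)
      fix c assume "c \<in> (\<Union>X\<in>exact_set. \<Union>Y\<in>exact_set. {to_coset ((X + x) + (Y + y))})"
      then obtain X Y where XY: "X \<in> exact_set" "Y \<in> exact_set" "c = to_coset ((X + x) + (Y + y))" by blast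
      then have "c = to_coset ((X + Y) + (x + y))" by (simp add: add_ac)
      then show "c \<in> form_class (x + y)" using XY E unfolding form_class_def by blast
    next
      fix c assume "c \<in> form_class (x + y)"
      then obtain X where "X \<in> exact_set" "c = to_coset (X + (x + y))" by (auto simp: form_class_def)
      then have "c = to_coset ((X + x) + (0 + y))" "X \<in> exact_set" by (simp_all add: add_ac)
      then show "c \<in> (\<Union>X\<in>exact_set. \<Union>Y\<in>exact_set. {to_coset ((X + x) + (Y + y))})" using E by blast
    qed
    finally show ?thesis .
  qed
  fix z
  show "z \<odot>\<^bsub>Max_quot ?q\<^esub> form_class x = form_class (sc z * x)"
  proof -
    have "z \<odot>\<^bsub>Max_quot ?q\<^esub> form_class x = (\<Union>X\<in>exact_set. form_class (sc z * (X + x)))"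
      unfolding Max_quot_def quot_space_def form_class_def[of x] by (simp add: smult Omega_simps coset)
    also have "\<dots> = (\<Union>X\<in>(exact_set :: 'a omega set). form_class (sc z * x))"
    proof (rule SUP_cong[OF refl])
      fix X :: "'a omega" assume "X \<in> exact_set"
      then show "form_class (sc z * (X + x)) = form_class (sc z * x)"
        unfolding form_class_eq_iff using E by (simp add: distrib_left)
    qed
    also have "\<dots> = form_class (sc z * x)" using E by blast
    finally show ?thesis .
  qed
qed

lemma quot_classes_to_coset: "quot_classes (proot TYPE('a)) (to_coset ` S) = form_class ` (S :: 'a::cubic_root omega set)"
  unfolding quot_classes_def image_image by (simp add: coset_form_class)

text \<open>J is the set of indices whose forms lie in S. The coefficients outside J vanish on S,
  and in ker Max the vanishing of all 28 means exactness; so those in J detect exactness on S and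
  count its dimension modulo exact forms.\<close>

lemma has_dim_classes:
  fixes S :: "'a::cubic_root omega set"
  assumes "om.subspace S" "exact_set \<subseteq> S" "S \<subseteq> max_ker" "J \<subseteq> {..<28}"
    and mem: "\<And>j. j \<in> J \<Longrightarrow> basis_form j \<in> S"
    and van: "\<And>j A. j < 28 \<Longrightarrow> j \<notin> J \<Longrightarrow> A \<in> S \<Longrightarrow> coefficient j A = 0"
  shows "has_dim ((Max_quot (proot TYPE('a)))\<lparr>carrier := form_class ` S\<rparr>) (card J)"
proof (rule vs_image.dual_basis_dim[OF vs_image.restrict[OF Max_quot_image assms(1,3)], of J basis_form "\<lambda>j A. coefficient j A / 12"])
  show "finite J" using assms(4) finite_subset by blast
  show "basis_form j \<in> S" if "j \<in> J" for j by (rule mem[OF that])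
  show "coefficient j (x + y) / 12 = coefficient j x / 12 + coefficient j y / 12" for j and x y :: "'a omega"
    by (simp add: pairing_add add_divide_distrib)
  show "coefficient j (sc z * x) / 12 = z * (coefficient j x / 12)" for j z and x :: "'a omega"
    by (simp add: pairing_scale)
  show "coefficient i (basis_form j :: 'a omega) / 12 = (if i = j then 1 else 0)" if "i \<in> J" "j \<in> J" for i j
  proof -
    have "i < 28" "j < 28" using that assms(4) by auto
    then show ?thesis by (simp add: coefficient_basis_form)
  qed
  show "form_class x = form_class (0 :: 'a omega) \<longleftrightarrow> (\<forall>j\<in>J. coefficient j x / 12 = 0)" if x: "x \<in> S" for x
  proof
    assume "form_class x = form_class (0 :: 'a omega)"
    then have "x \<in> exact_set" by (simp add: form_class_eq_iff)
    then show "\<forall>j\<in>J. coefficient j x / 12 = 0"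
      using coefficient_exact[where 'a = 'a] assms(4) by (auto simp: exact_set_def)
  next
    assume "\<forall>j\<in>J. coefficient j x / 12 = 0"
    then have "coefficient j x = 0" if "j < 28" for j using van[OF that _ x] by (cases "j \<in> J") auto
    then have "x \<in> exact_set" using exactI assms(3) x by blast
    then show "form_class x = form_class (0 :: 'a omega)" by (simp add: form_class_eq_iff)
  qed
qed

lemma sum_mem:
  assumes "om.subspace (S :: 'a::cubic_root omega set)" "\<And>j. j \<in> J \<Longrightarrow> basis_form j \<in> S"
  shows "(\<Sum>j\<in>J. sc (c j) * basis_form j) \<in> S"
  using assms by (intro om.subspace_sum[OF assms(1)] om.subspace_scale[OF assms(1)]) auto

text \<open>The forms with index below 16 are self-dual and the remaining ones antiself-dual. The
  four flat forms belong to both kinds; here they are counted in the self-dual summand.\<close>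

lemma max_ker_split:
  assumes "A \<in> (max_ker :: 'a::cubic_root omega set)"
  shows "\<exists>S\<in>sd_forms. \<exists>T\<in>asd_forms. \<exists>X\<in>exact_set. A = S + T + X"
proof -
  let ?t = "\<lambda>j. sc (coefficient j A / 12) * basis_form j :: 'a omega"
  have "{..<28} = {..<16} \<union> {16..<28 :: nat}" by auto
  moreover have "sum ?t ({..<16} \<union> {16..<28}) = sum ?t {..<16} + sum ?t {16..<28}"
    by (rule sum.union_disjoint) auto
  ultimately have "sum ?t {..<28} = sum ?t {..<16} + sum ?t {16..<28}" by simp
  then have "A = sum ?t {..<16} + sum ?t {16..<28} + (A - sum ?t {..<28})"
    by simp
  moreover have "sum ?t {..<16} \<in> sd_forms"
    by (rule sum_mem[OF dual_subspaces(1)]) (simp add: basis_form_mem)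
  moreover have "sum ?t {16..<28} \<in> asd_forms"
    by (rule sum_mem[OF dual_subspaces(2)]) (simp add: basis_form_mem)
  ultimately show ?thesis using max_ker_decomposition[OF assms] by blast
qed

text \<open>Equal classes may have different representatives S and T, but these differ by an exact
  form, which has zero curvature. Hence S is itself antiself-dual, and a curvature equal to its own
  negative is zero.\<close>

lemma classes_inter:
  "form_class ` (sd_forms :: 'a::cubic_root omega set) \<inter> form_class ` (asd_forms :: 'a omega set)
    = form_class ` (flat_forms :: 'a omega set)"
proof
  show "form_class ` (flat_forms :: 'a omega set) \<subseteq> form_class ` (sd_forms :: 'a omega set) \<inter> form_class ` (asd_forms :: 'a omega set)"
    using closed_dual[where 'a = 'a] by blast
  show "form_class ` (sd_forms :: 'a omega set) \<inter> form_class ` (asd_forms :: 'a omega set) \<subseteq> form_class ` (flat_forms :: 'a omega set)"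
  proof
    fix c assume "c \<in> form_class ` (sd_forms :: 'a omega set) \<inter> form_class ` (asd_forms :: 'a omega set)"
    then obtain S T :: "'a omega" where ST: "S \<in> sd_forms" "T \<in> asd_forms" "c = form_class S" "form_class S = form_class T"
      by blast
    then have "S - T \<in> exact_set" by (simp add: form_class_eq_iff)
    then have "(S - T) + T \<in> asd_forms"
      using ST(2) exact_closed closed_dual om_subspace_closed[OF dual_subspaces(2), where 'a = 'a] by blast
    then have "S \<in> flat_forms" using ST(1) sd_asd_closed[where 'a = 'a] by auto
    then show "c \<in> form_class ` (flat_forms :: 'a omega set)" using ST(3) by blast
  qed
qed

lemma maxwell_theorem:
  fixes q :: complex
  defines "q \<equiv> proot TYPE('a::cubic_root)"
  shows "VectorSpace.subspace class_ring (exact_forms q) (Ker_Max_space q)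
    \<and> has_dim (Max_quot q) 28
    \<and> VectorSpace.subspace class_ring (quot_classes q (self_dual q)) (Max_quot q)
    \<and> has_dim ((Max_quot q)\<lparr>carrier := quot_classes q (self_dual q)\<rparr>) 16
    \<and> VectorSpace.subspace class_ring (quot_classes q (antiself_dual q)) (Max_quot q)
    \<and> has_dim ((Max_quot q)\<lparr>carrier := quot_classes q (antiself_dual q)\<rparr>) 16
    \<and> (\<forall>A\<in>ker_Max q. \<exists>S\<in>self_dual q. \<exists>T\<in>antiself_dual q. \<exists>X\<in>exact_forms q.
         A = S \<oplus>\<^bsub>Omega q\<^esub> T \<oplus>\<^bsub>Omega q\<^esub> X)
    \<and> quot_classes q (self_dual q) \<inter> quot_classes q (antiself_dual q) = quot_classes q (flat q)
    \<and> has_dim ((Max_quot q)\<lparr>carrier := quot_classes q (flat q)\<rparr>) 4"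
  unfolding q_def dual_to_coset quot_classes_to_coset exact_forms_to_coset ker_Max_to_coset
proof (intro conjI)
  let ?Q = "Max_quot (proot TYPE('a))"
  have incl: "(exact_set :: 'a omega set) \<subseteq> max_ker" "(exact_set :: 'a omega set) \<subseteq> sd_forms" "(exact_set :: 'a omega set) \<subseteq> asd_forms"
    using exact_closed closed_dual dual_max_ker by blast+
  show "VectorSpace.subspace class_ring (to_coset ` (exact_set :: 'a omega set)) (Ker_Max_space (proot TYPE('a)))"
    by (rule vs_image.image_subspace[OF Ker_Max_space_image exact_subspace incl(1)])
  show "VectorSpace.subspace class_ring (form_class ` (sd_forms :: 'a omega set)) ?Q"
    by (rule vs_image.image_subspace[OF Max_quot_image dual_subspaces(1) dual_max_ker(1)])
  show "VectorSpace.subspace class_ring (form_class ` (asd_forms :: 'a omega set)) ?Q"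
    by (rule vs_image.image_subspace[OF Max_quot_image dual_subspaces(2) dual_max_ker(2)])
  have "?Q\<lparr>carrier := form_class ` (max_ker :: 'a omega set)\<rparr> = ?Q"
    using vs_image.carrier_eq[OF Max_quot_image[where 'a = 'a]] by simp
  moreover have "has_dim (?Q\<lparr>carrier := form_class ` (max_ker :: 'a omega set)\<rparr>) (card {..<28 :: nat})"
    by (rule has_dim_classes[OF max_ker_subspace incl(1)]) (auto simp: basis_form_mem)
  ultimately show "has_dim ?Q 28" by simp
  have "has_dim (?Q\<lparr>carrier := form_class ` (sd_forms :: 'a omega set)\<rparr>) (card {..<16 :: nat})"
    by (rule has_dim_classes[OF dual_subspaces(1) incl(2) dual_max_ker(1)])
      (auto simp: basis_form_mem intro!: coefficient_sd)
  then show "has_dim (?Q\<lparr>carrier := form_class ` (sd_forms :: 'a omega set)\<rparr>) 16" by simp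
  \<comment> \<open>The four flat forms and the twelve forms of the antiself-dual table; the indices
    between them carry the functionals that vanish on this subspace.\<close>
  have "has_dim (?Q\<lparr>carrier := form_class ` (asd_forms :: 'a omega set)\<rparr>) (card ({..<4} \<union> {16..<28 :: nat}))"
    by (rule has_dim_classes[OF dual_subspaces(2) incl(3) dual_max_ker(2)])
      (auto simp: basis_form_mem intro!: coefficient_asd)
  moreover have "card ({..<4} \<union> {16..<28 :: nat}) = 16"
    by (subst card_Un_disjoint) auto
  ultimately show "has_dim (?Q\<lparr>carrier := form_class ` (asd_forms :: 'a omega set)\<rparr>) 16" by simp
  have "has_dim (?Q\<lparr>carrier := form_class ` (flat_forms :: 'a omega set)\<rparr>) (card {..<4 :: nat})"
    by (rule has_dim_classes[OF dual_subspaces(3) exact_closed dual_max_ker(3)])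
      (auto simp: basis_form_mem intro!: coefficient_closed)
  then show "has_dim (?Q\<lparr>carrier := form_class ` (flat_forms :: 'a omega set)\<rparr>) 4" by simp
  show "form_class ` (sd_forms :: 'a omega set) \<inter> form_class ` (asd_forms :: 'a omega set)
      = form_class ` (flat_forms :: 'a omega set)" by (rule classes_inter)
  show "\<forall>A\<in>to_coset ` (max_ker :: 'a omega set). \<exists>S\<in>to_coset ` (sd_forms :: 'a omega set). \<exists>T\<in>to_coset ` (asd_forms :: 'a omega set).
      \<exists>X\<in>to_coset ` (exact_set :: 'a omega set).
      A = S \<oplus>\<^bsub>Omega (proot TYPE('a))\<^esub> T \<oplus>\<^bsub>Omega (proot TYPE('a))\<^esub> X"
  proof
    fix A assume "A \<in> to_coset ` (max_ker :: 'a omega set)"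
    then obtain B :: "'a omega" where B: "A = to_coset B" "B \<in> max_ker" by blast
    then obtain S T X :: "'a omega" where "S \<in> sd_forms" "T \<in> asd_forms" "X \<in> exact_set" "B = S + T + X"
      using max_ker_split by blast
    then show "\<exists>S\<in>to_coset ` (sd_forms :: 'a omega set). \<exists>T\<in>to_coset ` (asd_forms :: 'a omega set). \<exists>X\<in>to_coset ` (exact_set :: 'a omega set).
        A = S \<oplus>\<^bsub>Omega (proot TYPE('a))\<^esub> T \<oplus>\<^bsub>Omega (proot TYPE('a))\<^esub> X"
      by (intro bexI[of _ "to_coset S"] bexI[of _ "to_coset T"] bexI[of _ "to_coset X"]) (simp_all add: Omega_simps B(1))
  qed
qed

section \<open>The two primitive cube roots of unity as type parameters\<close>

datatype root_plus = Root_plus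
datatype root_minus = Root_minus

instantiation root_plus :: cubic_root
begin

definition proot_root_plus :: "root_plus itself \<Rightarrow> complex" where
  "proot_root_plus _ = Complex (- 1 / 2) (sqrt 3 / 2)"

instance
  by standard (simp_all add: proot_root_plus_def complex_eq_iff power3_eq_cube algebra_simps)

end

instantiation root_minus :: cubic_root
begin

definition proot_root_minus :: "root_minus itself \<Rightarrow> complex" where
  "proot_root_minus _ = Complex (- 1 / 2) (- sqrt 3 / 2)"

instance
  by standard (simp_all add: proot_root_minus_def complex_eq_iff power3_eq_cube algebra_simps)

end

lemma cubic_root_cases:
  fixes q :: complex
  assumes "q ^ 3 = 1" "q \<noteq> 1"
  shows "q = proot TYPE(root_plus) \<or> q = proot TYPE(root_minus)"
proof -
  let ?r = "proot TYPE(root_plus)" and ?s = "proot TYPE(root_minus)"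
  have rs: "?r + ?s = - 1" "?r * ?s = 1"
    by (simp_all add: proot_root_plus_def proot_root_minus_def complex_eq_iff)
  have "(q - ?r) * (q - ?s) = q * q - (?r + ?s) * q + ?r * ?s" by (simp add: algebra_simps)
  then have "(q - 1) * ((q - ?r) * (q - ?s)) = (q - 1) * (q * q + q + 1)" by (simp add: rs)
  also have "\<dots> = q ^ 3 - 1" by (simp add: algebra_simps power3_eq_cube)
  finally show ?thesis using assms by simp
qed

theorem proposition4p7:
  fixes q :: complex
  assumes "q ^ 3 = 1" and "q \<noteq> 1"
  shows "VectorSpace.subspace class_ring (exact_forms q) (Ker_Max_space q)
    \<and> has_dim (Max_quot q) 28
    \<and> VectorSpace.subspace class_ring (quot_classes q (self_dual q)) (Max_quot q)
    \<and> has_dim ((Max_quot q)\<lparr>carrier := quot_classes q (self_dual q)\<rparr>) 16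
    \<and> VectorSpace.subspace class_ring (quot_classes q (antiself_dual q)) (Max_quot q)
    \<and> has_dim ((Max_quot q)\<lparr>carrier := quot_classes q (antiself_dual q)\<rparr>) 16
    \<and> (\<forall>A\<in>ker_Max q. \<exists>S\<in>self_dual q. \<exists>T\<in>antiself_dual q. \<exists>X\<in>exact_forms q.
         A = S \<oplus>\<^bsub>Omega q\<^esub> T \<oplus>\<^bsub>Omega q\<^esub> X)
    \<and> quot_classes q (self_dual q) \<inter> quot_classes q (antiself_dual q) = quot_classes q (flat q)
    \<and> has_dim ((Max_quot q)\<lparr>carrier := quot_classes q (flat q)\<rparr>) 4"
  using cubic_root_cases[OF assms] maxwell_theorem[where 'a = root_plus] maxwell_theorem[where 'a = root_minus]
  by metis

end
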